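(* Let $k$ be a finite field with algebraic closure $\overline{k}$, let $\mathcal{E}_0,\mathcal{E}_1,\mathcal{E}_2$ be elliptic curves defined over $k$, and let $\varphi_0:\mathcal{E}_1\to\mathcal{E}_0$ and $\varphi_1:\mathcal{E}_2\to\mathcal{E}_1$ be two separable isogenies defined over $k$, of respective degrees $\ell_0$ and $\ell_1$. Suppose that all prime factors of $\ell_1$ divide $\ell_0$. Fix a point $P\in\mathcal{E}_0(\overline{k})$ and assume that the kernel $\ker(\varphi_0\circ\varphi_1)$ (a subgroup of $\mathcal{E}_2(\overline{k})$) is cyclic and that all its points are $k(P)$-rational. Then every point $Q\in\mathcal{E}_2(\overline{k})$ with $(\varphi_0\circ\varphi_1)(Q)=P$ which satisfies $[k(\varphi_1(Q)):k(P)]=\ell_0$ also satisfies $[k(Q):k(P)]=\ell_0\ell_1$.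
   Context: For a point $R$ of an elliptic curve defined over $k$, with coordinates in $\overline{k}$, $k(R)$ denotes the field of definition of $R$ over $k$ (the extension of $k$ generated by the coordinates of $R$, equal to $k$ if $R$ is the point at infinity). A point is $k(P)$-rational if its field of definition is contained in $k(P)$. *)

theory Defs
  imports "HOL-Algebra.Algebra" "HOL-Algebra.Algebraic_Closure_Type"
begin

section \<open>Weierstrass curves and their group law\<close>

text \<open>
  \<open>Weierstrass a1 a2 a3 a4 a6\<close> stands for the plane projective curve
  \<open>y\<^sup>2 + a1 x y + a3 y = x\<^sup>3 + a2 x\<^sup>2 + a4 x + a6\<close>; the long form is needed because the
  characteristic is arbitrary.
\<close>

datatype 'a weierstrass = Weierstrass (wa1: 'a) (wa2: 'a) (wa3: 'a) (wa4: 'a) (wa6: 'a)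

definition discriminant :: "'a::comm_ring_1 weierstrass \<Rightarrow> 'a" where
  "discriminant E =
     (let b2 = wa1 E ^ 2 + 4 * wa2 E;
          b4 = 2 * wa4 E + wa1 E * wa3 E;
          b6 = wa3 E ^ 2 + 4 * wa6 E;
          b8 = wa1 E ^ 2 * wa6 E + 4 * wa2 E * wa6 E - wa1 E * wa3 E * wa4 E
               + wa2 E * wa3 E ^ 2 - wa4 E ^ 2
      in - (b2 ^ 2 * b8) - 8 * b4 ^ 3 - 27 * b6 ^ 2 + 9 * b2 * b4 * b6)"

definition elliptic_curve :: "'a::comm_ring_1 weierstrass \<Rightarrow> bool" where
  "elliptic_curve E \<longleftrightarrow> discriminant E \<noteq> 0"

datatype 'a point = Infinity | Affine 'a 'a

definition on_curve :: "'a::comm_ring_1 weierstrass \<Rightarrow> 'a \<Rightarrow> 'a \<Rightarrow> bool" where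
  "on_curve E x y \<longleftrightarrow>
     y ^ 2 + wa1 E * x * y + wa3 E * y = x ^ 3 + wa2 E * x ^ 2 + wa4 E * x + wa6 E"

definition points :: "'a::comm_ring_1 weierstrass \<Rightarrow> 'a point set" where
  "points E = insert Infinity {Affine x y | x y. on_curve E x y}"

text \<open>The chord-tangent law: \<open>y = l x + n\<close> is the line through the two points
  (the tangent line, if they coincide).\<close>

fun point_add :: "'a::field weierstrass \<Rightarrow> 'a point \<Rightarrow> 'a point \<Rightarrow> 'a point" where
  "point_add E Infinity Q = Q"
| "point_add E P Infinity = P"
| "point_add E (Affine x1 y1) (Affine x2 y2) =
     (if x1 = x2 \<and> y1 + y2 + wa1 E * x2 + wa3 E = 0 then Infinity
      else
        let l = (if x1 = x2
                 then (3 * x1 ^ 2 + 2 * wa2 E * x1 + wa4 E - wa1 E * y1)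
                        / (2 * y1 + wa1 E * x1 + wa3 E)
                 else (y2 - y1) / (x2 - x1));
            n = y1 - l * x1;
            x3 = l ^ 2 + wa1 E * l - wa2 E - x1 - x2;
            y3 = - (l + wa1 E) * x3 - n - wa3 E
        in Affine x3 y3)"

text \<open>
  Throughout, the base field \<open>k\<close> is the type \<open>'k\<close>, and its algebraic closure is
  \<open>'k alg_closure\<close>.
\<close>

definition geom_points :: "'k::field weierstrass \<Rightarrow> 'k alg_closure point set" where
  "geom_points E = points (map_weierstrass to_ac E)"

definition geom_group :: "'k::field weierstrass \<Rightarrow> 'k alg_closure point monoid" where
  "geom_group E =
     \<lparr>carrier = geom_points E,
      monoid.mult = point_add (map_weierstrass to_ac E),
      one = Infinity\<rparr>"


section \<open>Subfields\<close>

definition gen_subfield :: "'a::field set \<Rightarrow> 'a set" where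
  "gen_subfield S = generate_field ring_of_type_algebra S"

text \<open>\<open>ext_degree F L n\<close> says that \<open>[L : F] = n\<close>.\<close>

definition ext_degree :: "'a::field set \<Rightarrow> 'a set \<Rightarrow> nat \<Rightarrow> bool" where
  "ext_degree F L n \<longleftrightarrow> F \<subseteq> L \<and> ring.dimension ring_of_type_algebra n F L"

definition is_minpoly :: "'a::field set \<Rightarrow> 'a \<Rightarrow> 'a poly \<Rightarrow> bool" where
  "is_minpoly F \<alpha> p \<longleftrightarrow>
     (\<forall>i. poly.coeff p i \<in> F) \<and> Polynomial.lead_coeff p = 1 \<and> poly p \<alpha> = 0 \<and>
     (\<forall>q. (\<forall>i. poly.coeff q i \<in> F) \<and> q \<noteq> 0 \<and> poly q \<alpha> = 0
          \<longrightarrow> Polynomial.degree p \<le> Polynomial.degree q)"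

text \<open>The ambient field is algebraically closed, so that \<^const>\<open>rsquarefree\<close>, which only speaks
  about roots in the ambient field, means that there are no multiple roots at all.\<close>

definition separable_extension :: "'a::alg_closed_field set \<Rightarrow> 'a set \<Rightarrow> bool" where
  "separable_extension F L \<longleftrightarrow> F \<subseteq> L \<and> (\<forall>\<alpha>\<in>L. \<exists>p. is_minpoly F \<alpha> p \<and> rsquarefree p)"

fun coordinates :: "'a point \<Rightarrow> 'a set" where
  "coordinates Infinity = {}"
| "coordinates (Affine x y) = {x, y}"

definition field_of_definition :: "'k::field alg_closure point \<Rightarrow> 'k alg_closure set" where
  "field_of_definition R = gen_subfield (range to_ac \<union> coordinates R)"


section \<open>Morphisms defined over \<open>k\<close>\<close>

text \<open>A ternary form of degree \<open>d\<close> is given by its coefficients: \<open>c i j\<close> is the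
  coefficient of \<open>x ^ i * y ^ j * z ^ (d - i - j)\<close>, for \<open>i + j \<le> d\<close>.\<close>

type_synonym 'a form = "nat \<Rightarrow> nat \<Rightarrow> 'a"

definition eval_form ::
  "('k \<Rightarrow> 'a::comm_ring_1) \<Rightarrow> nat \<Rightarrow> 'k form \<Rightarrow> 'a \<times> 'a \<times> 'a \<Rightarrow> 'a" where
  "eval_form h d c = (\<lambda>(x, y, z). \<Sum>i\<le>d. \<Sum>j\<le>d-i. h (c i j) * x ^ i * y ^ j * z ^ (d - i - j))"

definition eval_forms ::
  "('k \<Rightarrow> 'a::comm_ring_1) \<Rightarrow> nat \<Rightarrow> 'k form \<times> 'k form \<times> 'k form
     \<Rightarrow> 'a \<times> 'a \<times> 'a \<Rightarrow> 'a \<times> 'a \<times> 'a" where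
  "eval_forms h d = (\<lambda>(F, G, H) v. (eval_form h d F v, eval_form h d G v, eval_form h d H v))"

fun hom_coords :: "'a::comm_ring_1 point \<Rightarrow> 'a \<times> 'a \<times> 'a" where
  "hom_coords Infinity = (0, 1, 0)"
| "hom_coords (Affine x y) = (x, y, 1)"

definition proj_eq :: "'a::field \<times> 'a \<times> 'a \<Rightarrow> 'a \<times> 'a \<times> 'a \<Rightarrow> bool" where
  "proj_eq = (\<lambda>(a, b, c) w. \<exists>s. s \<noteq> 0 \<and> w = (s * a, s * b, s * c))"

text \<open>\<open>represents E \<phi> d F\<close>: the map \<open>\<phi>\<close> is given by the forms \<open>F\<close> over \<open>k\<close> at all points of
  \<open>E\<close> where they do not all vanish.\<close>

definition represents ::
  "'k::field weierstrass \<Rightarrow> ('k alg_closure point \<Rightarrow> 'k alg_closure point)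
     \<Rightarrow> nat \<Rightarrow> 'k form \<times> 'k form \<times> 'k form \<Rightarrow> bool" where
  "represents E \<phi> d F \<longleftrightarrow>
     (\<forall>R\<in>geom_points E. eval_forms to_ac d F (hom_coords R) \<noteq> (0, 0, 0)
        \<longrightarrow> proj_eq (hom_coords (\<phi> R)) (eval_forms to_ac d F (hom_coords R)))"

definition morphism_over ::
  "'k::field weierstrass \<Rightarrow> 'k weierstrass
     \<Rightarrow> ('k alg_closure point \<Rightarrow> 'k alg_closure point) \<Rightarrow> bool" where
  "morphism_over E E' \<phi> \<longleftrightarrow>
     \<phi> \<in> geom_points E \<rightarrow> geom_points E' \<and>
     (\<forall>P\<in>geom_points E. \<exists>d F. represents E \<phi> d F \<and>
        eval_forms to_ac d F (hom_coords P) \<noteq> (0, 0, 0))"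

text \<open>An isogeny is a surjective morphism of curves that is a homomorphism of groups.\<close>

definition isogeny ::
  "'k::field weierstrass \<Rightarrow> 'k weierstrass
     \<Rightarrow> ('k alg_closure point \<Rightarrow> 'k alg_closure point) \<Rightarrow> bool" where
  "isogeny E E' \<phi> \<longleftrightarrow>
     morphism_over E E' \<phi> \<and> \<phi> \<in> hom (geom_group E) (geom_group E') \<and>
     \<phi> ` geom_points E = geom_points E'"


section \<open>Function fields, degree and separability\<close>

text \<open>
  Write \<open>K\<close> for the algebraic closure of \<open>k\<close>. The function field \<open>K(E)\<close> is realised
  as the subfield \<open>K(x, y)\<close> of an algebraic closure of the rational function field \<open>K(x)\<close>,
  where \<open>y\<close> is a root of the Weierstrass equation over \<open>K(x)\<close>. As this equation is irreducible over
  \<open>K(x)\<close>, the two choices of \<open>y\<close> give extensions that are isomorphic over \<open>K(x)\<close>.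
\<close>

type_synonym 'k ambient = "'k alg_closure poly fract alg_closure"

definition ff_const :: "'k::field alg_closure \<Rightarrow> 'k ambient" where
  "ff_const c = to_ac (Fract [:c:] 1)"

definition ff_x :: "'k::field ambient" where
  "ff_x = to_ac (Fract [:0, 1:] 1)"

definition ff_y :: "'k::field weierstrass \<Rightarrow> 'k ambient" where
  "ff_y E = (SOME y. on_curve (map_weierstrass (ff_const \<circ> to_ac) E) ff_x y)"

definition function_field :: "'k::field weierstrass \<Rightarrow> 'k ambient set" where
  "function_field E = gen_subfield (range ff_const \<union> {ff_x, ff_y E})"

text \<open>
  For a nonconstant morphism \<open>\<phi> : E \<rightarrow> E'\<close>, the pair \<open>(\<phi>\<^sup>* x', \<phi>\<^sup>* y')\<close> of pulled back
  coordinate functions of \<open>E'\<close>, as elements of \<open>K(E)\<close>: if \<open>\<phi>\<close> is represented by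
  \<open>[F : G : H]\<close>, with \<open>H\<close> not identically zero on \<open>E\<close>, it is \<open>(F / H, G / H)\<close>.
  This does not depend on the chosen representation.
\<close>

definition pullback_coords ::
  "'k::field weierstrass \<Rightarrow> ('k alg_closure point \<Rightarrow> 'k alg_closure point)
     \<Rightarrow> 'k ambient \<times> 'k ambient" where
  "pullback_coords E \<phi> =
     (SOME (u, v). \<exists>d F f g h. represents E \<phi> d F \<and>
        eval_forms (ff_const \<circ> to_ac) d F (ff_x, ff_y E, 1) = (f, g, h) \<and>
        h \<noteq> 0 \<and> u = f / h \<and> v = g / h)"

text \<open>The image \<open>\<phi>\<^sup>* K(E') = K(\<phi>\<^sup>* x', \<phi>\<^sup>* y')\<close> of the function field of \<open>E'\<close> in \<open>K(E)\<close>.\<close>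

definition pullback_field ::
  "'k::field weierstrass \<Rightarrow> ('k alg_closure point \<Rightarrow> 'k alg_closure point) \<Rightarrow> 'k ambient set" where
  "pullback_field E \<phi> =
     gen_subfield (range ff_const \<union> {fst (pullback_coords E \<phi>), snd (pullback_coords E \<phi>)})"

definition isogeny_degree ::
  "'k::field weierstrass \<Rightarrow> ('k alg_closure point \<Rightarrow> 'k alg_closure point) \<Rightarrow> nat \<Rightarrow> bool" where
  "isogeny_degree E \<phi> n \<longleftrightarrow> ext_degree (pullback_field E \<phi>) (function_field E) n"

definition separable_isogeny ::
  "'k::field weierstrass \<Rightarrow> 'k weierstrass
     \<Rightarrow> ('k alg_closure point \<Rightarrow> 'k alg_closure point) \<Rightarrow> bool" where
  "separable_isogeny E E' \<phi> \<longleftrightarrow>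
     isogeny E E' \<phi> \<and> separable_extension (pullback_field E \<phi>) (function_field E)"

end

theory Submission
  imports Defs
begin

text \<open>
  Write \<open>F = k(P)\<close>, a finite field, and let \<open>\<sigma>\<close> be its Frobenius. As \<open>\<phi>0 \<circ> \<phi>1\<close> is defined over \<open>k\<close>, the
  point \<open>\<sigma> Q\<close> lies in the same fibre as \<open>Q\<close>, so \<open>\<sigma> Q = Q + T\<close> with \<open>T\<close> in the kernel \<open>C\<close>. All of \<open>C\<close> is
  fixed by \<open>\<sigma>\<close>, so \<open>\<sigma>\<^sup>j Q = Q + j T\<close> and \<open>\<sigma>\<^sup>j (\<phi>1 Q) = \<phi>1 Q + j (\<phi>1 T)\<close>. For a point \<open>R\<close> the degree
  \<open>[F(R) : F]\<close> is the least \<open>r > 0\<close> with \<open>\<sigma>\<^sup>r R = R\<close> (\<open>ext_degree_eq_period\<close>). Thus the degree of \<open>Q\<close> is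
  the order of \<open>T\<close>, that of \<open>\<phi>1 Q\<close> is the order of \<open>\<phi>1 T\<close>, and the theorem becomes a statement on
  groups (\<open>cyclic_lift_generator\<close>): \<open>C\<close> is cyclic of order \<open>l0 l1\<close>, and \<open>\<phi>1 T\<close> has order \<open>l0\<close>, the order
  of the kernel of \<open>\<phi>0\<close>. If \<open>T\<close> did not generate \<open>C\<close>, it would be \<open>p S\<close> for some \<open>S\<close> in \<open>C\<close> and some prime
  \<open>p\<close> dividing \<open>l0 l1\<close>, hence dividing \<open>l0\<close>; then \<open>(l0 / p) \<phi>1 T = l0 (\<phi>1 S) = 0\<close>, which contradicts the
  order of \<open>\<phi>1 T\<close>. So \<open>T\<close> has order \<open>l0 l1\<close>.

  Two facts about elliptic curves carry this argument.

  The chord-tangent law is associative (\<open>point_add_assoc\<close>). A point is sent to the class of its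
  ideal in the coordinate ring. The lines of the construction show that sums go to products
  (\<open>gens_neg\<close>, \<open>gens_add_affine\<close>). The ideal of an affine point is never principal, because the norm of
  an element of the coordinate ring, a polynomial in \<open>x\<close>, never has degree 1
  (\<open>point_ideal_not_principal\<close>). So the map to ideal classes is injective, and associativity is
  inherited from the product of ideals.

  A separable isogeny of degree \<open>n\<close> has a kernel of order \<open>n\<close> (\<open>card_kernel_separable_isogeny\<close>). All
  fibres are translates of the kernel, so it is enough to count a generic fibre
  (\<open>card_generic_fibre\<close>). Let \<open>M = K(u, v)\<close> be the pulled back function field. In the tower from \<open>M\<close>
  over \<open>M(x)\<close> to \<open>M(x, y)\<close> both steps have a minimal polynomial with simple roots. Away from finitely
  many points, the coefficients can be evaluated at the image point, and the specialised polynomials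
  still have simple roots. Pairs of such roots \<open>(x, z)\<close> are exactly the points of the fibre: evaluation
  at a point of the fibre gives roots, and conversely the evaluation homomorphism on the local ring
  of the target extends along each choice of roots (\<open>extend_hom\<close>).
\<close>

section \<open>Subrings, subfields and polynomials over them\<close>

abbreviation RT :: "'a::field ring" where "RT \<equiv> ring_of_type_algebra"

lemma RT_simps [simp]:
  "carrier RT = UNIV" "monoid.mult RT = (*)" "monoid.one RT = 1" "ring.zero RT = 0" "ring.add RT = (+)"
  by (simp_all add: ring_of_type_algebra_def)

lemmas RT_field = field_from_type_algebra and RT_ring = ring_from_type_algebra
  and RT_cring = cring_from_type_algebra

lemma RT_a_inv [simp]: "\<ominus>\<^bsub>RT\<^esub> x = - (x :: 'a::field)"
  using ring.ring_simprules(16)[OF RT_ring, of x] by (simp add: eq_neg_iff_add_eq_0 add.commute)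

lemma RT_m_inv [simp]: "x \<noteq> 0 \<Longrightarrow> inv\<^bsub>RT\<^esub> x = inverse (x :: 'a::field)"
  using comm_monoid.comm_inv_char[OF cring.axioms(2)[OF RT_cring], of x "inverse x"] by simp

definition is_subring :: "'a::comm_ring_1 set \<Rightarrow> bool" where
  "is_subring A \<longleftrightarrow> 1 \<in> A \<and> (\<forall>a\<in>A. \<forall>b\<in>A. a + b \<in> A \<and> a * b \<in> A) \<and> (\<forall>a\<in>A. - a \<in> A)"

definition is_subfield :: "'a::field set \<Rightarrow> bool" where
  "is_subfield F \<longleftrightarrow> is_subring F \<and> (\<forall>a\<in>F. inverse a \<in> F)"

lemma is_subringD:
  assumes "is_subring A"
  shows "1 \<in> A" "a \<in> A \<Longrightarrow> b \<in> A \<Longrightarrow> a + b \<in> A" "a \<in> A \<Longrightarrow> b \<in> A \<Longrightarrow> a * b \<in> A"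
    "a \<in> A \<Longrightarrow> - a \<in> A" "0 \<in> A" "a \<in> A \<Longrightarrow> b \<in> A \<Longrightarrow> a - b \<in> A"
    "a \<in> A \<Longrightarrow> a ^ n \<in> A" "(\<And>i. i \<in> I \<Longrightarrow> f i \<in> A) \<Longrightarrow> sum f I \<in> A" "of_nat n \<in> A"
proof -
  show *: "1 \<in> A" "a \<in> A \<Longrightarrow> b \<in> A \<Longrightarrow> a + b \<in> A" "a \<in> A \<Longrightarrow> b \<in> A \<Longrightarrow> a * b \<in> A"
    "a \<in> A \<Longrightarrow> - a \<in> A" for a b
    using assms by (auto simp: is_subring_def)
  show 0: "0 \<in> A" using *(2)[OF *(1) *(4)[OF *(1)]] by simp
  show "a \<in> A \<Longrightarrow> b \<in> A \<Longrightarrow> a - b \<in> A" using *(2)[of a "-b"] *(4) by simp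
  show "a \<in> A \<Longrightarrow> a ^ n \<in> A" by (induction n) (use * in auto)
  show "(\<And>i. i \<in> I \<Longrightarrow> f i \<in> A) \<Longrightarrow> sum f I \<in> A"
    by (induction I rule: infinite_finite_induct) (use * 0 in auto)
  show "of_nat n \<in> A" by (induction n) (use * 0 in auto)
qed

lemma is_subfieldD:
  assumes "is_subfield F"
  shows "is_subring F" "a \<in> F \<Longrightarrow> inverse a \<in> F" "a \<in> F \<Longrightarrow> b \<in> F \<Longrightarrow> a / b \<in> F"
  using assms is_subringD[of F] by (auto simp: is_subfield_def divide_inverse)

lemma is_subfield_iff: "subfield F RT \<longleftrightarrow> is_subfield F"
proof
  assume F: "subfield F RT"
  note S = subringE[OF subfieldE(1)[OF F]]
  have "inverse a \<in> F" if "a \<in> F" for a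
    using S(2) ring.subfield_m_inv(1)[OF RT_ring F, of a] that by (cases "a = 0") auto
  then show "is_subfield F"
    using S(3,5-7) by (auto simp: is_subfield_def is_subring_def)
next
  assume F: "is_subfield F"
  note S = is_subringD[OF is_subfieldD(1)[OF F]]
  show "subfield F RT"
  proof (rule field.subfieldI'[OF RT_field])
    show "subring F RT"
      by (rule ring.subringI[OF RT_ring]) (use S in auto)
    show "inv\<^bsub>RT\<^esub> k \<in> F" if "k \<in> F - {\<zero>\<^bsub>RT\<^esub>}" for k
      using that is_subfieldD(2)[OF F] by auto
  qed
qed

lemma gen_subfield: "is_subfield (gen_subfield S)" "S \<subseteq> gen_subfield S"
  using field.generate_fieldE[OF RT_field, of S "generate_field RT S"]
  by (auto simp: gen_subfield_def is_subfield_iff)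

lemma gen_subfield_minimal: "is_subfield F \<Longrightarrow> S \<subseteq> F \<Longrightarrow> gen_subfield S \<subseteq> F"
  using field.generate_field_min_subfield1[OF RT_field, of S F] by (auto simp: gen_subfield_def is_subfield_iff)

lemma gen_subfield_mono: "S \<subseteq> T \<Longrightarrow> gen_subfield S \<subseteq> gen_subfield T"
  by (meson gen_subfield gen_subfield_minimal order_trans)

lemma gen_subfield_gen_subfield: "gen_subfield (gen_subfield S \<union> T) = gen_subfield (S \<union> T)"
proof
  show "gen_subfield (gen_subfield S \<union> T) \<subseteq> gen_subfield (S \<union> T)"
    using gen_subfield_mono[of S "S \<union> T"] gen_subfield(2)[of "S \<union> T"]
    by (intro gen_subfield_minimal gen_subfield) auto
  show "gen_subfield (S \<union> T) \<subseteq> gen_subfield (gen_subfield S \<union> T)"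
    using gen_subfield(2)[of S] by (intro gen_subfield_mono) auto
qed

definition gen_subring :: "'a::comm_ring_1 set \<Rightarrow> 'a set" where
  "gen_subring S = \<Inter>{A. is_subring A \<and> S \<subseteq> A}"

lemma gen_subring: "is_subring (gen_subring S)" "S \<subseteq> gen_subring S"
  by (auto simp: gen_subring_def is_subring_def)

lemma gen_subring_minimal: "is_subring A \<Longrightarrow> S \<subseteq> A \<Longrightarrow> gen_subring S \<subseteq> A"
  by (auto simp: gen_subring_def)

text \<open>
  The fractions of elements of the generated ring already form a field.
\<close>

lemma gen_subfield_fractions:
  assumes "c \<in> gen_subfield S"
  obtains a b where "a \<in> gen_subring S" "b \<in> gen_subring S" "b \<noteq> 0" "c = a / b"
proof -
  let ?A = "gen_subring S"
  let ?F = "{a / b | a b. a \<in> ?A \<and> b \<in> ?A \<and> b \<noteq> 0}"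
  note A = is_subringD[OF gen_subring(1)[of S]]
  have I: "a / b \<in> ?F" if "a \<in> ?A" "b \<in> ?A" "b \<noteq> 0" for a b using that by blast
  have "is_subfield ?F"
    unfolding is_subfield_def is_subring_def
  proof (intro conjI ballI)
    show "1 \<in> ?F" using I[of 1 1] A by simp
  next
    fix x y assume "x \<in> ?F" "y \<in> ?F"
    then obtain a b c d where *: "a \<in> ?A" "b \<in> ?A" "b \<noteq> 0" "x = a / b" "c \<in> ?A" "d \<in> ?A" "d \<noteq> 0" "y = c / d"
      by blast
    show "x + y \<in> ?F" using I[of "a * d + c * b" "b * d"] * A by (simp add: add_frac_eq)
    show "x * y \<in> ?F" using I[of "a * c" "b * d"] * A by simp
  next
    fix x assume "x \<in> ?F"
    then obtain a b where *: "a \<in> ?A" "b \<in> ?A" "b \<noteq> 0" "x = a / b" by blast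
    show "- x \<in> ?F" using I[of "- a" b] * A by simp
    show "inverse x \<in> ?F"
      using I[of b a] I[of 0 1] * A by (cases "a = 0") auto
  qed
  moreover have "S \<subseteq> ?F"
  proof
    fix s assume "s \<in> S"
    then show "s \<in> ?F" using I[of s 1] A gen_subring(2)[of S] by auto
  qed
  ultimately have "c \<in> ?F" using assms gen_subfield_minimal by blast
  then show ?thesis using that by blast
qed

definition poly_over :: "'a::comm_ring_1 set \<Rightarrow> 'a poly \<Rightarrow> bool" where
  "poly_over A p \<longleftrightarrow> (\<forall>i. poly.coeff p i \<in> A)"

lemma poly_over_mono: "A \<subseteq> B \<Longrightarrow> poly_over A p \<Longrightarrow> poly_over B p"
  by (auto simp: poly_over_def)

lemma poly_over_ops:
  fixes A :: "'a::idom set"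
  assumes "is_subring A"
  shows "poly_over A p \<Longrightarrow> poly_over A q \<Longrightarrow> poly_over A (p + q)"
    "poly_over A p \<Longrightarrow> poly_over A q \<Longrightarrow> poly_over A (p - q)"
    "poly_over A p \<Longrightarrow> poly_over A (- p)"
    "poly_over A p \<Longrightarrow> poly_over A q \<Longrightarrow> poly_over A (p * q)"
    "poly_over A p \<Longrightarrow> poly_over A (pderiv p)"
    "a \<in> A \<Longrightarrow> poly_over A (Polynomial.monom a n)"
    "a \<in> A \<Longrightarrow> poly_over A p \<Longrightarrow> poly_over A (pCons a p)"
    "a \<in> A \<Longrightarrow> poly_over A p \<Longrightarrow> poly_over A (Polynomial.smult a p)"
    "poly_over A 0" "poly_over A 1"
  using is_subringD[OF assms]
  by (auto simp: poly_over_def Polynomial.coeff_mult coeff_pderiv coeff_pCons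
      split: nat.split simp del: of_nat_Suc intro!: is_subringD(8)[OF assms])

lemma poly_over_eval:
  assumes "is_subring A" "poly_over A p" "x \<in> A"
  shows "poly p x \<in> A"
  unfolding poly_altdef using assms
  by (intro is_subringD(8)[OF assms(1)] is_subringD(3)[OF assms(1)] is_subringD(7)[OF assms(1)])
     (auto simp: poly_over_def)

text \<open>
  Long division stays inside \<open>A\<close> because the leading coefficient of the divisor is 1. Coefficient rings
  that are not fields occur below as local rings.
\<close>

lemma monic_division:
  fixes A :: "'a::idom set"
  assumes A: "is_subring A" and m: "poly_over A m" "Polynomial.lead_coeff m = 1" and q: "poly_over A q"
  obtains s r where "poly_over A s" "poly_over A r" "q = m * s + r"
    "r = 0 \<or> Polynomial.degree r < Polynomial.degree m"
proof -
  have "\<exists>s r. poly_over A s \<and> poly_over A r \<and> q = m * s + r \<and>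
      (r = 0 \<or> Polynomial.degree r < Polynomial.degree m)"
    using q
  proof (induction "Polynomial.degree q" arbitrary: q rule: less_induct)
    case less
    note ops = poly_over_ops[OF A]
    show ?case
    proof (cases "q = 0 \<or> Polynomial.degree q < Polynomial.degree m")
      case True
      then show ?thesis using less(2) ops by (intro exI[of _ 0] exI[of _ q]) auto
    next
      case False
      let ?c = "Polynomial.lead_coeff q"
      \<comment> \<open>the next term of the quotient in long division\<close>
      let ?t = "Polynomial.monom ?c (Polynomial.degree q - Polynomial.degree m)"
      let ?q = "q - m * ?t"
      have m0: "m \<noteq> 0" using m(2) by auto
      have t: "poly_over A ?t" using less(2) by (intro ops) (simp add: poly_over_def)
      have qo: "poly_over A ?q" by (rule ops(2)[OF less(2) ops(4)[OF m(1) t]])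
      have t0: "?t \<noteq> 0" using False by simp
      have deg: "Polynomial.degree (m * ?t) = Polynomial.degree q"
        using False t0 m0 m(2) Polynomial.degree_monom_eq[of ?c]
        by (subst Polynomial.degree_mult_eq) auto
      have lc: "poly.coeff (m * ?t) (Polynomial.degree q) = ?c"
        using False m(2) unfolding mult.commute[of m] coeff_monom_mult by auto
      show ?thesis
      proof (cases "?q = 0 \<or> Polynomial.degree ?q < Polynomial.degree m")
        case True
        then show ?thesis using t qo by (intro exI[of _ ?t] exI[of _ ?q]) auto
      next
        case False': False
        have "Polynomial.degree ?q < Polynomial.degree q"
        proof (rule degree_lessI)
          show "?q \<noteq> 0 \<or> 0 < Polynomial.degree q" using False' by auto
          show "\<forall>k\<ge>Polynomial.degree q. poly.coeff ?q k = 0"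
          proof (intro allI impI)
            fix k assume "Polynomial.degree q \<le> k"
            then consider "k = Polynomial.degree q" | "k > Polynomial.degree q" by linarith
            then show "poly.coeff ?q k = 0"
              by cases (simp_all add: lc Polynomial.coeff_eq_0 deg)
          qed
        qed
        from less(1)[OF this qo] obtain s r where "poly_over A s" "poly_over A r" "?q = m * s + r"
          "r = 0 \<or> Polynomial.degree r < Polynomial.degree m" by blast
        then show ?thesis using t
          by (intro exI[of _ "s + ?t"] exI[of _ r]) (auto simp: algebra_simps intro: ops)
      qed
    qed
  qed
  then show ?thesis using that by blast
qed

section \<open>Minimal polynomials and simple extensions\<close>

lemma is_minpoly_iff:
  "is_minpoly F \<alpha> p \<longleftrightarrow> poly_over F p \<and> Polynomial.lead_coeff p = 1 \<and> poly p \<alpha> = 0 \<and>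
     (\<forall>q. poly_over F q \<and> q \<noteq> 0 \<and> poly q \<alpha> = 0 \<longrightarrow> Polynomial.degree p \<le> Polynomial.degree q)"
  unfolding is_minpoly_def poly_over_def by simp

lemma is_minpoly_ne_0: "is_minpoly F \<alpha> p \<Longrightarrow> p \<noteq> 0"
  unfolding is_minpoly_iff by auto

lemma minpoly_dvd:
  assumes F: "is_subring F" and m: "is_minpoly F \<alpha> m" and F': "F \<subseteq> F'"
    and q: "poly_over F q" "poly q \<alpha> = 0"
  obtains s where "poly_over F s" "q = m * s"
proof -
  obtain s r where sr: "poly_over F s" "poly_over F r" "q = m * s + r"
    "r = 0 \<or> Polynomial.degree r < Polynomial.degree m"
    using monic_division[OF F _ _ q(1)] m unfolding is_minpoly_iff by metis
  have "poly r \<alpha> = 0" using sr(3) q(2) m by (simp add: is_minpoly_iff)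
  then have "r = 0" using sr m unfolding is_minpoly_iff by (metis not_le)
  then show ?thesis using sr that by simp
qed

text \<open>
  The remainder of the division within \<open>A\<close> vanishes at \<open>\<alpha>\<close> and has smaller degree than \<open>m\<close>, which is
  minimal even over \<open>F\<close>.
\<close>

lemma minpoly_dvd_subring:
  assumes A: "is_subring A" "A \<subseteq> F" and m: "is_minpoly F \<alpha> m" "poly_over A m"
    and q: "poly_over A q" "poly q \<alpha> = 0"
  obtains s where "poly_over A s" "q = m * s"
proof -
  obtain s r where sr: "poly_over A s" "poly_over A r" "q = m * s + r"
    "r = 0 \<or> Polynomial.degree r < Polynomial.degree m"
    using monic_division[OF A(1) m(2) _ q(1)] m unfolding is_minpoly_iff by metis
  have "poly r \<alpha> = 0" using sr(3) q(2) m by (simp add: is_minpoly_iff)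
  then have "r = 0" using sr m A(2) poly_over_mono unfolding is_minpoly_iff by (metis not_le)
  then show ?thesis using sr that by simp
qed

lemma minpoly_exists:
  assumes F: "is_subfield F" and q: "poly_over F q" "q \<noteq> 0" "poly q \<alpha> = 0"
  obtains m where "is_minpoly F \<alpha> m"
proof -
  let ?P = "\<lambda>d. \<exists>q. poly_over F q \<and> q \<noteq> 0 \<and> poly q \<alpha> = 0 \<and> Polynomial.degree q = d"
  have "?P (LEAST d. ?P d)" by (rule LeastI_ex) (use q in blast)
  then obtain p where p: "poly_over F p" "p \<noteq> 0" "poly p \<alpha> = 0" "Polynomial.degree p = (LEAST d. ?P d)"
    by blast
  let ?c = "Polynomial.lead_coeff p"
  let ?m = "Polynomial.smult (inverse ?c) p"
  have c: "?c \<in> F" using p(1) unfolding poly_over_def by blast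
  have c0: "?c \<noteq> 0" using p(2) by simp
  have "Polynomial.degree p \<le> Polynomial.degree q" if "poly_over F q" "q \<noteq> 0" "poly q \<alpha> = 0" for q
    unfolding p(4) by (rule Least_le) (use that in blast)
  moreover have "poly_over F ?m"
    by (rule poly_over_ops(8)[OF is_subfieldD(1)[OF F] is_subfieldD(2)[OF F c] p(1)])
  ultimately have "is_minpoly F \<alpha> ?m" using c0 p(2,3) by (simp add: is_minpoly_iff)
  then show ?thesis by (rule that)
qed

definition adjoin :: "'a::comm_ring_1 set \<Rightarrow> 'a \<Rightarrow> 'a set" where
  "adjoin A \<alpha> = {poly q \<alpha> | q. poly_over A q}"

lemma adjoin_subring:
  fixes A :: "'a::idom set"
  assumes "is_subring A" shows "is_subring (adjoin A \<alpha>)"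
proof -
  note ops = poly_over_ops[OF assms]
  have I: "poly q \<alpha> \<in> adjoin A \<alpha>" if "poly_over A q" for q using that by (auto simp: adjoin_def)
  show ?thesis unfolding is_subring_def
  proof (intro conjI ballI)
    show "1 \<in> adjoin A \<alpha>" using I[OF ops(10)] by simp
    fix a assume "a \<in> adjoin A \<alpha>"
    then obtain p where p: "poly_over A p" "a = poly p \<alpha>" by (auto simp: adjoin_def)
    then show "- a \<in> adjoin A \<alpha>" using I[OF ops(3)[OF p(1)]] by simp
    fix b assume "b \<in> adjoin A \<alpha>"
    then obtain q where q: "poly_over A q" "b = poly q \<alpha>" by (auto simp: adjoin_def)
    show "a + b \<in> adjoin A \<alpha>" using I[OF ops(1)[OF p(1) q(1)]] p q by simp
    show "a * b \<in> adjoin A \<alpha>" using I[OF ops(4)[OF p(1) q(1)]] p q by simp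
  qed
qed

lemma adjoin_base:
  fixes A :: "'a::idom set"
  assumes "is_subring A" shows "A \<subseteq> adjoin A \<alpha>" "\<alpha> \<in> adjoin A \<alpha>"
proof -
  note ops = poly_over_ops[OF assms] and A = is_subringD[OF assms]
  show "A \<subseteq> adjoin A \<alpha>"
  proof
    fix a assume "a \<in> A"
    then have "poly_over A [:a:]" by (intro ops)
    then show "a \<in> adjoin A \<alpha>" unfolding adjoin_def by force
  qed
  have "poly_over A [:0, 1:]" using A by (intro ops)
  then show "\<alpha> \<in> adjoin A \<alpha>" unfolding adjoin_def by force
qed

lemma adjoin_minimal:
  assumes "is_subring B" "A \<subseteq> B" "\<alpha> \<in> B" shows "adjoin A \<alpha> \<subseteq> B"
  using assms poly_over_eval poly_over_mono unfolding adjoin_def by blast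

text \<open>
  Euclid's algorithm, by induction on the degree of \<open>q\<close>: by minimality of \<open>m\<close>, the remainder of \<open>m\<close>
  modulo \<open>q\<close> does not vanish at \<open>\<alpha>\<close>, so its value is already known to be invertible.
\<close>

lemma minpoly_inverse:
  assumes F: "is_subfield F" and m: "is_minpoly F \<alpha> m" and q: "poly_over F q" "poly q \<alpha> \<noteq> 0"
  obtains r where "poly_over F r" "poly r \<alpha> * poly q \<alpha> = 1"
proof -
  note S = is_subfieldD(1)[OF F]
  note ops = poly_over_ops[OF S]
  have "\<exists>r. poly_over F r \<and> poly r \<alpha> * poly q \<alpha> = 1"
    if "poly_over F q" "poly q \<alpha> \<noteq> 0" "Polynomial.degree q < Polynomial.degree m" for q
    using that
  proof (induction "Polynomial.degree q" arbitrary: q rule: less_induct)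
    case less
    let ?c = "Polynomial.lead_coeff q"
    let ?q = "Polynomial.smult (inverse ?c) q"
    have q0: "q \<noteq> 0" using less by auto
    have c: "?c \<in> F" "?c \<noteq> 0" using less q0 by (auto simp: poly_over_def)
    have ic: "inverse ?c \<in> F" using is_subfieldD(2)[OF F c(1)] .
    have qo: "poly_over F ?q" by (rule ops(8)[OF ic less(2)])
    show ?case
    proof (cases "Polynomial.degree q = 0")
      case True
      then obtain k where k: "q = [:k:]" by (meson degree_eq_zeroE)
      then have "poly_over F [:inverse k:]" using ic by (intro ops) simp
      then show ?thesis using k q0 by (intro exI[of _ "[:inverse k:]"]) auto
    next
      case False
      have mo: "poly_over F m" using m by (simp add: is_minpoly_iff)
      \<comment> \<open>evaluated at \<open>\<alpha>\<close>, this expresses \<open>r \<alpha>\<close> through \<open>q \<alpha>\<close>\<close>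
      obtain s r where sr: "poly_over F s" "poly_over F r" "m = ?q * s + r"
        "r = 0 \<or> Polynomial.degree r < Polynomial.degree ?q"
        using monic_division[OF S qo _ mo] c by auto
      have eq: "inverse ?c * poly q \<alpha> * poly s \<alpha> + poly r \<alpha> = 0"
        using m sr(3) unfolding is_minpoly_iff by (metis poly_add poly_mult poly_smult)
      have "poly r \<alpha> \<noteq> 0"
      proof
        assume r: "poly r \<alpha> = 0"
        have "r = 0"
        proof (rule ccontr)
          assume "r \<noteq> 0"
          then have "Polynomial.degree m \<le> Polynomial.degree r" using m r sr(2) by (auto simp: is_minpoly_iff)
          moreover have "Polynomial.degree r < Polynomial.degree q" using \<open>r \<noteq> 0\<close> sr(4) c by auto
          ultimately show False using less(4) by linarith
        qed
        then have ms: "m = ?q * s" using sr by simp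
        then have s0: "s \<noteq> 0" using is_minpoly_ne_0[OF m] by auto
        have "Polynomial.degree m = Polynomial.degree q + Polynomial.degree s"
          unfolding ms using s0 q0 c by (subst Polynomial.degree_mult_eq) auto
        moreover have "poly s \<alpha> = 0" using eq r less(3) c by auto
        then have "Polynomial.degree m \<le> Polynomial.degree s" using m s0 sr(1) by (auto simp: is_minpoly_iff)
        ultimately show False using False by linarith
      qed
      then have "r \<noteq> 0" by auto
      then have "Polynomial.degree r < Polynomial.degree q" using sr(4) c by auto
      from less(1)[OF this sr(2) \<open>poly r \<alpha> \<noteq> 0\<close>] this less(4) obtain t where
        t: "poly_over F t" "poly t \<alpha> * poly r \<alpha> = 1" by auto
      let ?r = "- (Polynomial.smult (inverse ?c) (s * t))"
      have "poly_over F ?r" using sr t ic by (intro ops)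
      moreover have "poly ?r \<alpha> * poly q \<alpha> = poly t \<alpha> * poly r \<alpha>"
        using eq by (simp add: eq_neg_iff_add_eq_0 [symmetric] add_eq_0_iff algebra_simps)
      ultimately show ?thesis using t by auto
    qed
  qed
  note * = this
  obtain s r where sr: "poly_over F s" "poly_over F r" "q = m * s + r"
    "r = 0 \<or> Polynomial.degree r < Polynomial.degree m"
    using monic_division[OF S _ _ q(1)] m unfolding is_minpoly_iff by metis
  have "poly r \<alpha> = poly q \<alpha>" using m sr(3) by (simp add: is_minpoly_iff)
  then show ?thesis using * [OF sr(2)] sr(4) q(2) that by auto
qed

lemma adjoin_subfield:
  assumes F: "is_subfield F" and m: "is_minpoly F \<alpha> m"
  shows "is_subfield (adjoin F \<alpha>)"
  unfolding is_subfield_def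
proof (intro conjI ballI)
  show S: "is_subring (adjoin F \<alpha>)" by (rule adjoin_subring[OF is_subfieldD(1)[OF F]])
  fix a assume "a \<in> adjoin F \<alpha>"
  then obtain q where q: "poly_over F q" "a = poly q \<alpha>" by (auto simp: adjoin_def)
  show "inverse a \<in> adjoin F \<alpha>"
  proof (cases "a = 0")
    case False
    then obtain r where r: "poly_over F r" "poly r \<alpha> * poly q \<alpha> = 1"
      using minpoly_inverse[OF F m q(1)] q(2) by blast
    then have "inverse a = poly r \<alpha>" unfolding q(2) by (metis inverse_unique mult.commute)
    then show ?thesis using r by (auto simp: adjoin_def)
  qed (use is_subringD[OF S] in auto)
qed

lemma gen_subfield_insert:
  assumes F: "is_subfield F" and m: "is_minpoly F \<alpha> m"
  shows "gen_subfield (F \<union> {\<alpha>}) = adjoin F \<alpha>"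
proof
  note S = is_subfieldD(1)[OF F]
  show "gen_subfield (F \<union> {\<alpha>}) \<subseteq> adjoin F \<alpha>"
    using adjoin_base[OF S] by (intro gen_subfield_minimal adjoin_subfield[OF F m]) auto
  show "adjoin F \<alpha> \<subseteq> gen_subfield (F \<union> {\<alpha>})"
    using gen_subfield[of "F \<union> {\<alpha>}"] by (intro adjoin_minimal is_subfieldD) auto
qed

lemma minpoly_degree_pos: "is_minpoly F a m \<Longrightarrow> 0 < Polynomial.degree m"
proof (rule ccontr)
  assume m: "is_minpoly F a m" "\<not> 0 < Polynomial.degree m"
  then obtain k where "m = [:k:]" using degree_eq_zeroE by blast
  then show False using m by (auto simp: is_minpoly_iff)
qed

lemma adjoin_mono: "A \<subseteq> B \<Longrightarrow> adjoin A a \<subseteq> adjoin B a"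
  unfolding adjoin_def using poly_over_mono by blast

section \<open>Degrees of field extensions\<close>

lemma ext_degree_unique:
  assumes "is_subfield F" "ext_degree F L n" "ext_degree F L m" shows "n = m"
  using assms ring.dimension_is_inj[OF RT_ring, of F n L m]
  by (auto simp: ext_degree_def is_subfield_iff)

lemma ext_degree_trans:
  assumes "is_subfield F" "is_subfield M" "ext_degree F M n" "ext_degree M L m"
  shows "ext_degree F L (n * m)"
  using assms ring.telescopic_base[OF RT_ring, of F M n m L]
  by (auto simp: ext_degree_def is_subfield_iff)

lemma line_extension_iff:
  "u \<in> ring.line_extension RT F a E \<longleftrightarrow> (\<exists>c\<in>F. \<exists>v\<in>E. u = c * a + v)"
  by (simp add: ring.line_extension_mem_iff[OF RT_ring])

text \<open>
  The powers of \<open>\<alpha>\<close> are added one at a time. As long as the exponent is below the degree of \<open>m\<close>, the new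
  power is not in the span of the previous ones, so the dimension grows by one.
\<close>

lemma ext_degree_adjoin:
  assumes F: "is_subfield F" and m: "is_minpoly F \<alpha> m"
  shows "ext_degree F (adjoin F \<alpha>) (Polynomial.degree m)"
proof -
  note S = is_subfieldD(1)[OF F]
  note ops = poly_over_ops[OF S]
  \<comment> \<open>the span of the powers of \<open>\<alpha>\<close> with exponent below \<open>k\<close>\<close>
  define E where "E k = {poly q \<alpha> | q. poly_over F q \<and> (\<forall>i\<ge>k. poly.coeff q i = 0)}" for k
  have dim: "ring.dimension RT k F (E k)" if "k \<le> Polynomial.degree m" for k
    using that
  proof (induction k)
    case 0
    have "q = 0" if "\<forall>i. poly.coeff q i = 0" for q :: "'a poly" using that by (simp add: poly_eq_iff)
    then have "u = 0" if "u \<in> E 0" for u using that unfolding E_def by fastforce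
    moreover have "0 \<in> E 0" unfolding E_def using ops(9) by (intro CollectI exI[of _ 0]) simp
    ultimately have "E 0 = {0}" by blast
    then show ?case using ring.zero_dim[OF RT_ring, of F] by simp
  next
    case (Suc k)
    have "\<alpha> ^ k \<notin> E k"
    proof
      assume "\<alpha> ^ k \<in> E k"
      then obtain q where q: "poly_over F q" "\<forall>i\<ge>k. poly.coeff q i = 0" "\<alpha> ^ k = poly q \<alpha>"
        by (auto simp: E_def)
      let ?p = "Polynomial.monom 1 k - q"
      have "poly_over F ?p" using q is_subringD[OF S] by (intro ops)
      moreover have "poly.coeff ?p k = 1" using q by simp
      then have "?p \<noteq> 0" by (metis coeff_0 zero_neq_one)
      moreover have "poly ?p \<alpha> = 0" using q by (simp add: poly_monom)
      ultimately have "Polynomial.degree m \<le> Polynomial.degree ?p" using m by (auto simp: is_minpoly_iff)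
      moreover have "Polynomial.degree ?p \<le> k" using q(2) by (intro degree_le) auto
      ultimately show False using Suc by linarith
    qed
    moreover have "ring.line_extension RT F (\<alpha> ^ k) (E k) = E (Suc k)"
    proof (intro equalityI subsetI)
      fix u assume "u \<in> ring.line_extension RT F (\<alpha> ^ k) (E k)"
      then obtain c v where cv: "c \<in> F" "v \<in> E k" "u = c * \<alpha> ^ k + v"
        unfolding line_extension_iff by blast
      then obtain q where q: "poly_over F q" "\<forall>i\<ge>k. poly.coeff q i = 0" "v = poly q \<alpha>"
        by (auto simp: E_def)
      have "poly_over F (Polynomial.monom c k + q)" using q cv by (intro ops)
      moreover have "\<forall>i\<ge>Suc k. poly.coeff (Polynomial.monom c k + q) i = 0" using q by auto
      moreover have "u = poly (Polynomial.monom c k + q) \<alpha>" using q cv by (simp add: poly_monom)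
      ultimately show "u \<in> E (Suc k)" unfolding E_def by blast
    next
      fix u assume "u \<in> E (Suc k)"
      then obtain q where q: "poly_over F q" "\<forall>i\<ge>Suc k. poly.coeff q i = 0" "u = poly q \<alpha>"
        by (auto simp: E_def)
      let ?c = "poly.coeff q k"
      have c: "?c \<in> F" using q by (simp add: poly_over_def)
      have "poly_over F (q - Polynomial.monom ?c k)" using q c by (intro ops)
      moreover have "poly.coeff (q - Polynomial.monom ?c k) i = 0" if "i \<ge> k" for i
        using q that by (cases "i = k") auto
      ultimately have "poly (q - Polynomial.monom ?c k) \<alpha> \<in> E k" unfolding E_def by blast
      moreover have "u = ?c * \<alpha> ^ k + poly (q - Polynomial.monom ?c k) \<alpha>"
        using q by (simp add: poly_monom)
      ultimately show "u \<in> ring.line_extension RT F (\<alpha> ^ k) (E k)"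
        using c unfolding line_extension_iff by blast
    qed
    ultimately show ?case
      using ring.Suc_dim[OF RT_ring, of "\<alpha> ^ k" "E k" k F] Suc by simp
  qed
  have "E (Polynomial.degree m) = adjoin F \<alpha>"
  proof (intro equalityI subsetI)
    fix u assume "u \<in> adjoin F \<alpha>"
    then obtain q where q: "poly_over F q" "u = poly q \<alpha>" by (auto simp: adjoin_def)
    obtain s r where sr: "poly_over F s" "poly_over F r" "q = m * s + r"
      "r = 0 \<or> Polynomial.degree r < Polynomial.degree m"
      using monic_division[OF S _ _ q(1)] m unfolding is_minpoly_iff by metis
    have "u = poly r \<alpha>" using m sr(3) q(2) by (simp add: is_minpoly_iff)
    moreover have "\<forall>i\<ge>Polynomial.degree m. poly.coeff r i = 0"
      using sr(4) by (auto simp: Polynomial.coeff_eq_0)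
    ultimately show "u \<in> E (Polynomial.degree m)" using sr(2) unfolding E_def by blast
  qed (auto simp: E_def adjoin_def)
  then show ?thesis using dim[OF order_refl] adjoin_base[OF S] by (simp add: ext_degree_def)
qed

text \<open>
  Every basis vector multiplies the number of elements by \<open>card F\<close>.
\<close>

lemma card_ext_degree:
  assumes F: "is_subfield F" "finite F" and d: "ext_degree F L n"
  shows "finite L \<and> card L = card F ^ n"
proof -
  have F': "subfield F RT" using F by (simp add: is_subfield_iff)
  have "finite E \<and> card E = card F ^ k" if "ring.dimension RT k F E" for k E
    using that
  proof (induction k arbitrary: E)
    case 0
    then show ?case using ring.dimension_zero[OF RT_ring F', of E] by simp
  next
    case (Suc k)
    obtain v E' where E': "ring.dimension RT k F E'" "v \<notin> E'" "E = ring.line_extension RT F v E'"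
      using ring.dimension_backwards[OF RT_ring F' Suc(2)] by auto
    note sub = ring.space_subgroup_props[OF RT_ring F' E'(1), simplified]
    have "E = (\<lambda>(c, e). c * v + e) ` (F \<times> E')"
      unfolding E'(3) by (auto simp: line_extension_iff image_iff) blast
    moreover have "inj_on (\<lambda>(c, e). c * v + e) (F \<times> E')"
    proof (rule inj_onI, clarify)
      fix c e c' e' assume *: "c \<in> F" "e \<in> E'" "c' \<in> F" "e' \<in> E'" "c * v + e = c' * v + e'"
      have "c = c'"
      proof (rule ccontr)
        assume ne: "c \<noteq> c'"
        have "(c - c') * v = e' + - e" using *(5) by (simp add: algebra_simps)
        moreover have "e' + - e \<in> E'" by (rule sub(3)[OF *(4) sub(4)[OF *(2)]])
        ultimately have "(c - c') * v \<in> E'" by simp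
        moreover have "c - c' \<in> F" using * is_subringD[OF is_subfieldD(1)[OF F(1)]] by simp
        ultimately have "inverse (c - c') * ((c - c') * v) \<in> E'"
          using sub(5) is_subfieldD(2)[OF F(1)] by simp
        then show False using ne E'(2) by (simp add: mult.assoc[symmetric])
      qed
      then show "c = c' \<and> e = e'" using * by simp
    qed
    ultimately show ?case using Suc(1)[OF E'(1)] F(2) by (simp add: card_image card_cartesian_product)
  qed
  then show ?thesis using d unfolding ext_degree_def by blast
qed

section \<open>Specialising polynomials along ring homomorphisms\<close>

definition hom_on :: "'b::comm_ring_1 set \<Rightarrow> ('b \<Rightarrow> 'a::comm_ring_1) \<Rightarrow> bool" where
  "hom_on A \<chi> \<longleftrightarrow> is_subring A \<and> \<chi> 1 = 1 \<and>
     (\<forall>a\<in>A. \<forall>b\<in>A. \<chi> (a + b) = \<chi> a + \<chi> b \<and> \<chi> (a * b) = \<chi> a * \<chi> b)"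

lemma hom_onD:
  assumes "hom_on A \<chi>"
  shows "is_subring A" "\<chi> 1 = 1" "a \<in> A \<Longrightarrow> b \<in> A \<Longrightarrow> \<chi> (a + b) = \<chi> a + \<chi> b"
    "a \<in> A \<Longrightarrow> b \<in> A \<Longrightarrow> \<chi> (a * b) = \<chi> a * \<chi> b" "\<chi> 0 = 0" "a \<in> A \<Longrightarrow> \<chi> (- a) = - \<chi> a"
    "a \<in> A \<Longrightarrow> b \<in> A \<Longrightarrow> \<chi> (a - b) = \<chi> a - \<chi> b"
    "(\<And>i. i \<in> I \<Longrightarrow> f i \<in> A) \<Longrightarrow> \<chi> (sum f I) = (\<Sum>i\<in>I. \<chi> (f i))"
    "a \<in> A \<Longrightarrow> \<chi> (a ^ n) = \<chi> a ^ n" "\<chi> (of_nat n) = of_nat n"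
proof -
  show *: "is_subring A" "\<chi> 1 = 1" "a \<in> A \<Longrightarrow> b \<in> A \<Longrightarrow> \<chi> (a + b) = \<chi> a + \<chi> b"
    "a \<in> A \<Longrightarrow> b \<in> A \<Longrightarrow> \<chi> (a * b) = \<chi> a * \<chi> b" for a b
    using assms by (auto simp: hom_on_def)
  note A = is_subringD[OF *(1)]
  show 0: "\<chi> 0 = 0" using *(3)[of 0 0] A(5) by simp
  show minus: "a \<in> A \<Longrightarrow> \<chi> (- a) = - \<chi> a" for a
    using *(3)[of a "- a"] A(4)[of a] 0 by (simp add: eq_neg_iff_add_eq_0 add.commute)
  show "a \<in> A \<Longrightarrow> b \<in> A \<Longrightarrow> \<chi> (a - b) = \<chi> a - \<chi> b"
    using *(3)[of a "- b"] A(4)[of b] minus by simp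
  show "(\<And>i. i \<in> I \<Longrightarrow> f i \<in> A) \<Longrightarrow> \<chi> (sum f I) = (\<Sum>i\<in>I. \<chi> (f i))"
    by (induction I rule: infinite_finite_induct) (simp_all add: 0 *(3) A(8))
  show "a \<in> A \<Longrightarrow> \<chi> (a ^ n) = \<chi> a ^ n"
    by (induction n) (simp_all add: *(2,4) A(7))
  show "\<chi> (of_nat n) = of_nat n"
    by (induction n) (simp_all add: 0 *(2,3) A(1,9))
qed

lemma hom_on_map_poly:
  fixes A :: "'b::idom set" and \<chi> :: "'b \<Rightarrow> 'a::idom"
  assumes h: "hom_on A \<chi>" and p: "poly_over A p" and q: "poly_over A q"
  shows "map_poly \<chi> (p + q) = map_poly \<chi> p + map_poly \<chi> q"
    "map_poly \<chi> (p * q) = map_poly \<chi> p * map_poly \<chi> q"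
    "map_poly \<chi> (pderiv p) = pderiv (map_poly \<chi> p)"
    "map_poly \<chi> 1 = 1"
    "a \<in> A \<Longrightarrow> \<chi> (poly p a) = poly (map_poly \<chi> p) (\<chi> a)"
proof -
  note h' = hom_onD[OF h] and A = is_subringD[OF hom_onD(1)[OF h]]
  have c: "poly.coeff p i \<in> A" "poly.coeff q i \<in> A" for i using p q by (auto simp: poly_over_def)
  note cm = coeff_map_poly[of \<chi>, OF h'(5)]
  show "map_poly \<chi> (p + q) = map_poly \<chi> p + map_poly \<chi> q"
    by (intro poly_eqI) (simp add: cm h'(3) c)
  show "map_poly \<chi> (p * q) = map_poly \<chi> p * map_poly \<chi> q"
    by (intro poly_eqI) (simp add: cm Polynomial.coeff_mult h'(4,8) c A(3))
  show "map_poly \<chi> (pderiv p) = pderiv (map_poly \<chi> p)"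
    by (intro poly_eqI) (simp add: cm coeff_pderiv h'(4,10) c A(9) del: of_nat_Suc)
  show "map_poly \<chi> 1 = 1"
    using h'(2) by simp
  assume a: "a \<in> A"
  have "Polynomial.degree (map_poly \<chi> p) \<le> Polynomial.degree p"
    by (intro degree_le) (simp add: cm Polynomial.coeff_eq_0 h'(5))
  then have "poly (map_poly \<chi> p) (\<chi> a) = (\<Sum>i\<le>Polynomial.degree p. poly.coeff (map_poly \<chi> p) i * \<chi> a ^ i)"
    unfolding poly_altdef by (intro sum.mono_neutral_left) (auto simp: Polynomial.coeff_eq_0)
  then show "\<chi> (poly p a) = poly (map_poly \<chi> p) (\<chi> a)"
    unfolding poly_altdef[of p] by (simp add: cm h'(4,8,9) c a A(3,7))
qed

text \<open>
  The map sending \<open>q(\<alpha>)\<close> to the value at \<open>z\<close> of the specialised \<open>q\<close> is well defined: two polynomials over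
  \<open>A\<close> with the same value at \<open>\<alpha>\<close> differ by a multiple of \<open>m\<close> over \<open>A\<close>, and the specialised \<open>m\<close> vanishes
  at \<open>z\<close>.
\<close>

lemma extend_hom:
  fixes A :: "'b::field set" and \<chi> :: "'b \<Rightarrow> 'a::field"
  assumes h: "hom_on A \<chi>" and AF: "A \<subseteq> F" and m: "is_minpoly F \<alpha> m" "poly_over A m"
    and z: "poly (map_poly \<chi> m) z = 0"
  shows "\<exists>\<chi>'. hom_on (adjoin A \<alpha>) \<chi>' \<and> (\<forall>a\<in>A. \<chi>' a = \<chi> a) \<and> \<chi>' \<alpha> = z \<and>
    (\<forall>q. poly_over A q \<longrightarrow> \<chi>' (poly q \<alpha>) = poly (map_poly \<chi> q) z)"
proof -
  note S = hom_onD(1)[OF h]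
  note ops = poly_over_ops[OF S] and h' = hom_onD[OF h] and A = is_subringD[OF S]
  define \<chi>' where "\<chi>' b = poly (map_poly \<chi> (SOME q. poly_over A q \<and> b = poly q \<alpha>)) z" for b
  have val: "\<chi>' (poly q \<alpha>) = poly (map_poly \<chi> q) z" if q: "poly_over A q" for q
  proof -
    define p where "p = (SOME p. poly_over A p \<and> poly q \<alpha> = poly p \<alpha>)"
    have p: "poly_over A p \<and> poly q \<alpha> = poly p \<alpha>"
      unfolding p_def by (rule someI[of _ q]) (use q in simp)
    then obtain s where s: "poly_over A s" "p - q = m * s"
      using minpoly_dvd_subring[OF S AF m, of "p - q"] ops(2)[of p q] q by auto
    have "map_poly \<chi> p = map_poly \<chi> (m * s + q)" using s(2) by (simp add: algebra_simps)
    also have "\<dots> = map_poly \<chi> m * map_poly \<chi> s + map_poly \<chi> q"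
      using hom_on_map_poly(1)[OF h ops(4)[OF m(2) s(1)] q] hom_on_map_poly(2)[OF h m(2) s(1)] by simp
    finally have "poly (map_poly \<chi> p) z = poly (map_poly \<chi> q) z" using z by simp
    then show ?thesis by (simp add: \<chi>'_def p_def)
  qed
  show ?thesis
  proof (intro exI[of _ \<chi>'] conjI allI impI ballI)
    show "\<chi>' (poly q \<alpha>) = poly (map_poly \<chi> q) z" if "poly_over A q" for q by (rule val[OF that])
    show "\<chi>' a = \<chi> a" if "a \<in> A" for a
    proof -
      have "poly_over A [:a:]" using that by (intro ops)
      from val[OF this] show ?thesis using h'(5) by (simp add: map_poly_pCons)
    qed
    have "poly_over A [:0, 1:]" using A by (intro ops)
    from val[OF this] show "\<chi>' \<alpha> = z" using h'(2,5) by (simp add: map_poly_pCons)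
    show "hom_on (adjoin A \<alpha>) \<chi>'"
      unfolding hom_on_def
    proof (intro conjI ballI)
      show "is_subring (adjoin A \<alpha>)" by (rule adjoin_subring[OF S])
      show "\<chi>' 1 = 1" using val[OF ops(10)] h'(2) by simp
      fix a b assume "a \<in> adjoin A \<alpha>" "b \<in> adjoin A \<alpha>"
      then obtain p q where pq: "poly_over A p" "a = poly p \<alpha>" "poly_over A q" "b = poly q \<alpha>"
        by (auto simp: adjoin_def)
      show "\<chi>' (a + b) = \<chi>' a + \<chi>' b"
        using val[OF ops(1)[OF pq(1,3)]] val[OF pq(1)] val[OF pq(3)] hom_on_map_poly(1)[OF h pq(1,3)]
        by (simp add: pq)
      show "\<chi>' (a * b) = \<chi>' a * \<chi>' b"
        using val[OF ops(4)[OF pq(1,3)]] val[OF pq(1)] val[OF pq(3)] hom_on_map_poly(2)[OF h pq(1,3)]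
        by (simp add: pq)
    qed
  qed
qed

text \<open>
  In every characteristic, a common root of \<open>p\<close> and its derivative has order at least 2.
\<close>

lemma simple_root_pderiv:
  fixes p :: "'a::field poly"
  assumes "rsquarefree p" "poly p a = 0"
  shows "poly (pderiv p) a \<noteq> 0"
proof
  assume d: "poly (pderiv p) a = 0"
  obtain q where q: "p = [:- a, 1:] * q" using assms(2) by (metis poly_eq_0_iff_dvd dvd_def)
  have "pderiv p = q + [:- a, 1:] * pderiv q" unfolding q pderiv_mult by (simp add: pderiv_pCons)
  then have "poly q a = 0" using d by simp
  then obtain r where r: "q = [:- a, 1:] * r" by (metis poly_eq_0_iff_dvd dvd_def)
  have "p = [:- a, 1:] ^ 2 * r" unfolding q r by (simp only: power2_eq_square mult.assoc)
  then have "[:- a, 1:] ^ 2 dvd p" by (rule dvdI)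
  moreover have "p \<noteq> 0" using assms(1) by (simp add: rsquarefree_def)
  ultimately have "2 \<le> order a p" using order_divides[of a 2 p] by blast
  moreover have "order a p = 0 \<or> order a p = 1" using assms(1) unfolding rsquarefree_def by blast
  ultimately show False by linarith
qed

text \<open>
  The inverse of \<open>m'(\<alpha>)\<close> in \<open>F(\<alpha>)\<close> is a polynomial expression over \<open>F\<close>. The coefficients are required to lie
  in \<open>F\<close>, and not just in the ambient field, because the identity will be specialised.
\<close>

lemma minpoly_bezout:
  assumes F: "is_subfield F" and m: "is_minpoly F \<alpha> m" and "poly (pderiv m) \<alpha> \<noteq> 0"
  obtains r s where "poly_over F r" "poly_over F s" "r * pderiv m = 1 + m * s"
proof -
  note ops = poly_over_ops[OF is_subfieldD(1)[OF F]]
  have mo: "poly_over F m" using m by (simp add: is_minpoly_iff)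
  have dm: "poly_over F (pderiv m)" by (rule ops(5)[OF mo])
  obtain r where r: "poly_over F r" "poly r \<alpha> * poly (pderiv m) \<alpha> = 1"
    using minpoly_inverse[OF F m dm assms(3)] by blast
  have "poly_over F (r * pderiv m - 1)" by (intro ops(2,4,10) r dm)
  moreover have "poly (r * pderiv m - 1) \<alpha> = 0" using r by simp
  ultimately obtain s where "poly_over F s" "r * pderiv m - 1 = m * s"
    using minpoly_dvd[OF is_subfieldD(1)[OF F] m order_refl] by blast
  then show ?thesis using that[OF r(1)] by (simp add: algebra_simps)
qed

lemma card_roots_coprime_pderiv:
  fixes p :: "'a::alg_closed_field poly"
  assumes "r * pderiv p = 1 + p * s" "p \<noteq> 0"
  shows "card {x. poly p x = 0} = Polynomial.degree p"
proof -
  obtain A where A: "size A = Polynomial.degree p"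
    "p = Polynomial.smult (Polynomial.lead_coeff p) (\<Prod>x\<in>#A. [:- x, 1:])"
    using alg_closed_imp_factorization[OF assms(2)] by auto
  have simple: "poly (pderiv p) x \<noteq> 0" if "poly p x = 0" for x
  proof
    assume "poly (pderiv p) x = 0"
    then have "poly (r * pderiv p) x = 0" by simp
    then show False unfolding assms(1) using that by simp
  qed
  have lc: "Polynomial.lead_coeff p \<noteq> 0" using assms by simp
  have roots: "poly p x = 0 \<longleftrightarrow> x \<in># A" for x
    by (subst A(2)) (use lc in \<open>simp add: poly_prod_mset prod_mset_zero_iff image_iff\<close>)
  have "count A x \<le> 1" for x
  proof (rule ccontr)
    assume "\<not> count A x \<le> 1"
    then have "{#x, x#} \<subseteq># A" by (simp add: subseteq_mset_def)
    then obtain B where "A = {#x, x#} + B" by (metis subset_mset.le_iff_add)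
    then have "p = [:- x, 1:] * ([:- x, 1:] * Polynomial.smult (Polynomial.lead_coeff p) (\<Prod>x\<in>#B. [:- x, 1:]))"
      using A(2) by (simp del: mult_pCons_left mult_pCons_right add: ac_simps)
    then obtain q where q: "p = [:- x, 1:] * ([:- x, 1:] * q)" by blast
    have "poly p x = 0" "poly (pderiv p) x = 0" unfolding q pderiv_mult by simp_all
    with simple show False by blast
  qed
  then have "A = mset_set (set_mset A)"
    by (intro multiset_eqI) (metis count_mset_set(1,3) finite_set_mset le_antisym not_in_iff count_greater_eq_one_iff)
  then have "size A = card (set_mset A)" by (metis size_mset_set)
  moreover have "{x. poly p x = 0} = set_mset A" using roots by blast
  ultimately show ?thesis using A(1) by simp
qed

text \<open>
  The specialised Bezout identity excludes common roots of the specialised polynomial and its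
  derivative.
\<close>

lemma card_roots_specialised_minpoly:
  fixes A :: "'b::field set" and \<chi> :: "'b \<Rightarrow> 'a::alg_closed_field"
  assumes h: "hom_on A \<chi>" and m: "poly_over A m" "Polynomial.lead_coeff m = 1"
    and rs: "poly_over A r" "poly_over A s" "r * pderiv m = 1 + m * s"
  shows "card {x. poly (map_poly \<chi> m) x = 0} = Polynomial.degree m"
proof -
  note h' = hom_onD[OF h] and ops = poly_over_ops[OF hom_onD(1)[OF h]]
  have "map_poly \<chi> (r * pderiv m) = map_poly \<chi> (1 + m * s)" using rs(3) by simp
  then have eq: "map_poly \<chi> r * pderiv (map_poly \<chi> m) = 1 + map_poly \<chi> m * map_poly \<chi> s"
    using hom_on_map_poly(2)[OF h rs(1) ops(5)[OF m(1)]] hom_on_map_poly(3)[OF h m(1) m(1)]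
      hom_on_map_poly(1)[OF h ops(10) ops(4)[OF m(1) rs(2)]] hom_on_map_poly(2)[OF h m(1) rs(2)]
      hom_on_map_poly(4)[OF h m(1) m(1)] by simp
  have lc: "poly.coeff (map_poly \<chi> m) (Polynomial.degree m) = 1"
    using m(2) h'(2) by (simp add: coeff_map_poly h'(5))
  then have "map_poly \<chi> m \<noteq> 0" by auto
  moreover have "Polynomial.degree (map_poly \<chi> m) = Polynomial.degree m"
  proof (rule antisym)
    show "Polynomial.degree (map_poly \<chi> m) \<le> Polynomial.degree m"
      by (intro degree_le) (simp add: coeff_map_poly Polynomial.coeff_eq_0 h'(5))
    show "Polynomial.degree m \<le> Polynomial.degree (map_poly \<chi> m)"
      by (rule le_degree) (simp add: lc)
  qed
  ultimately show ?thesis using card_roots_coprime_pderiv[OF eq] by simp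
qed

section \<open>Chords and tangents\<close>

fun point_neg :: "'a::field weierstrass \<Rightarrow> 'a point \<Rightarrow> 'a point" where
  "point_neg W Infinity = Infinity"
| "point_neg W (Affine x y) = Affine x (- y - wa1 W * x - wa3 W)"

text \<open>
  If both partial derivatives vanish, then \<open>a3\<close>, \<open>a4\<close> and \<open>a6\<close> are determined by \<open>a1\<close>, \<open>a2\<close> and the point,
  and the discriminant becomes identically zero.
\<close>

lemma nonsingular:
  fixes W :: "'a::field weierstrass"
  assumes "elliptic_curve W" "on_curve W x0 y0"
    and "2 * y0 + wa1 W * x0 + wa3 W = 0"
  shows "3 * x0 ^ 2 + 2 * wa2 W * x0 + wa4 W - wa1 W * y0 \<noteq> 0"
proof
  assume d2: "3 * x0 ^ 2 + 2 * wa2 W * x0 + wa4 W - wa1 W * y0 = 0"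
  obtain a1 a2 a3 a4 a6 where W: "W = Weierstrass a1 a2 a3 a4 a6" by (cases W)
  have a3: "a3 = - (2 * y0) - a1 * x0"
    using assms(3)[unfolded W weierstrass.sel] by Groebner_Basis.algebra
  have a4: "a4 = a1 * y0 - 3 * x0 ^ 2 - 2 * a2 * x0"
    using d2[unfolded W weierstrass.sel] by Groebner_Basis.algebra
  have a6: "a6 = y0 ^ 2 + a1 * x0 * y0 + a3 * y0 - x0 ^ 3 - a2 * x0 ^ 2 - a4 * x0"
    using assms(2) by (simp add: W on_curve_def)
  have "discriminant W = 0"
    unfolding W discriminant_def Let_def weierstrass.sel a6 a4 a3
    by Groebner_Basis.algebra
  with assms(1) show False by (simp add: elliptic_curve_def)
qed

text \<open>
  On the line \<open>y = l x + n\<close>, the equation of the curve becomes a monic cubic in \<open>x\<close>. The first two claims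
  compare its coefficients with those of \<open>(X - x1) (X - x2) (X - x3)\<close>. The two cubics differ by a linear
  polynomial, because \<open>x3\<close> has been chosen to make the sums of the roots equal. It is zero: it vanishes at
  \<open>x1\<close> and at \<open>x2\<close>, and for a tangent the choice of \<open>l\<close> makes its slope zero.
\<close>

lemma chord_tangent_coeffs:
  fixes W :: "'a::field weierstrass"
  assumes c1: "on_curve W x1 y1" and c2: "on_curve W x2 y2"
    and ne: "\<not> (x1 = x2 \<and> y1 + y2 + wa1 W * x2 + wa3 W = 0)"
    and l: "l = (if x1 = x2
                 then (3 * x1 ^ 2 + 2 * wa2 W * x1 + wa4 W - wa1 W * y1)
                        / (2 * y1 + wa1 W * x1 + wa3 W)
                 else (y2 - y1) / (x2 - x1))"
    and n: "n = y1 - l * x1"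
    and x3: "x3 = l ^ 2 + wa1 W * l - wa2 W - x1 - x2"
  shows "x1 * x2 + x1 * x3 + x2 * x3 = wa4 W - 2 * l * n - wa1 W * n - wa3 W * l" (is ?A)
    and "x1 * x2 * x3 = n ^ 2 + wa3 W * n - wa6 W" (is ?B)
    and "y1 = l * x1 + n" "y2 = l * x2 + n"
    and "x1 = x2 \<Longrightarrow> y1 = y2 \<and> 2 * y1 + wa1 W * x1 + wa3 W \<noteq> 0"
proof -
  obtain a1 a2 a3 a4 a6 where W: "W = Weierstrass a1 a2 a3 a4 a6" by (cases W)
  note c1 = c1[unfolded W on_curve_def weierstrass.sel]
  note c2 = c2[unfolded W on_curve_def weierstrass.sel]
  \<comment> \<open>the difference of \<open>(X - x1) (X - x2) (X - x3)\<close> and the cubic is \<open>A X - B\<close>\<close>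
  define A where "A = x1 * x2 + x1 * x3 + x2 * x3 - (a4 - 2 * l * n - a1 * n - a3 * l)"
  define B where "B = x1 * x2 * x3 - (n ^ 2 + a3 * n - a6)"
  have x3: "x3 = l ^ 2 + a1 * l - a2 - x1 - x2" using x3 by (simp add: W)
  show y1: "y1 = l * x1 + n" by (simp add: n)
  show same: "y1 = y2 \<and> 2 * y1 + wa1 W * x1 + wa3 W \<noteq> 0" if "x1 = x2"
  proof -
    have "(y1 - y2) * (y1 + y2 + a1 * x2 + a3)
        = (y1 ^ 2 + a1 * x2 * y1 + a3 * y1) - (y2 ^ 2 + a1 * x2 * y2 + a3 * y2)"
      by (simp add: algebra_simps power2_eq_square)
    also have "\<dots> = 0" using c1 c2 that by simp
    finally have "(y1 - y2) * (y1 + y2 + a1 * x2 + a3) = 0" .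
    then have "y1 = y2" using ne that by (simp add: W)
    with ne that show ?thesis by (auto simp: W)
  qed
  show y2: "y2 = l * x2 + n"
  proof (cases "x1 = x2")
    case True then show ?thesis using same y1 by simp
  next
    case False
    then have "l * (x2 - x1) = y2 - y1" by (simp add: l)
    then show ?thesis unfolding n by Groebner_Basis.algebra
  qed
  have zero1: "A * x1 = B"
    using c1 unfolding A_def B_def x3 y1 by Groebner_Basis.algebra
  have "A = 0"
  proof (cases "x1 = x2")
    case False
    have zero2: "A * x2 = B"
      using c2 unfolding A_def B_def x3 y2 by Groebner_Basis.algebra
    then have "A * (x1 - x2) = 0" using zero1 by (simp add: algebra_simps)
    then show ?thesis using False by simp
  next
    case True
    have "2 * y1 + a1 * x1 + a3 \<noteq> 0" using conjunct2[OF same[OF True]] by (simp add: W)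
    then have "l * (2 * y1 + a1 * x1 + a3) = 3 * x1 ^ 2 + 2 * a2 * x1 + a4 - a1 * y1"
      using True by (simp add: l W)
    then show ?thesis unfolding A_def x3 True[symmetric] n by Groebner_Basis.algebra
  qed
  then show ?A by (simp add: A_def W)
  show ?B using zero1 \<open>A = 0\<close> by (simp add: B_def W)
qed

section \<open>The coordinate ring of a Weierstrass curve\<close>

text \<open>
  The field \<open>'b\<close> contains the coordinate functions: \<open>\<iota>\<close> embeds the polynomials in \<open>x\<close>, and \<open>y\<close> satisfies
  \<open>y\<^sup>2 + s y = w\<close> with polynomials \<open>s\<close> and \<open>w\<close> in \<open>x\<close>. That \<open>1\<close> and \<open>y\<close> are independent over the polynomials
  in \<open>x\<close> is a consequence, see \<open>elem_eq_0_iff\<close> below.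
\<close>

locale weierstrass_ring =
  fixes W :: "'a::field weierstrass" and \<iota> :: "'a poly \<Rightarrow> 'b::field" and y :: 'b
  assumes iota_add: "\<iota> (p + q) = \<iota> p + \<iota> q"
    and iota_mult: "\<iota> (p * q) = \<iota> p * \<iota> q"
    and iota_1: "\<iota> 1 = 1"
    and iota_inj: "\<iota> p = 0 \<Longrightarrow> p = 0"
    and y_eq: "y ^ 2 + \<iota> [:wa3 W, wa1 W:] * y = \<iota> [:wa6 W, wa4 W, wa2 W, 1:]"
begin

definition s :: "'a poly" where "s = [:wa3 W, wa1 W:]"
definition w :: "'a poly" where "w = [:wa6 W, wa4 W, wa2 W, 1:]"

lemma weierstrass_eq: "y ^ 2 = \<iota> w - \<iota> s * y"
  using y_eq by (simp add: s_def w_def algebra_simps)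

lemma iota_0 [simp]: "\<iota> 0 = 0"
  using iota_add[of 0 0] by (metis add_cancel_right_right)

lemma iota_minus: "\<iota> (- p) = - \<iota> p"
  using iota_add[of p "-p"] by (simp add: eq_neg_iff_add_eq_0 add.commute)

lemma iota_diff: "\<iota> (p - q) = \<iota> p - \<iota> q"
  using iota_add[of p "-q"] by (simp add: iota_minus)

lemma iota_power: "\<iota> (p ^ n) = \<iota> p ^ n"
  by (induction n) (auto simp: iota_1 iota_mult)

lemmas iota_hom = iota_add iota_mult iota_1 iota_minus iota_diff iota_power iota_0

definition elem :: "'a poly \<Rightarrow> 'a poly \<Rightarrow> 'b" where
  "elem p q = \<iota> p + \<iota> q * y"

definition coord_ring :: "'b set" where
  "coord_ring = {elem p q | p q. True}"

text \<open>
  The norm of \<open>p + q y\<close>, that is, its product with the conjugate obtained from \<open>y \<mapsto> - y - s\<close>.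
\<close>

definition norm_poly :: "'a poly \<Rightarrow> 'a poly \<Rightarrow> 'a poly" where
  "norm_poly p q = p ^ 2 - p * q * s - q ^ 2 * w"

lemma elem_mult:
  "elem p q * elem p' q' = elem (p * p' + q * q' * w) (p * q' + q * p' - q * q' * s)"
proof -
  show ?thesis using weierstrass_eq
    unfolding elem_def iota_hom by Groebner_Basis.algebra
qed

lemma elem_conj: "elem p q * elem (p - q * s) (- q) = \<iota> (norm_poly p q)"
proof -
  show ?thesis using weierstrass_eq
    unfolding elem_def norm_poly_def iota_hom by Groebner_Basis.algebra
qed

lemma norm_poly_mult:
  "norm_poly (p * p' + q * q' * w) (p * q' + q * p' - q * q' * s) = norm_poly p q * norm_poly p' q'"
proof -
  have gen: "(p * p' + q * q' * b)\<^sup>2 - (p * p' + q * q' * b) * (p * q' + q * p' - q * q' * a) * a - (p * q' + q * p' - q * q' * a)\<^sup>2 * b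
      = (p\<^sup>2 - p * q * a - q\<^sup>2 * b) * (p'\<^sup>2 - p' * q' * a - q'\<^sup>2 * b)" for a b :: "'a poly"
    by Groebner_Basis.algebra
  show ?thesis unfolding norm_poly_def by (rule gen)
qed

text \<open>
  The terms \<open>p\<^sup>2\<close> and \<open>q\<^sup>2 w\<close> have degrees of different parity, so they cannot cancel, and the degree of
  the mixed term is below the larger of the two.
\<close>

lemma degree_norm_poly:
  assumes "q \<noteq> 0"
  shows "Polynomial.degree (norm_poly p q) = max (2 * Polynomial.degree p) (2 * Polynomial.degree q + 3)"
proof -
  have w: "Polynomial.degree w = 3" "w \<noteq> 0" by (simp_all add: w_def)
  have A: "Polynomial.degree (p ^ 2) = 2 * Polynomial.degree p"
    by (simp add: Polynomial.degree_power_eq power2_eq_square degree_mult_eq_0 Polynomial.degree_mult_eq) (cases "p = 0"; simp add: Polynomial.degree_mult_eq)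
  have B: "Polynomial.degree (q ^ 2 * w) = 2 * Polynomial.degree q + 3"
    using assms by (simp add: power2_eq_square Polynomial.degree_mult_eq w)
  have C: "Polynomial.degree (p * q * s) \<le> Polynomial.degree p + Polynomial.degree q + 1"
  proof -
    have "Polynomial.degree s \<le> 1" by (simp add: s_def)
    then show ?thesis using degree_mult_le[of "p*q" s] degree_mult_le[of p q] by linarith
  qed
  \<comment> \<open>equality of the two bounds is excluded by parity\<close>
  show ?thesis
  proof (cases "2 * Polynomial.degree p > 2 * Polynomial.degree q + 3")
    case True
    have "Polynomial.degree (p * q * s + q ^ 2 * w) < 2 * Polynomial.degree p"
      using True C by (intro degree_add_less) (auto simp only: B)
    then have "Polynomial.degree (p ^ 2 - (p * q * s + q ^ 2 * w)) = 2 * Polynomial.degree p"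
      using A degree_add_eq_left[of "- (p * q * s + q ^ 2 * w)" "p ^ 2"]
      by (simp only: degree_minus diff_conv_add_uminus)
    then show ?thesis using True by (simp add: norm_poly_def algebra_simps)
  next
    case False
    have "Polynomial.degree (p ^ 2 - p * q * s) < 2 * Polynomial.degree q + 3"
    proof (rule degree_diff_less)
      show "Polynomial.degree (p ^ 2) < 2 * Polynomial.degree q + 3"
        unfolding A using False by presburger
      show "Polynomial.degree (p * q * s) < 2 * Polynomial.degree q + 3"
        using False C by linarith
    qed
    then have "Polynomial.degree ((p ^ 2 - p * q * s) - q ^ 2 * w) = 2 * Polynomial.degree q + 3"
      using B degree_add_eq_right[of "p ^ 2 - p * q * s" "- (q ^ 2 * w)"] by simp
    then show ?thesis using False by (simp add: norm_poly_def)
  qed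
qed

lemma norm_poly_eq_0_iff: "norm_poly p q = 0 \<longleftrightarrow> p = 0 \<and> q = 0"
proof (cases "q = 0")
  case True then show ?thesis by (simp add: norm_poly_def)
next
  case False
  then show ?thesis using degree_norm_poly[OF False, of p] by auto
qed

lemma elem_eq_0_iff: "elem p q = 0 \<longleftrightarrow> p = 0 \<and> q = 0"
proof
  assume "elem p q = 0"
  then have "\<iota> (norm_poly p q) = 0" using elem_conj[of p q] by simp
  then show "p = 0 \<and> q = 0" using iota_inj norm_poly_eq_0_iff by blast
qed (simp add: elem_def)

lemma elem_add: "elem p q + elem p' q' = elem (p + p') (q + q')"
  by (simp add: elem_def iota_hom algebra_simps)

lemma elem_minus: "- elem p q = elem (- p) (- q)"
  by (simp add: elem_def iota_hom algebra_simps)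

lemma elem_diff: "elem p q - elem p' q' = elem (p - p') (q - q')"
  by (simp add: elem_def iota_hom algebra_simps)

lemma elem_eq_iff: "elem p q = elem p' q' \<longleftrightarrow> p = p' \<and> q = q'"
  using elem_eq_0_iff[of "p - p'" "q - q'"] elem_diff[of p q p' q'] by auto

lemma coord_ringE:
  assumes "f \<in> coord_ring" obtains p q where "f = elem p q"
  using assms unfolding coord_ring_def by blast

lemma elem_in [simp, intro]: "elem p q \<in> coord_ring"
  unfolding coord_ring_def by blast

lemma coord_ring_add [intro]: "f \<in> coord_ring \<Longrightarrow> g \<in> coord_ring \<Longrightarrow> f + g \<in> coord_ring"
  by (metis coord_ringE elem_add elem_in)

lemma coord_ring_mult [intro]: "f \<in> coord_ring \<Longrightarrow> g \<in> coord_ring \<Longrightarrow> f * g \<in> coord_ring"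
  by (metis coord_ringE elem_mult elem_in)

lemma coord_ring_minus [intro]: "f \<in> coord_ring \<Longrightarrow> - f \<in> coord_ring"
  by (metis coord_ringE elem_minus elem_in)

lemma coord_ring_diff [intro]: "f \<in> coord_ring \<Longrightarrow> g \<in> coord_ring \<Longrightarrow> f - g \<in> coord_ring"
  by (metis coord_ringE elem_diff elem_in)

lemma iota_eq_elem: "\<iota> p = elem p 0" and y_eq_elem: "y = elem 0 1"
  by (simp_all add: elem_def iota_1)

lemma iota_in [simp, intro]: "\<iota> p \<in> coord_ring" and y_in [simp, intro]: "y \<in> coord_ring"
  by (metis iota_eq_elem elem_in, metis y_eq_elem elem_in)

lemma coord_ring_0 [simp, intro]: "0 \<in> coord_ring" and coord_ring_1 [simp, intro]: "1 \<in> coord_ring"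
  by (metis iota_0 iota_in, metis iota_1 iota_in)

lemma coord_ring_power [intro]: "f \<in> coord_ring \<Longrightarrow> f ^ n \<in> coord_ring"
  by (induction n) auto

lemma coord_ring_sum [intro]: "(\<And>i. i \<in> I \<Longrightarrow> f i \<in> coord_ring) \<Longrightarrow> sum f I \<in> coord_ring"
  by (induction I rule: infinite_finite_induct) auto

subsection \<open>Evaluation at points of the curve\<close>

text \<open>
  Well defined because \<open>p\<close> and \<open>q\<close> are determined by \<open>f\<close>.
\<close>

definition ev :: "'a \<Rightarrow> 'a \<Rightarrow> 'b \<Rightarrow> 'a" where
  "ev x0 y0 f = (THE c. \<exists>p q. f = elem p q \<and> c = poly p x0 + poly q x0 * y0)"

lemma ev_elem: "ev x0 y0 (elem p q) = poly p x0 + poly q x0 * y0"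
  unfolding ev_def by (rule the_equality) (auto simp: elem_eq_iff)

lemma ev_iota: "ev x0 y0 (\<iota> p) = poly p x0" and ev_y: "ev x0 y0 y = y0"
  by (subst iota_eq_elem, simp add: ev_elem, subst y_eq_elem, simp only: ev_elem, simp)

lemma ev_0 [simp]: "ev x0 y0 0 = 0" and ev_1 [simp]: "ev x0 y0 1 = 1"
  using ev_iota[of x0 y0 0] ev_iota[of x0 y0 1] by (simp_all add: iota_1)

lemma ev_add: "f \<in> coord_ring \<Longrightarrow> g \<in> coord_ring \<Longrightarrow> ev x0 y0 (f + g) = ev x0 y0 f + ev x0 y0 g"
  by (auto elim!: coord_ringE simp: elem_add ev_elem algebra_simps)

lemma ev_diff: "f \<in> coord_ring \<Longrightarrow> g \<in> coord_ring \<Longrightarrow> ev x0 y0 (f - g) = ev x0 y0 f - ev x0 y0 g"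
  by (auto elim!: coord_ringE simp: elem_diff ev_elem algebra_simps)

lemma poly_s: "poly s x0 = wa1 W * x0 + wa3 W" and poly_w: "poly w x0 = x0 ^ 3 + wa2 W * x0 ^ 2 + wa4 W * x0 + wa6 W"
  by (simp_all add: s_def w_def algebra_simps power2_eq_square power3_eq_cube)

lemma ev_mult:
  assumes "on_curve W x0 y0" "f \<in> coord_ring" "g \<in> coord_ring"
  shows "ev x0 y0 (f * g) = ev x0 y0 f * ev x0 y0 g"
proof -
  obtain p q p' q' where fg: "f = elem p q" "g = elem p' q'" using assms by (metis coord_ringE)
  have "y0 ^ 2 = poly w x0 - poly s x0 * y0"
    using assms(1) unfolding on_curve_def poly_s poly_w by (simp add: algebra_simps)
  then show ?thesis
    unfolding fg elem_mult ev_elem poly_add poly_mult poly_diff by Groebner_Basis.algebra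
qed

lemma ev_power: "on_curve W x0 y0 \<Longrightarrow> f \<in> coord_ring \<Longrightarrow> ev x0 y0 (f ^ n) = ev x0 y0 f ^ n"
  by (induction n) (auto simp: ev_mult coord_ring_power)

lemma ev_sum: "(\<And>i. i \<in> I \<Longrightarrow> f i \<in> coord_ring) \<Longrightarrow> ev x0 y0 (sum f I) = (\<Sum>i\<in>I. ev x0 y0 (f i))"
  by (induction I rule: infinite_finite_induct) (auto simp: ev_add coord_ring_sum)

lemma finite_points_over: "finite {y0. on_curve W x0 y0}"
proof -
  define r where "r = [: - poly w x0, poly s x0, 1:]"
  have "r \<noteq> 0" by (simp add: r_def)
  then have "finite {y0. poly r y0 = 0}" by (rule poly_roots_finite)
  moreover have "{y0. on_curve W x0 y0} \<subseteq> {y0. poly r y0 = 0}"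
    unfolding r_def on_curve_def poly_s poly_w by (auto simp: algebra_simps power2_eq_square)
  ultimately show ?thesis by (rule finite_subset[rotated])
qed

text \<open>
  A zero of \<open>f\<close> lies over a root of the norm of \<open>f\<close>.
\<close>

lemma finite_zeros:
  assumes "f \<in> coord_ring" "f \<noteq> 0"
  shows "finite {(x0, y0). on_curve W x0 y0 \<and> ev x0 y0 f = 0}"
proof -
  obtain p q where f: "f = elem p q" using assms(1) by (rule coord_ringE)
  have "norm_poly p q \<noteq> 0" using assms(2) norm_poly_eq_0_iff[of p q] elem_eq_0_iff[of p q] f by simp
  then have fin: "finite {x0. poly (norm_poly p q) x0 = 0}" by (rule poly_roots_finite)
  have "{(x0, y0). on_curve W x0 y0 \<and> ev x0 y0 f = 0} \<subseteq>
      (SIGMA x0:{x0. poly (norm_poly p q) x0 = 0}. {y0. on_curve W x0 y0})"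
  proof clarify
    fix x0 y0 assume c: "on_curve W x0 y0" "ev x0 y0 f = 0"
    have "ev x0 y0 (\<iota> (norm_poly p q)) = 0"
      unfolding elem_conj[symmetric] using c f by (simp add: ev_mult)
    then show "x0 \<in> {x0. poly (norm_poly p q) x0 = 0} \<and> y0 \<in> {y0. on_curve W x0 y0}"
      using c by (simp add: ev_iota)
  qed
  then show ?thesis by (rule finite_subset) (intro finite_SigmaI fin finite_points_over)
qed

section \<open>Ideal classes of points\<close>

text \<open>
  The submodule over the coordinate ring that is spanned by \<open>S\<close>. Ideals are handled through generating
  sets, whose elementwise products generate the product ideals.
\<close>

inductive_set rspan :: "'b set \<Rightarrow> 'b set" for S where
  rspan_0 [simp, intro]: "0 \<in> rspan S"
| rspan_step: "f \<in> rspan S \<Longrightarrow> r \<in> coord_ring \<Longrightarrow> g \<in> S \<Longrightarrow> f + r * g \<in> rspan S"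

lemma rspan_add:
  assumes "f \<in> rspan S" "g \<in> rspan S" shows "f + g \<in> rspan S"
  using assms(2,1)
proof (induction g rule: rspan.induct)
  case (rspan_step h r k)
  then show ?case using rspan.rspan_step[of "f + h" S r k] by (simp add: add.assoc)
qed simp

lemma rspan_base: "g \<in> S \<Longrightarrow> g \<in> rspan S"
  using rspan_step[of 0 S 1 g] by simp

lemma rspan_mult:
  assumes "r \<in> coord_ring" "f \<in> rspan S" shows "r * f \<in> rspan S"
  using assms(2,1)
proof (induction f rule: rspan.induct)
  case (rspan_step h r' k)
  then show ?case using rspan.rspan_step[of "r * h" S "r * r'" k]
    by (simp add: algebra_simps coord_ring_mult)
qed simp

lemma rspan_minus: "f \<in> rspan S \<Longrightarrow> - f \<in> rspan S"
  using rspan_mult[of "-1" f S] coord_ring_minus[of 1] by simp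

lemma rspan_diff: "f \<in> rspan S \<Longrightarrow> g \<in> rspan S \<Longrightarrow> f - g \<in> rspan S"
  using rspan_add[of f S "- g"] rspan_minus by simp

lemma rspan_minimal:
  assumes "\<And>g. g \<in> S \<Longrightarrow> c * g \<in> rspan T" "f \<in> rspan S"
  shows "c * f \<in> rspan T"
  using assms(2)
proof (induction f rule: rspan.induct)
  case (rspan_step f r g)
  have "c * f + r * (c * g) \<in> rspan T"
    using rspan_step assms(1) by (intro rspan_add rspan_mult[of r])
  then show ?case by (simp add: algebra_simps)
qed simp

text \<open>
  \<open>S\<close> and \<open>T\<close> span the same module up to a factor from the field, so they define the same ideal class.
\<close>

definition sim :: "'b set \<Rightarrow> 'b set \<Rightarrow> bool" where
  "sim S T \<longleftrightarrow> (\<exists>c. c \<noteq> 0 \<and> (\<forall>f\<in>rspan S. c * f \<in> rspan T) \<and> (\<forall>g\<in>rspan T. g / c \<in> rspan S))"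

lemma simI:
  assumes "c \<noteq> 0" "\<And>f. f \<in> S \<Longrightarrow> c * f \<in> rspan T" "\<And>g. g \<in> T \<Longrightarrow> g / c \<in> rspan S"
  shows "sim S T"
  unfolding sim_def
  using assms rspan_minimal[of S c T] rspan_minimal[of T "inverse c" S]
  by (intro exI[of _ c]) (auto simp: divide_inverse mult.commute)

lemma sim_refl: "sim S S"
  by (rule simI[of 1]) (auto intro: rspan_base)

lemma sim_sym:
  assumes "sim S T" shows "sim T S"
proof -
  obtain c where "c \<noteq> 0" "\<forall>f\<in>rspan S. c * f \<in> rspan T" "\<forall>g\<in>rspan T. g / c \<in> rspan S"
    using assms unfolding sim_def by blast
  then show ?thesis unfolding sim_def
    by (intro exI[of _ "inverse c"]) (simp add: divide_inverse mult.commute)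
qed

lemma sim_trans: "sim S T \<Longrightarrow> sim T U \<Longrightarrow> sim S U"
proof -
  assume "sim S T" "sim T U"
  then obtain c d where "c \<noteq> 0" "\<forall>f\<in>rspan S. c * f \<in> rspan T" "\<forall>g\<in>rspan T. g / c \<in> rspan S"
    "d \<noteq> 0" "\<forall>f\<in>rspan T. d * f \<in> rspan U" "\<forall>g\<in>rspan U. g / d \<in> rspan T"
    unfolding sim_def by blast
  note cd = this
  have "d * c * f \<in> rspan U" if "f \<in> rspan S" for f
    using cd that by (simp add: mult.assoc)
  moreover have "g / (d * c) \<in> rspan S" if "g \<in> rspan U" for g
    using cd that by (metis divide_divide_eq_left)
  ultimately show "sim S U" unfolding sim_def
    using cd by (intro exI[of _ "d * c"]) simp
qed

definition gprod :: "'b set \<Rightarrow> 'b set \<Rightarrow> 'b set" where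
  "gprod S T = {f * g | f g. f \<in> S \<and> g \<in> T}"

lemma gprod_commute: "gprod S T = gprod T S"
  unfolding gprod_def by (rule Collect_cong) (blast intro: mult.commute)

lemma gprod_assoc: "gprod (gprod S T) U = gprod S (gprod T U)"
  unfolding gprod_def by (auto simp: mult.assoc) (metis mult.assoc)+

lemma gprod_1: "gprod {1} S = S"
  unfolding gprod_def by auto

lemma rspan_gprod:
  assumes "f \<in> rspan S" "g \<in> T"
  shows "g * f \<in> rspan (gprod S T)"
proof (rule rspan_minimal[OF _ assms(1)])
  fix h assume "h \<in> S"
  then show "g * h \<in> rspan (gprod S T)"
    using assms(2) unfolding gprod_def
    by (intro rspan_base CollectI exI[of _ h] exI[of _ g]) (simp add: mult.commute)
qed

lemma sim_gprod: assumes "sim S S'" shows "sim (gprod S T) (gprod S' T)"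
proof -
  obtain c where c: "c \<noteq> 0" "\<And>f. f\<in>rspan S \<Longrightarrow> c * f \<in> rspan S'" "\<And>g. g\<in>rspan S' \<Longrightarrow> g / c \<in> rspan S"
    using assms unfolding sim_def by blast
  show ?thesis
  proof (rule simI[OF c(1)])
    fix f assume "f \<in> gprod S T"
    then obtain a b where ab: "a \<in> S" "b \<in> T" "f = a * b" by (auto simp: gprod_def)
    from rspan_gprod[OF c(2)[OF rspan_base[OF ab(1)]] ab(2)] show "c * f \<in> rspan (gprod S' T)"
      by (simp add: ab algebra_simps)
  next
    fix f assume "f \<in> gprod S' T"
    then obtain a b where ab: "a \<in> S'" "b \<in> T" "f = a * b" by (auto simp: gprod_def)
    from rspan_gprod[OF c(3)[OF rspan_base[OF ab(1)]] ab(2)] show "f / c \<in> rspan (gprod S T)"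
      by (simp add: ab algebra_simps)
  qed
qed

lemma sim_gprod2: "sim S S' \<Longrightarrow> sim T T' \<Longrightarrow> sim (gprod S T) (gprod S' T')"
  using sim_gprod[of S S' T] sim_gprod[of T T' S'] sim_trans[of "gprod S T" "gprod S' T" "gprod S' T'"]
  by (simp add: gprod_commute[of _ S'])

abbreviation xc where "xc \<equiv> \<iota> [:0, 1:]"
definition const :: "'a \<Rightarrow> 'b" where "const a = \<iota> [:a:]"

lemma const_hom: "const (a + b) = const a + const b" "const (a - b) = const a - const b" "const (- a) = - const a"
  "const (a * b) = const a * const b" "const 0 = 0" "const 1 = 1" "const (a ^ n) = const a ^ n" "const (numeral k) = numeral k"
proof -
  show add: "const (a + b) = const a + const b" for a b unfolding const_def iota_add[symmetric] by simp
  show "const (a - b) = const a - const b" unfolding const_def iota_diff[symmetric] by simp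
  show "const (- a) = - const a" unfolding const_def iota_minus[symmetric] by simp
  show mult: "const (a * b) = const a * const b" for a b unfolding const_def iota_mult[symmetric] by (simp add: mult.commute)
  show zero: "const 0 = 0" by (simp add: const_def)
  show one: "const 1 = 1" using iota_1 unfolding const_def one_pCons .
  show "const (a ^ n) = const a ^ n" by (induction n) (simp_all add: one mult)
  have "const (of_nat m) = of_nat m" for m by (induction m) (simp_all add: zero one add)
  from this[of "numeral k"] show "const (numeral k) = numeral k" by simp
qed

lemma const_eq_0_iff [simp]: "const a = 0 \<longleftrightarrow> a = 0"
  using iota_inj[of "[:a:]"] by (auto simp: const_def)

lemma iota_pCons: "\<iota> (pCons a p) = const a + xc * \<iota> p"
  unfolding const_def iota_mult[symmetric] iota_add[symmetric] by simp

lemma iota_s: "\<iota> s = const (wa1 W) * xc + const (wa3 W)"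
  and iota_w: "\<iota> w = xc ^ 3 + const (wa2 W) * xc ^ 2 + const (wa4 W) * xc + const (wa6 W)"
  and iota_lin: "\<iota> [:- a, 1:] = xc - const a"
  unfolding s_def w_def const_def iota_mult[symmetric] iota_power[symmetric] iota_add[symmetric]
    iota_diff[symmetric]
  by (simp_all add: power3_eq_cube power2_eq_square)

lemma const_in [simp, intro]: "const a \<in> coord_ring" by (simp add: const_def)

lemma xc_minus_const_neq_0: "xc - const a \<noteq> 0"
  unfolding iota_lin[symmetric] using iota_inj by fastforce

text \<open>
  Generators of the ideal of functions that vanish at the point. The point at infinity gives the unit
  ideal, the trivial class.
\<close>

fun gens :: "'a point \<Rightarrow> 'b set" where
  "gens Infinity = {1}"
| "gens (Affine x0 y0) = {xc - const x0, y - const y0}"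

lemma gprod_mem: "f \<in> S \<Longrightarrow> g \<in> T \<Longrightarrow> f * g \<in> rspan (gprod S T)"
  by (rule rspan_base) (auto simp: gprod_def)

text \<open>
  This ideal identity comes from the vertical line through the point: the product of the two ideals is
  generated by \<open>U = x - x0\<close>. To find \<open>U\<close> in the product one needs the point to be nonsingular.
\<close>

lemma gens_neg:
  assumes "elliptic_curve W" "on_curve W x0 y0"
  shows "sim (gprod (gens (Affine x0 y0)) (gens (point_neg W (Affine x0 y0)))) {1}"
proof -
  obtain a1 a2 a3 a4 a6 where W: "W = Weierstrass a1 a2 a3 a4 a6" by (cases W)
  define y0' where "y0' = - y0 - a1 * x0 - a3"
  define U where "U = xc - const x0"
  define V where "V = y - const y0"
  define V' where "V' = y - const y0'"
  have gens: "gens (Affine x0 y0) = {U, V}" "gens (point_neg W (Affine x0 y0)) = {U, V'}"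
    by (simp_all add: U_def V_def V'_def y0'_def W)
  let ?S = "gprod {U, V} {U, V'}"
  have U0: "U \<noteq> 0" unfolding U_def by (rule xc_minus_const_neq_0)
  \<comment> \<open>the quotient of \<open>V V'\<close> by \<open>U\<close>; at the point it takes the value of the derivative of the equation by \<open>x\<close>\<close>
  define D where "D = xc ^ 2 + xc * const x0 + const x0 ^ 2 + const a2 * (xc + const x0) + const a4 - const a1 * y"
  have eq: "y ^ 2 = xc ^ 3 + const a2 * xc ^ 2 + const a4 * xc + const a6 - const a1 * xc * y - const a3 * y"
    using weierstrass_eq unfolding iota_s iota_w by (simp add: W algebra_simps)
  have "const (y0 ^ 2 + a1 * x0 * y0 + a3 * y0) = const (x0 ^ 3 + a2 * x0 ^ 2 + a4 * x0 + a6)"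
    using assms(2) by (simp add: on_curve_def W)
  then have eq0: "const y0 ^ 2 + const a1 * const x0 * const y0 + const a3 * const y0 = const x0 ^ 3 + const a2 * const x0 ^ 2 + const a4 * const x0 + const a6"
    by (simp add: const_hom)
  have VV: "V * V' = U * D"
    unfolding V_def V'_def U_def D_def y0'_def const_hom using eq eq0 by Groebner_Basis.algebra
  have in_ring: "U \<in> coord_ring" "V \<in> coord_ring" "V' \<in> coord_ring" "D \<in> coord_ring"
    unfolding U_def V_def V'_def D_def
    by (intro coord_ring_add coord_ring_diff coord_ring_mult coord_ring_power iota_in y_in const_in)+
  have "V * U \<in> rspan ?S" by (rule gprod_mem) auto
  then have mem: "U * U \<in> rspan ?S" "U * V \<in> rspan ?S" "U * V' \<in> rspan ?S" "V * V' \<in> rspan ?S"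
    by (auto intro!: gprod_mem simp only: mult.commute[of V U])
  \<comment> \<open>the value \<open>e\<close> of one partial derivative at the point is nonzero, and \<open>e U\<close> is a combination of the products\<close>
  have "U \<in> rspan ?S"
  proof (cases "2 * y0 + a1 * x0 + a3 = 0")
    case False
    define e where "e = 2 * y0 + a1 * x0 + a3"
    have e: "const e \<noteq> 0" using False by (simp add: e_def)
    have "const (inverse e) * (U * V' - U * V) \<in> rspan ?S"
      by (intro rspan_mult rspan_diff mem) auto
    moreover have "U * V' - U * V = const e * U"
      by (simp add: V_def V'_def e_def y0'_def const_hom algebra_simps)
    moreover have "const (inverse e) * (const e * U) = const (inverse e * e) * U" by (simp add: const_hom)
    ultimately show ?thesis using False by (metis const_hom(6) e_def left_inverse mult_1)
  next
    case True
    define e where "e = 3 * x0 ^ 2 + 2 * a2 * x0 + a4 - a1 * y0"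
    have e: "e \<noteq> 0" using nonsingular[OF assms] True by (simp add: W e_def)
    have "2 * const x0 = const (2 * x0)" by (simp add: const_hom)
    then have "xc + 2 * const x0 + const a2 \<in> coord_ring"
      by (metis coord_ring_add iota_in const_in)
    note t = rspan_mult[OF this mem(1)]
    have "const (inverse e) * (V * V' - (xc + 2 * const x0 + const a2) * (U * U) + const a1 * (U * V)) \<in> rspan ?S"
      by (intro rspan_mult[OF const_in] rspan_diff rspan_add mem t)
    moreover have "V * V' - (xc + 2 * const x0 + const a2) * (U * U) + const a1 * (U * V) = const e * U"
      unfolding VV by (simp add: D_def U_def V_def e_def const_hom algebra_simps power2_eq_square)
    moreover have "const (inverse e) * (const e * U) = const (inverse e * e) * U" by (simp add: const_hom)
    ultimately show ?thesis using e by (metis const_hom(6) left_inverse mult_1)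
  qed
  then have "sim {1} ?S"
  proof (intro simI[OF U0])
    fix g assume "g \<in> ?S"
    then have "g = U * U \<or> g = U * V' \<or> g = U * V \<or> g = U * D"
      unfolding VV[symmetric] by (auto simp: gprod_def)
    then have "g / U \<in> coord_ring" using U0 in_ring by auto
    then show "g / U \<in> rspan {1}" using rspan_mult[OF _ rspan_base[of 1 "{1}"]] by force
  qed auto
  then show ?thesis unfolding gens by (rule sim_sym)
qed

text \<open>
  This ideal identity comes from the line \<open>L\<close> through the two points. With its conjugate \<open>L'\<close> one has
  \<open>L L' = U1 U2 U3\<close>, where \<open>U1\<close>, \<open>U2\<close>, \<open>U3\<close> are the vertical lines, and the ideal of the sum is generated by
  \<open>U3\<close> and \<open>L'\<close>. Multiplying it by \<open>L / U3\<close> therefore gives \<open>L\<close> and \<open>U1 U2\<close>, which generate the product of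
  the ideals of the two points.
\<close>

lemma gens_add_affine:
  assumes c1: "on_curve W x1 y1" and c2: "on_curve W x2 y2"
    and ne: "\<not> (x1 = x2 \<and> y1 + y2 + wa1 W * x2 + wa3 W = 0)"
  shows "sim (gens (point_add W (Affine x1 y1) (Affine x2 y2)))
             (gprod (gens (Affine x1 y1)) (gens (Affine x2 y2)))"
proof -
  obtain a1 a2 a3 a4 a6 where W: "W = Weierstrass a1 a2 a3 a4 a6" by (cases W)
  define l where "l = (if x1 = x2
                 then (3 * x1 ^ 2 + 2 * wa2 W * x1 + wa4 W - wa1 W * y1)
                        / (2 * y1 + wa1 W * x1 + wa3 W)
                 else (y2 - y1) / (x2 - x1))"
  define n where "n = y1 - l * x1"
  define x3 where "x3 = l ^ 2 + wa1 W * l - wa2 W - x1 - x2"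
  define y3 where "y3 = - (l + wa1 W) * x3 - n - wa3 W"
  note ct = chord_tangent_coeffs[OF c1 c2 ne l_def n_def x3_def]
  have sum: "point_add W (Affine x1 y1) (Affine x2 y2) = Affine x3 y3"
    using ne unfolding y3_def x3_def n_def l_def by (auto simp: Let_def)
  define U1 where "U1 = xc - const x1"
  define U2 where "U2 = xc - const x2"
  define U3 where "U3 = xc - const x3"
  define V1 where "V1 = y - const y1"
  define V2 where "V2 = y - const y2"
  define V3 where "V3 = y - const y3"
  define L where "L = y - const l * xc - const n"
  \<comment> \<open>the conjugate of \<open>L\<close>: the line through the negatives of the three points\<close>
  define L' where "L' = y + const l * xc + const n + const a1 * xc + const a3"
  have gens: "gens (Affine x1 y1) = {U1, V1}" "gens (Affine x2 y2) = {U2, V2}"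
    "gens (Affine x3 y3) = {U3, V3}"
    by (simp_all add: U1_def U2_def U3_def V1_def V2_def V3_def)
  let ?S = "gprod {U1, V1} {U2, V2}"
  have in_ring: "U1 \<in> coord_ring" "U2 \<in> coord_ring" "U3 \<in> coord_ring"
     "V1 \<in> coord_ring" "V2 \<in> coord_ring" "V3 \<in> coord_ring" "L \<in> coord_ring" "L' \<in> coord_ring"
    unfolding U1_def U2_def U3_def V1_def V2_def V3_def L_def L'_def
    by (intro coord_ring_add coord_ring_diff coord_ring_mult coord_ring_power iota_in y_in const_in)+
  have V1: "V1 = L + const l * U1" unfolding V1_def L_def U1_def ct(3) by (simp add: const_hom algebra_simps)
  have V2: "V2 = L + const l * U2" unfolding V2_def L_def U2_def by (subst ct(4)) (simp add: const_hom algebra_simps)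
  have V3: "V3 = L' - (const l + const a1) * U3"
    unfolding V3_def L'_def U3_def y3_def by (simp add: W const_hom algebra_simps)
  have eq: "y ^ 2 = xc ^ 3 + const a2 * xc ^ 2 + const a4 * xc + const a6 - const a1 * xc * y - const a3 * y"
    using weierstrass_eq unfolding iota_s iota_w by (simp add: W algebra_simps)
  have "const (x1 * x2 + x1 * x3 + x2 * x3) = const (a4 - 2 * l * n - a1 * n - a3 * l)"
    "const (x1 * x2 * x3) = const (n ^ 2 + a3 * n - a6)" "const (x1 + x2 + x3) = const (l ^ 2 + a1 * l - a2)"
    using ct(1,2) by (simp_all add: W x3_def del: const_hom) (simp add: algebra_simps)
  note coeffs = this[unfolded const_hom]
  have LL: "L * L' = U1 * U2 * U3"
    unfolding L_def L'_def U1_def U2_def U3_def using eq coeffs by Groebner_Basis.algebra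
  have mem0: "U1 * U2 \<in> rspan ?S" "U1 * V2 \<in> rspan ?S" "V1 * U2 \<in> rspan ?S" "V1 * V2 \<in> rspan ?S"
    by (auto intro!: gprod_mem)
  have mem1: "U1 * L \<in> rspan ?S" "U2 * L \<in> rspan ?S"
  proof -
    have "U1 * V2 - const l * (U1 * U2) \<in> rspan ?S" "V1 * U2 - const l * (U1 * U2) \<in> rspan ?S"
      by (intro rspan_diff rspan_mult mem0 const_in)+
    then show "U1 * L \<in> rspan ?S" "U2 * L \<in> rspan ?S" by (simp_all add: V1 V2 algebra_simps)
  qed
  have mem2: "L * L \<in> rspan ?S"
  proof -
    have "V1 * V2 - const l * (U1 * L) - const l * (U2 * L) - (const l * const l) * (U1 * U2) \<in> rspan ?S"
      by (intro rspan_diff rspan_mult mem0 mem1 const_in coord_ring_mult)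
    then show "L * L \<in> rspan ?S" by (simp add: V1 V2 algebra_simps)
  qed
  \<comment> \<open>some combination of \<open>U1\<close>, \<open>U2\<close>, \<open>L\<close> and \<open>L'\<close> is a nonzero constant: \<open>U1 - U2\<close> for a chord,
    \<open>L' - L - (2 l + a1) U1\<close> for a tangent\<close>
  have L_mem: "L \<in> rspan ?S"
  proof (cases "x1 = x2")
    case False
    have "const (inverse (x2 - x1)) * (U1 * L - U2 * L) \<in> rspan ?S"
      by (intro rspan_diff rspan_mult mem1 const_in)
    moreover have "U1 * L - U2 * L = const (x2 - x1) * L"
      by (simp add: U1_def U2_def const_hom algebra_simps)
    moreover have "const (inverse (x2 - x1)) * (const (x2 - x1) * L) = const (inverse (x2 - x1) * (x2 - x1)) * L"
      by (simp only: const_hom mult.assoc)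
    ultimately show ?thesis using False by (simp add: const_hom(6))
  next
    case True
    define e where "e = 2 * y1 + a1 * x1 + a3"
    have e: "e \<noteq> 0" using conjunct2[OF ct(5)[OF True]] by (simp add: W e_def)
    have "const (2 * l + a1) = 2 * const l + const a1" by (simp add: const_hom)
    then have "const (inverse e) * (U3 * (U1 * U2) - L * L - const (2 * l + a1) * (U1 * L)) \<in> rspan ?S"
      by (intro rspan_diff rspan_mult mem0 mem1 mem2 in_ring const_in)
    moreover have "U3 * (U1 * U2) = L * L'" by (simp add: LL)
    moreover have "L * L' - L * L - const (2 * l + a1) * (U1 * L) = const e * L"
      unfolding e_def L'_def L_def U1_def n_def by (simp add: const_hom algebra_simps)
    moreover have "const (inverse e) * (const e * L) = const (inverse e * e) * L" by (simp add: const_hom)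
    ultimately show ?thesis using e by (metis const_hom(6) left_inverse mult_1)
  qed
  have U3: "U3 \<noteq> 0" and U1: "U1 \<noteq> 0" and U2: "U2 \<noteq> 0"
    unfolding U1_def U2_def U3_def by (rule xc_minus_const_neq_0)+
  then have L0: "L \<noteq> 0" using LL by auto
  define c where "c = L / U3"
  have c0: "c \<noteq> 0" and cU3: "c * U3 = L" using L0 U3 by (simp_all add: c_def)
  have cL': "c * L' = U1 * U2" using U3 LL by (simp add: c_def)
  have mem3: "U3 \<in> rspan {U3, V3}" "L' \<in> rspan {U3, V3}"
  proof -
    have "V3 + (const l + const a1) * U3 \<in> rspan {U3, V3}"
      by (intro rspan_add rspan_mult rspan_base coord_ring_add const_in) auto
    then show "L' \<in> rspan {U3, V3}" by (simp add: V3)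
  qed (auto intro: rspan_base)
  have "sim {U3, V3} ?S"
  proof (rule simI[OF c0])
    fix f assume "f \<in> {U3, V3}"
    moreover have "c * V3 = U1 * U2 - (const l + const a1) * L"
      unfolding V3 by (simp add: right_diff_distrib cL' flip: cU3)
    moreover have "U1 * U2 - (const l + const a1) * L \<in> rspan ?S"
      by (intro rspan_diff rspan_mult mem0 L_mem coord_ring_add const_in)
    ultimately show "c * f \<in> rspan ?S" using cU3 L_mem by auto
  next
    fix g assume "g \<in> ?S"
    then have "g = U1 * U2 \<or> g = U1 * V2 \<or> g = V1 * U2 \<or> g = V1 * V2"
      by (auto simp: gprod_def)
    moreover have "U1 * U2 = c * L'" by (simp add: cL')
    moreover have "U1 * V2 = c * (U1 * U3 + const l * L')"
    proof -
      have "U1 * V2 = U1 * L + const l * (U1 * U2)" by (simp add: V2 algebra_simps)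
      also have "\<dots> = U1 * (c * U3) + const l * (c * L')" by (simp only: cU3 cL')
      finally show ?thesis by (simp add: algebra_simps)
    qed
    moreover have "V1 * U2 = c * (U2 * U3 + const l * L')"
    proof -
      have "V1 * U2 = U2 * L + const l * (U1 * U2)" by (simp add: V1 algebra_simps)
      also have "\<dots> = U2 * (c * U3) + const l * (c * L')" by (simp only: cU3 cL')
      finally show ?thesis by (simp add: algebra_simps)
    qed
    moreover have "V1 * V2 = c * (L * U3 + (const l * (U1 + U2)) * U3 + (const l * const l) * L')"
    proof -
      have "V1 * V2 = (L + const l * (U1 + U2)) * L + (const l * const l) * (U1 * U2)"
        by (simp add: V1 V2 algebra_simps)
      also have "\<dots> = (L + const l * (U1 + U2)) * (c * U3) + (const l * const l) * (c * L')"
        by (simp only: cU3 cL')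
      finally show ?thesis by (simp add: algebra_simps)
    qed
    ultimately have "g = c * L' \<or> g = c * (U1 * U3 + const l * L') \<or> g = c * (U2 * U3 + const l * L')
       \<or> g = c * (L * U3 + (const l * (U1 + U2)) * U3 + (const l * const l) * L')"
      by metis
    moreover have "L' \<in> rspan {U3, V3}" "U1 * U3 + const l * L' \<in> rspan {U3, V3}"
      "U2 * U3 + const l * L' \<in> rspan {U3, V3}"
      "L * U3 + (const l * (U1 + U2)) * U3 + (const l * const l) * L' \<in> rspan {U3, V3}"
      by (intro rspan_add rspan_mult mem3 in_ring const_in coord_ring_mult coord_ring_add)+
    ultimately show "g / c \<in> rspan {U3, V3}" using c0 by auto
  qed
  then show ?thesis unfolding sum gens .
qed

lemma rspan_zero:
  assumes "on_curve W x0 y0" "\<And>g. g \<in> S \<Longrightarrow> g \<in> coord_ring \<and> ev x0 y0 g = 0" "f \<in> rspan S"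
  shows "f \<in> coord_ring \<and> ev x0 y0 f = 0"
  using assms(3)
proof (induction f rule: rspan.induct)
  case (rspan_step f r g)
  then show ?case using assms(1,2) by (auto simp: ev_add ev_mult coord_ring_mult coord_ring_add)
qed auto

lemma degree_norm_poly_neq_1: "Polynomial.degree (norm_poly p q) \<noteq> 1"
proof (cases "q = 0")
  case True
  then have "norm_poly p q = p * p" by (simp add: norm_poly_def power2_eq_square)
  then have "Polynomial.degree (norm_poly p q) = 2 * Polynomial.degree p"
    by (cases "p = 0") (simp_all add: Polynomial.degree_mult_eq)
  then show ?thesis by presburger
next
  case False
  then show ?thesis by (simp add: degree_norm_poly)
qed

text \<open>
  A generator \<open>d\<close> divides \<open>x - x0\<close>, whose norm has degree 2. Norms never have degree 1, so \<open>d\<close> or its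
  cofactor has constant norm and is a unit. In the first case the ideal contains 1, which does not
  vanish at the point; in the second case \<open>x - x0\<close> divides \<open>y - y0\<close>.
\<close>

lemma point_ideal_not_principal:
  assumes c: "on_curve W x0 y0"
  shows "\<not> sim (gens (Affine x0 y0)) {1}"
proof
  let ?l = "[:- x0, 1:]"
  assume "sim (gens (Affine x0 y0)) {1}"
  then obtain c where c0: "c \<noteq> 0" and c1: "\<And>f. f \<in> rspan (gens (Affine x0 y0)) \<Longrightarrow> c * f \<in> rspan {1}"
    and c2: "\<And>g. g \<in> rspan {1} \<Longrightarrow> g / c \<in> rspan (gens (Affine x0 y0))"
    unfolding sim_def by blast
  have R: "f \<in> coord_ring" if "f \<in> rspan {1}" for f
    using that by (induction f rule: rspan.induct) auto
  \<comment> \<open>the generator of the ideal\<close>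
  define d where "d = 1 / c"
  have d_mem: "d \<in> rspan (gens (Affine x0 y0))"
    unfolding d_def by (rule c2) (auto intro: rspan_base)
  have "g \<in> coord_ring \<and> ev x0 y0 g = 0" if "g \<in> gens (Affine x0 y0)" for g
    using that by (auto simp: ev_diff ev_y ev_iota const_def)
  from rspan_zero[OF c this d_mem] have d: "d \<in> coord_ring" "ev x0 y0 d = 0" by auto
  have quot: "\<exists>h\<in>coord_ring. f = d * h" if "f \<in> gens (Affine x0 y0)" for f
    using R[OF c1[OF rspan_base[OF that]]] c0 by (intro bexI[of _ "c * f"]) (simp_all add: d_def)
  obtain hU hV where hU: "hU \<in> coord_ring" "xc - const x0 = d * hU"
    and hV: "hV \<in> coord_ring" "y - const y0 = d * hV"
    using quot[of "xc - const x0"] quot[of "y - const y0"] by auto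
  obtain p q p' q' where dpq: "d = elem p q" and hpq: "hU = elem p' q'"
    using d(1) hU(1) by (meson coord_ringE)
  have U: "xc - const x0 = elem ?l 0" by (simp add: elem_def iota_lin)
  have "elem ?l 0 = elem (p * p' + q * q' * w) (p * q' + q * p' - q * q' * s)"
    using hU(2) unfolding U dpq hpq elem_mult .
  then have "norm_poly ?l 0 = norm_poly p q * norm_poly p' q'"
    by (metis elem_eq_iff norm_poly_mult)
  then have N: "norm_poly p q * norm_poly p' q' = ?l * ?l"
    by (simp add: norm_poly_def power2_eq_square)
  have nz: "norm_poly p q \<noteq> 0" "norm_poly p' q' \<noteq> 0" using N by auto
  have "Polynomial.degree (norm_poly p q) + Polynomial.degree (norm_poly p' q') = Polynomial.degree (?l * ?l)"
    using Polynomial.degree_mult_eq[OF nz] unfolding N by simp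
  also have "\<dots> = 2" by (subst Polynomial.degree_mult_eq) auto
  finally have "Polynomial.degree (norm_poly p q) = 0 \<or> Polynomial.degree (norm_poly p' q') = 0"
    using degree_norm_poly_neq_1[of p q] by linarith
  then show False
  proof
    assume "Polynomial.degree (norm_poly p q) = 0"
    then obtain k where k: "norm_poly p q = [:k:]" by (meson degree_eq_zeroE)
    have "ev x0 y0 (d * elem (p - q * s) (- q)) = k"
      unfolding dpq elem_conj k by (simp add: ev_iota)
    then show False using d c nz k by (simp add: ev_mult)
  next
    assume "Polynomial.degree (norm_poly p' q') = 0"
    then obtain k where k: "norm_poly p' q' = [:k:]" by (meson degree_eq_zeroE)
    obtain a b where ab: "elem (p' - q' * s) (- q') * hV = elem a b"
      using hV(1) by (meson coord_ringE coord_ring_mult elem_in)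
    have "hU * elem (p' - q' * s) (- q') = \<iota> [:k:]"
      unfolding hpq elem_conj k ..
    then have "(y - const y0) * \<iota> [:k:] = (xc - const x0) * elem a b"
      unfolding hV(2) hU(2) ab[symmetric] by (simp add: ac_simps)
    moreover have "(y - const y0) * \<iota> [:k:] = elem ([:- y0:] * [:k:]) [:k:]"
      unfolding elem_def const_def iota_mult by (simp add: algebra_simps iota_minus[of "[:y0:]", simplified])
    moreover have "(xc - const x0) * elem a b = elem (?l * a) (?l * b)"
      unfolding U elem_def iota_mult by (simp add: algebra_simps)
    ultimately have "[:k:] = ?l * b" by (simp only: elem_eq_iff)
    then have "poly [:k:] x0 = poly (?l * b) x0" by simp
    then show False using nz k by simp
  qed
qed
end

section \<open>The group law\<close>

lemma point_add_closed:
  fixes W :: "'a::field weierstrass"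
  assumes "P \<in> points W" "Q \<in> points W"
  shows "point_add W P Q \<in> points W"
proof (cases "P = Infinity \<or> Q = Infinity")
  case True
  then show ?thesis using assms by (cases P) auto
next
  case False
  then obtain x1 y1 x2 y2 where PQ: "P = Affine x1 y1" "Q = Affine x2 y2"
    by (meson point.exhaust)
  then have c: "on_curve W x1 y1" "on_curve W x2 y2" using assms by (auto simp: points_def)
  show ?thesis
  proof (cases "x1 = x2 \<and> y1 + y2 + wa1 W * x2 + wa3 W = 0")
    case True
    then show ?thesis by (simp add: PQ points_def)
  next
    case ne: False
    define l where "l = (if x1 = x2
                   then (3 * x1 ^ 2 + 2 * wa2 W * x1 + wa4 W - wa1 W * y1)
                          / (2 * y1 + wa1 W * x1 + wa3 W)
                   else (y2 - y1) / (x2 - x1))"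
    define n where "n = y1 - l * x1"
    define x3 where "x3 = l ^ 2 + wa1 W * l - wa2 W - x1 - x2"
    define y3 where "y3 = - (l + wa1 W) * x3 - n - wa3 W"
    note ct = chord_tangent_coeffs[OF c ne l_def n_def x3_def]
    have sum: "point_add W P Q = Affine x3 y3"
      using ne unfolding PQ y3_def x3_def n_def l_def by (auto simp: Let_def)
    have "x1 + x2 + x3 = l ^ 2 + wa1 W * l - wa2 W" by (simp add: x3_def)
    then have "on_curve W x3 y3"
      using ct(1,2) unfolding on_curve_def y3_def by Groebner_Basis.algebra
    then show ?thesis by (simp add: sum points_def)
  qed
qed

lemma point_add_commute:
  fixes W :: "'a::field weierstrass"
  assumes "P \<in> points W" "Q \<in> points W"
  shows "point_add W P Q = point_add W Q P"
proof (cases "P = Infinity \<or> Q = Infinity")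
  case True
  then show ?thesis using assms by (cases P; cases Q) auto
next
  case False
  then obtain x1 y1 x2 y2 where PQ: "P = Affine x1 y1" "Q = Affine x2 y2"
    by (meson point.exhaust)
  then have c: "on_curve W x1 y1" "on_curve W x2 y2" using assms by (auto simp: points_def)
  show ?thesis
  proof (cases "x1 = x2")
    case True
    have "y1 = y2" if "y1 + y2 + wa1 W * x2 + wa3 W \<noteq> 0"
      using chord_tangent_coeffs(5)[OF c _ refl refl refl] that True by auto
    moreover have "point_add W P Q = point_add W Q P" if "y1 + y2 + wa1 W * x2 + wa3 W = 0"
      using that True by (simp add: PQ add.commute[of y2 y1])
    ultimately show ?thesis using True PQ by blast
  next
    case ne: False
    define l where "l = (y2 - y1) / (x2 - x1)"
    have l': "(y1 - y2) / (x1 - x2) = l" unfolding l_def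
      using ne by (simp add: frac_eq_eq algebra_simps)
    have "l * (x2 - x1) = y2 - y1" using ne by (simp add: l_def)
    then have "y1 - l * x1 = y2 - l * x2" by (simp add: algebra_simps)
    moreover have "l ^ 2 + wa1 W * l - wa2 W - x1 - x2 = l ^ 2 + wa1 W * l - wa2 W - x2 - x1" by simp
    ultimately show ?thesis
      unfolding PQ point_add.simps if_not_P[OF ne] if_not_P[OF ne[symmetric]] l' l_def[symmetric]
      using ne by (simp add: Let_def)
  qed
qed

lemma point_neg_closed:
  fixes W :: "'a::field weierstrass"
  assumes "P \<in> points W"
  shows "point_neg W P \<in> points W"
proof (cases P)
  case (Affine x y)
  then have "on_curve W x y" using assms by (auto simp: points_def)
  then have "on_curve W x (- y - wa1 W * x - wa3 W)"
    unfolding on_curve_def by (simp add: algebra_simps power2_eq_square)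
  then show ?thesis by (simp add: Affine points_def)
qed (simp add: points_def)

lemma point_add_neg:
  fixes W :: "'a::field weierstrass"
  shows "point_add W (point_neg W P) P = Infinity"
  by (cases P) auto

lemma point_add_eq_Infinity:
  fixes W :: "'a::field weierstrass"
  assumes "point_add W P (point_neg W Q) = Infinity"
  shows "P = Q"
  using assms by (cases P; cases Q) (auto simp: Let_def split: if_splits)

lemma points_cases:
  assumes "P \<in> points W" obtains "P = Infinity" | x y where "P = Affine x y" "on_curve W x y"
  using assms unfolding points_def by auto

context weierstrass_ring begin

lemma gens_add:
  assumes ell: "elliptic_curve W" and PQ: "P \<in> points W" "Q \<in> points W"
  shows "sim (gens (point_add W P Q)) (gprod (gens P) (gens Q))"
  using PQ(1)
proof (cases rule: points_cases)
  case 1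
  then show ?thesis by (simp add: gprod_1 sim_refl)
next
  case P: (2 x1 y1)
  show ?thesis using PQ(2)
  proof (cases rule: points_cases)
    case 1
    then show ?thesis using P by (simp add: gprod_1 sim_refl gprod_commute[of _ "{1}"])
  next
    case Q: (2 x2 y2)
    show ?thesis
    proof (cases "x1 = x2 \<and> y1 + y2 + wa1 W * x2 + wa3 W = 0")
      case False
      then show ?thesis using gens_add_affine[OF P(2) Q(2)] P(1) Q(1) by simp
    next
      case True
      have "y2 = (y1 + y2 + wa1 W * x2 + wa3 W) - y1 - wa1 W * x2 - wa3 W" by simp
      then have "Q = point_neg W P" using True by (simp add: P(1) Q(1))
      then show ?thesis
        using sim_sym[OF gens_neg[OF ell P(2)]] P(1) Q(1) True by simp
    qed
  qed
qed

text \<open>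
  The difference of the two points has the trivial class, so it is the point at infinity.
\<close>

lemma gens_inj:
  assumes ell: "elliptic_curve W" and PQ: "P \<in> points W" "Q \<in> points W"
    and "sim (gens P) (gens Q)"
  shows "P = Q"
proof -
  let ?R = "point_add W P (point_neg W Q)"
  have Q': "point_neg W Q \<in> points W" using PQ(2) by (rule point_neg_closed)
  have "sim (gens ?R) (gprod (gens P) (gens (point_neg W Q)))"
    by (rule gens_add[OF ell PQ(1) Q'])
  moreover have "sim (gprod (gens P) (gens (point_neg W Q))) (gprod (gens Q) (gens (point_neg W Q)))"
    by (rule sim_gprod) fact
  moreover have "sim (gprod (gens Q) (gens (point_neg W Q))) {1}"
    using PQ(2)
  proof (cases rule: points_cases)
    case 1
    then show ?thesis by (simp add: gprod_1 sim_refl)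
  next
    case (2 x y)
    show ?thesis unfolding 2(1) by (rule gens_neg[OF ell 2(2)])
  qed
  ultimately have R: "sim (gens ?R) {1}" by (metis sim_trans)
  have "?R \<in> points W" by (rule point_add_closed[OF PQ(1) Q'])
  then have "?R = Infinity" using R point_ideal_not_principal by (cases rule: points_cases) auto
  then show ?thesis by (rule point_add_eq_Infinity)
qed

text \<open>
  Both sides have the class of the product of the three ideals.
\<close>

lemma point_add_assoc:
  assumes ell: "elliptic_curve W" and P: "P \<in> points W" and Q: "Q \<in> points W" and R: "R \<in> points W"
  shows "point_add W (point_add W P Q) R = point_add W P (point_add W Q R)"
proof (rule gens_inj[OF ell])
  have PQ: "point_add W P Q \<in> points W" and QR: "point_add W Q R \<in> points W"
    using P Q R by (auto intro: point_add_closed)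
  show "point_add W (point_add W P Q) R \<in> points W" "point_add W P (point_add W Q R) \<in> points W"
    using P R PQ QR by (auto intro: point_add_closed)
  have "sim (gens (point_add W (point_add W P Q) R)) (gprod (gprod (gens P) (gens Q)) (gens R))"
    using gens_add[OF ell PQ R] sim_gprod[OF gens_add[OF ell P Q]] by (rule sim_trans)
  moreover have "sim (gens (point_add W P (point_add W Q R))) (gprod (gens P) (gprod (gens Q) (gens R)))"
    using gens_add[OF ell P QR] sim_gprod2[OF sim_refl gens_add[OF ell Q R]] by (rule sim_trans)
  ultimately show "sim (gens (point_add W (point_add W P Q) R)) (gens (point_add W P (point_add W Q R)))"
    by (metis gprod_assoc sim_sym sim_trans)
qed

end

section \<open>Localisation at the kernel of a homomorphism to a field\<close>

definition localise :: "'b::field set \<Rightarrow> ('b \<Rightarrow> 'a::field) \<Rightarrow> 'b set" where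
  "localise A \<chi> = {a / b | a b. a \<in> A \<and> b \<in> A \<and> \<chi> b \<noteq> 0}"

definition localise_hom :: "'b::field set \<Rightarrow> ('b \<Rightarrow> 'a::field) \<Rightarrow> 'b \<Rightarrow> 'a" where
  "localise_hom A \<chi> c = (THE z. \<exists>a b. a \<in> A \<and> b \<in> A \<and> \<chi> b \<noteq> 0 \<and> c = a / b \<and> z = \<chi> a / \<chi> b)"

lemma localise_hom_frac:
  assumes h: "hom_on A \<chi>" and ab: "a \<in> A" "b \<in> A" "\<chi> b \<noteq> 0"
  shows "localise_hom A \<chi> (a / b) = \<chi> a / \<chi> b"
  unfolding localise_hom_def
proof (rule the_equality)
  show "\<exists>a' b'. a' \<in> A \<and> b' \<in> A \<and> \<chi> b' \<noteq> 0 \<and> a / b = a' / b' \<and> \<chi> a / \<chi> b = \<chi> a' / \<chi> b'"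
    using ab by blast
  fix z assume "\<exists>a' b'. a' \<in> A \<and> b' \<in> A \<and> \<chi> b' \<noteq> 0 \<and> a / b = a' / b' \<and> z = \<chi> a' / \<chi> b'"
  then obtain a' b' where *: "a' \<in> A" "b' \<in> A" "\<chi> b' \<noteq> 0" "a / b = a' / b'" "z = \<chi> a' / \<chi> b'" by blast
  have "b \<noteq> 0" "b' \<noteq> 0" using ab(3) *(3) hom_onD(5)[OF h] by auto
  then have "a * b' = a' * b" using *(4) by (simp add: frac_eq_eq)
  then have "\<chi> a * \<chi> b' = \<chi> a' * \<chi> b" using hom_onD(4)[OF h] ab * by metis
  then show "z = \<chi> a / \<chi> b" using ab(3) * by (simp add: frac_eq_eq)
qed

lemma localiseI: "a \<in> A \<Longrightarrow> b \<in> A \<Longrightarrow> \<chi> b \<noteq> 0 \<Longrightarrow> a / b \<in> localise A \<chi>"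
  unfolding localise_def by blast

lemma hom_on_localise:
  assumes h: "hom_on A \<chi>"
  shows "hom_on (localise A \<chi>) (localise_hom A \<chi>)"
    and "a \<in> A \<Longrightarrow> a \<in> localise A \<chi>" and "a \<in> A \<Longrightarrow> localise_hom A \<chi> a = \<chi> a"
proof -
  note h' = hom_onD[OF h] and A = is_subringD[OF hom_onD(1)[OF h]]
  note frac = localise_hom_frac[OF h]
  show base: "a \<in> A \<Longrightarrow> a \<in> localise A \<chi>" for a
    using localiseI[of a A 1 \<chi>] A(1) h'(2) by simp
  show val: "a \<in> A \<Longrightarrow> localise_hom A \<chi> a = \<chi> a" for a
    using frac[of a 1] A(1) h'(2) by simp
  have ne: "b \<noteq> 0" if "\<chi> b \<noteq> 0" for b using that h'(5) by auto
  show "hom_on (localise A \<chi>) (localise_hom A \<chi>)"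
    unfolding hom_on_def is_subring_def
  proof (intro conjI ballI)
    show "1 \<in> localise A \<chi>" using base A(1) by blast
    show "localise_hom A \<chi> 1 = 1" using val A(1) h'(2) by simp
    fix x assume "x \<in> localise A \<chi>"
    then obtain a b where ab: "a \<in> A" "b \<in> A" "\<chi> b \<noteq> 0" "x = a / b" unfolding localise_def by blast
    show "- x \<in> localise A \<chi>"
      using localiseI[of "- a" A b \<chi>] ab A(4) by simp
    fix y assume "y \<in> localise A \<chi>"
    then obtain c d where cd: "c \<in> A" "d \<in> A" "\<chi> d \<noteq> 0" "y = c / d" unfolding localise_def by blast
    have sum: "x + y = (a * d + c * b) / (b * d)"
      using ab(3,4) cd(3,4) ne by (simp add: add_frac_eq)
    have prod: "x * y = (a * c) / (b * d)" using ab cd by simp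
    have mem: "a * d + c * b \<in> A" "b * d \<in> A" "a * c \<in> A" "a * d \<in> A" "c * b \<in> A"
      using ab cd A(2,3) by auto
    have nz: "\<chi> (b * d) \<noteq> 0" using ab cd h'(4) by simp
    show "x + y \<in> localise A \<chi>" "x * y \<in> localise A \<chi>"
      unfolding sum prod using localiseI[of _ A "b * d" \<chi>] mem nz by auto
    have x: "localise_hom A \<chi> x = \<chi> a / \<chi> b" unfolding ab(4) by (rule frac[OF ab(1-3)])
    have y: "localise_hom A \<chi> y = \<chi> c / \<chi> d" unfolding cd(4) by (rule frac[OF cd(1-3)])
    have "localise_hom A \<chi> (x + y) = \<chi> (a * d + c * b) / \<chi> (b * d)"
      unfolding sum by (rule frac[OF mem(1,2) nz])
    then show "localise_hom A \<chi> (x + y) = localise_hom A \<chi> x + localise_hom A \<chi> y"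
      unfolding x y using ab(1-3) cd(1-3) mem by (simp add: h'(3,4) add_frac_eq)
    have "localise_hom A \<chi> (x * y) = \<chi> (a * c) / \<chi> (b * d)"
      unfolding prod by (rule frac[OF mem(3,2) nz])
    then show "localise_hom A \<chi> (x * y) = localise_hom A \<chi> x * localise_hom A \<chi> y"
      unfolding x y using ab(1-3) cd(1-3) mem by (simp add: h'(3,4))
  qed
qed

lemma localise_frac_mem:
  assumes h: "hom_on A \<chi>" and xy: "x \<in> localise A \<chi>" "y \<in> localise A \<chi>" "localise_hom A \<chi> y \<noteq> 0"
  shows "x / y \<in> localise A \<chi>"
    "localise_hom A \<chi> (x / y) = localise_hom A \<chi> x / localise_hom A \<chi> y"
proof -
  note h' = hom_onD[OF h] and A = is_subringD[OF hom_onD(1)[OF h]]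
  note L = hom_onD[OF hom_on_localise(1)[OF h]]
  obtain c d where cd: "c \<in> A" "d \<in> A" "\<chi> d \<noteq> 0" "y = c / d" using xy(2) unfolding localise_def by blast
  have "\<chi> c / \<chi> d \<noteq> 0" using xy(3) localise_hom_frac[OF h cd(1-3)] cd(4) by simp
  then have "\<chi> c \<noteq> 0" by auto
  then have i: "inverse y \<in> localise A \<chi>" using localiseI[of d A c \<chi>] cd by simp
  show m: "x / y \<in> localise A \<chi>"
    unfolding divide_inverse using xy(1) i is_subringD(3)[OF L(1)] by blast
  have "y \<noteq> 0" using xy(3) L(5) by auto
  then have "localise_hom A \<chi> x = localise_hom A \<chi> (x / y) * localise_hom A \<chi> y"
    using L(4)[OF m xy(2)] by simp
  then show "localise_hom A \<chi> (x / y) = localise_hom A \<chi> x / localise_hom A \<chi> y"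
    using xy(3) by simp
qed

lemma hom_on_subset: "hom_on A \<chi> \<Longrightarrow> is_subring B \<Longrightarrow> B \<subseteq> A \<Longrightarrow> hom_on B \<chi>"
  unfolding hom_on_def by blast

text \<open>
  The elements on which the two homomorphisms agree form a subring.
\<close>

lemma hom_on_agree:
  assumes "hom_on (gen_subring S) \<chi>" "hom_on (gen_subring S) \<chi>'" "\<And>s. s \<in> S \<Longrightarrow> \<chi> s = \<chi>' s"
    "a \<in> gen_subring S"
  shows "\<chi> a = \<chi>' a"
proof -
  note h = hom_onD[OF assms(1)] and h' = hom_onD[OF assms(2)] and A = is_subringD[OF hom_onD(1)[OF assms(1)]]
  have "is_subring {a \<in> gen_subring S. \<chi> a = \<chi>' a}"
    unfolding is_subring_def using h(2,3,4,6) h'(2,3,4,6) A(1-4) by simp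
  moreover have "S \<subseteq> {a \<in> gen_subring S. \<chi> a = \<chi>' a}" using gen_subring(2)[of S] assms(3) by auto
  ultimately show ?thesis using gen_subring_minimal assms(4) by blast
qed

section \<open>Spreading out from finitely many elements\<close>

text \<open>
  Here \<open>Z A\<close> is a ring built from \<open>A\<close>, such as \<open>A\<close> itself or \<open>A[\<alpha>]\<close>: for \<open>c\<close> to lie in it, \<open>A\<close> only has
  to contain finitely many elements of \<open>M\<close>. Finitely many elements are regular at almost every point.
\<close>

definition spreads :: "'b::field set \<Rightarrow> 'b \<Rightarrow> ('b set \<Rightarrow> 'b set) \<Rightarrow> bool" where
  "spreads M c Z \<longleftrightarrow> (\<exists>D. finite D \<and> D \<subseteq> M \<and> (\<forall>A. is_subring A \<longrightarrow> D \<subseteq> A \<longrightarrow> c \<in> Z A))"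

lemma spreads_poly:
  assumes "\<And>c. c \<in> F \<Longrightarrow> spreads M c Z" "poly_over F p"
  shows "\<exists>D. finite D \<and> D \<subseteq> M \<and> (\<forall>A. is_subring A \<longrightarrow> D \<subseteq> A \<longrightarrow> poly_over (Z A) p)"
proof -
  have "\<forall>i. \<exists>D. finite D \<and> D \<subseteq> M \<and> (\<forall>A. is_subring A \<longrightarrow> D \<subseteq> A \<longrightarrow> poly.coeff p i \<in> Z A)"
    using assms unfolding spreads_def poly_over_def by blast
  then obtain D where D: "\<And>i. finite (D i)" "\<And>i. D i \<subseteq> M"
    "\<And>i A. is_subring A \<Longrightarrow> D i \<subseteq> A \<Longrightarrow> poly.coeff p i \<in> Z A" by metis
  \<comment> \<open>one index beyond the degree, for the coefficients that are zero\<close>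
  let ?D = "\<Union>i\<in>{..Suc (Polynomial.degree p)}. D i"
  have "poly.coeff p i \<in> Z A" if A: "is_subring A" "?D \<subseteq> A" for A i
  proof (cases "i \<le> Polynomial.degree p")
    case True
    then have "i \<in> {..Suc (Polynomial.degree p)}" by simp
    then show ?thesis using A by (intro D(3)) blast+
  next
    case False
    have "poly.coeff p (Suc (Polynomial.degree p)) \<in> Z A" using A by (intro D(3)) blast+
    then show ?thesis using False by (simp add: Polynomial.coeff_eq_0)
  qed
  moreover have "finite ?D" using D(1) by blast
  moreover have "?D \<subseteq> M" using D(2) by blast
  ultimately show ?thesis unfolding poly_over_def by (intro exI[of _ ?D]) blast
qed

lemma spreads_base: "c \<in> M \<Longrightarrow> spreads M c (\<lambda>A. A)"
  unfolding spreads_def by (intro exI[of _ "{c}"]) auto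

lemma spreads_adjoin:
  assumes "\<And>c. c \<in> F \<Longrightarrow> spreads M c Z" "c \<in> adjoin F \<alpha>"
  shows "spreads M c (\<lambda>A. adjoin (Z A) \<alpha>)"
proof -
  obtain q where q: "poly_over F q" "c = poly q \<alpha>" using assms(2) by (auto simp: adjoin_def)
  obtain D where "finite D" "D \<subseteq> M" "\<And>A. is_subring A \<Longrightarrow> D \<subseteq> A \<Longrightarrow> poly_over (Z A) q"
    using spreads_poly[OF assms(1) q(1)] by blast
  then show ?thesis unfolding spreads_def adjoin_def q(2) by (intro exI[of _ D]) blast
qed

section \<open>Generic fibres\<close>

text \<open>
  The rational map \<open>(u, v) = (f / h, g / h)\<close> to the plane. In the application it is an isogeny, \<open>M\<close> is the
  pulled back function field, and \<open>base_ring\<close> is the local ring of the target at the image of a point.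
\<close>

locale weierstrass_map = weierstrass_ring W \<iota> y
  for W :: "'a::alg_closed_field weierstrass" and \<iota> :: "'a poly \<Rightarrow> 'b::field" and y :: 'b +
  fixes f g h :: 'b
  assumes fgh: "f \<in> coord_ring" "g \<in> coord_ring" "h \<in> coord_ring" "h \<noteq> 0"
begin

definition u where "u = f / h"
definition v where "v = g / h"
definition M where "M = gen_subfield (range const \<union> {u, v})"
definition Kuv where "Kuv = gen_subring (range const \<union> {u, v})"

definition local_ring where "local_ring x0 y0 = localise coord_ring (ev x0 y0)"
definition lev where "lev x0 y0 = localise_hom coord_ring (ev x0 y0)"

lemma is_subring_coord_ring: "is_subring coord_ring"
  unfolding is_subring_def by auto

lemma hom_on_ev: "on_curve W x0 y0 \<Longrightarrow> hom_on coord_ring (ev x0 y0)"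
  unfolding hom_on_def using is_subring_coord_ring by (auto simp: ev_add ev_mult)

lemma hom_on_lev: "on_curve W x0 y0 \<Longrightarrow> hom_on (local_ring x0 y0) (lev x0 y0)"
  unfolding local_ring_def lev_def by (rule hom_on_localise[OF hom_on_ev])

lemma lev_coord_ring:
  assumes "on_curve W x0 y0" "a \<in> coord_ring"
  shows "a \<in> local_ring x0 y0" "lev x0 y0 a = ev x0 y0 a"
  unfolding local_ring_def lev_def
  by (rule hom_on_localise(2,3)[OF hom_on_ev[OF assms(1)] assms(2)])+

lemma ev_const [simp]: "ev x0 y0 (const a) = a"
  by (simp add: const_def ev_iota)

lemma ev_xc [simp]: "ev x0 y0 xc = x0"
  by (simp add: ev_iota)

lemma generated_by_xy: "gen_subfield (range const \<union> {u, v}) \<subseteq> gen_subfield (range const \<union> {xc, y})"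
  "coord_ring \<subseteq> gen_subring (range const \<union> {xc, y})"
proof -
  let ?R = "gen_subring (range const \<union> {xc, y})"
  note R = is_subringD[OF gen_subring(1)[of "range const \<union> {xc, y}"]]
  have base: "const a \<in> ?R" "xc \<in> ?R" "y \<in> ?R" for a
    using gen_subring(2)[of "range const \<union> {xc, y}"] by auto
  have "\<iota> p \<in> ?R" for p
  proof (induction p)
    case 0 then show ?case using R by simp
  next
    case (pCons a p) then show ?case unfolding iota_pCons[of a p] using R base by auto
  qed
  then show cr: "coord_ring \<subseteq> ?R"
    using base R by (auto elim!: coord_ringE simp: elem_def)
  let ?L = "gen_subfield (range const \<union> {xc, y})"
  have L: "is_subfield ?L" by (rule gen_subfield)
  have "?R \<subseteq> ?L" by (intro gen_subring_minimal gen_subfield(2) is_subfieldD(1)[OF L])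
  then have "f \<in> ?L" "g \<in> ?L" "h \<in> ?L" using cr fgh by auto
  then have "u \<in> ?L" "v \<in> ?L" unfolding u_def v_def by (blast intro: is_subfieldD(3)[OF L])+
  moreover have "range const \<subseteq> ?L" using gen_subfield(2)[of "range const \<union> {xc, y}"] by auto
  ultimately show "gen_subfield (range const \<union> {u, v}) \<subseteq> ?L"
    by (intro gen_subfield_minimal L) auto
qed

lemma function_field_fractions:
  assumes "c \<in> gen_subfield (range const \<union> {xc, y})"
  obtains a b where "a \<in> coord_ring" "b \<in> coord_ring" "b \<noteq> 0" "c = a / b"
proof -
  have "gen_subring (range const \<union> {xc, y}) \<subseteq> coord_ring"
    by (intro gen_subring_minimal is_subring_coord_ring) auto
  moreover obtain a b where "a \<in> gen_subring (range const \<union> {xc, y})" "b \<in> gen_subring (range const \<union> {xc, y})"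
    "b \<noteq> 0" "c = a / b" using assms by (rule gen_subfield_fractions)
  ultimately show ?thesis using that by blast
qed

text \<open>
  Write \<open>c\<close> as a fraction of elements of the coordinate ring; both have finitely many zeros.
\<close>

lemma generic_nonzero:
  assumes "c \<in> M" "c \<noteq> 0"
  obtains B where "finite B" "\<And>x0 y0. on_curve W x0 y0 \<Longrightarrow> (x0, y0) \<notin> B \<Longrightarrow>
    c \<in> local_ring x0 y0 \<and> lev x0 y0 c \<noteq> 0"
proof -
  obtain a b where ab: "a \<in> coord_ring" "b \<in> coord_ring" "b \<noteq> 0" "c = a / b"
    using assms(1) generated_by_xy(1) unfolding M_def by (elim function_field_fractions[OF subsetD])
  then have "a \<noteq> 0" using assms(2) by auto
  let ?B = "\<lambda>a. {(x0, y0). on_curve W x0 y0 \<and> ev x0 y0 a = 0}"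
  show ?thesis
  proof (rule that[of "?B a \<union> ?B b"])
    show "finite (?B a \<union> ?B b)" using finite_zeros ab \<open>a \<noteq> 0\<close> by blast
    fix x0 y0 assume c: "on_curve W x0 y0" "(x0, y0) \<notin> ?B a \<union> ?B b"
    then show "c \<in> local_ring x0 y0 \<and> lev x0 y0 c \<noteq> 0"
      unfolding ab(4) local_ring_def lev_def
      using localiseI[OF ab(1,2), of "ev x0 y0"] localise_hom_frac[OF hom_on_ev[OF c(1)] ab(1,2)] by auto
  qed
qed

definition base_ring where "base_ring x0 y0 = localise Kuv (lev x0 y0)"

lemma uv_local:
  assumes "on_curve W x0 y0" "ev x0 y0 h \<noteq> 0"
  shows "u \<in> local_ring x0 y0" "v \<in> local_ring x0 y0"
    "lev x0 y0 u = ev x0 y0 f / ev x0 y0 h" "lev x0 y0 v = ev x0 y0 g / ev x0 y0 h"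
  unfolding u_def v_def local_ring_def lev_def
  by (rule localiseI localise_hom_frac hom_on_ev fgh assms)+

lemma Kuv_local:
  assumes "on_curve W x0 y0" "ev x0 y0 h \<noteq> 0"
  shows "Kuv \<subseteq> local_ring x0 y0"
  unfolding Kuv_def
proof (rule gen_subring_minimal)
  show "is_subring (local_ring x0 y0)" by (rule hom_onD(1)[OF hom_on_lev[OF assms(1)]])
  show "range const \<union> {u, v} \<subseteq> local_ring x0 y0"
    using uv_local(1,2)[OF assms] lev_coord_ring(1)[OF assms(1) const_in] by auto
qed

lemma hom_on_Kuv:
  assumes "on_curve W x0 y0" "ev x0 y0 h \<noteq> 0"
  shows "hom_on Kuv (lev x0 y0)"
  by (rule hom_on_subset[OF hom_on_lev[OF assms(1)] _ Kuv_local[OF assms]])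
     (simp add: Kuv_def gen_subring(1))

lemma M_props: "is_subfield M" "range const \<union> {u, v} \<subseteq> M" "Kuv \<subseteq> M"
proof -
  show M: "is_subfield M" unfolding M_def by (rule gen_subfield(1))
  show S: "range const \<union> {u, v} \<subseteq> M" unfolding M_def by (rule gen_subfield(2))
  show "Kuv \<subseteq> M" unfolding Kuv_def by (rule gen_subring_minimal[OF is_subfieldD(1)[OF M] S])
qed

lemma base_ring_props:
  assumes "on_curve W x0 y0" "ev x0 y0 h \<noteq> 0"
  shows "base_ring x0 y0 \<subseteq> local_ring x0 y0" "hom_on (base_ring x0 y0) (lev x0 y0)"
    "base_ring x0 y0 \<subseteq> M" "Kuv \<subseteq> base_ring x0 y0"
proof -
  show sub: "base_ring x0 y0 \<subseteq> local_ring x0 y0"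
  proof
    fix c assume "c \<in> base_ring x0 y0"
    then obtain a b where ab: "a \<in> Kuv" "b \<in> Kuv" "lev x0 y0 b \<noteq> 0" "c = a / b"
      unfolding base_ring_def localise_def by blast
    then have "a \<in> local_ring x0 y0" "b \<in> local_ring x0 y0" using Kuv_local[OF assms] by auto
    then show "c \<in> local_ring x0 y0"
      using localise_frac_mem(1)[OF hom_on_ev[OF assms(1)]] ab(3) unfolding ab(4) local_ring_def lev_def
      by blast
  qed
  have "is_subring (base_ring x0 y0)"
    unfolding base_ring_def by (rule hom_onD(1)[OF hom_on_localise(1)[OF hom_on_Kuv[OF assms]]])
  then show "hom_on (base_ring x0 y0) (lev x0 y0)"
    by (intro hom_on_subset[OF hom_on_lev[OF assms(1)] _ sub])
  show "base_ring x0 y0 \<subseteq> M"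
    using is_subfieldD(3)[OF M_props(1)] M_props(3) unfolding base_ring_def localise_def by auto
  show "Kuv \<subseteq> base_ring x0 y0"
    unfolding base_ring_def by (rule subsetI) (rule hom_on_localise(2)[OF hom_on_Kuv[OF assms]])
qed

text \<open>
  The elements of \<open>M\<close> are fractions of polynomials in \<open>u\<close> and \<open>v\<close>, and each denominator has finitely many
  zeros.
\<close>

lemma generic_base_ring:
  assumes "finite D" "D \<subseteq> M"
  obtains B where "finite B" "\<And>x0 y0. on_curve W x0 y0 \<Longrightarrow> (x0, y0) \<notin> B \<Longrightarrow>
    ev x0 y0 h \<noteq> 0 \<and> D \<subseteq> base_ring x0 y0"
proof -
  have "\<exists>B. finite B \<and> (\<forall>x0 y0. on_curve W x0 y0 \<longrightarrow> (x0, y0) \<notin> B \<longrightarrow>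
    ev x0 y0 h \<noteq> 0 \<and> D \<subseteq> base_ring x0 y0)"
    using assms
  proof (induction D rule: finite_induct)
    case empty
    then show ?case using finite_zeros[OF fgh(3,4)]
      by (intro exI[of _ "{(x0, y0). on_curve W x0 y0 \<and> ev x0 y0 h = 0}"]) auto
  next
    case (insert c D)
    then obtain B where B: "finite B" "\<And>x0 y0. on_curve W x0 y0 \<Longrightarrow> (x0, y0) \<notin> B \<Longrightarrow>
      ev x0 y0 h \<noteq> 0 \<and> D \<subseteq> base_ring x0 y0" by auto
    have "c \<in> M" using insert by simp
    then obtain a b where ab: "a \<in> Kuv" "b \<in> Kuv" "b \<noteq> 0" "c = a / b"
      unfolding M_def Kuv_def by (rule gen_subfield_fractions)
    have "b \<in> M" using ab(2) M_props(3) by blast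
    then obtain B' where B': "finite B'" "\<And>x0 y0. on_curve W x0 y0 \<Longrightarrow> (x0, y0) \<notin> B' \<Longrightarrow>
      b \<in> local_ring x0 y0 \<and> lev x0 y0 b \<noteq> 0" using generic_nonzero[OF _ ab(3)] by blast
    show ?case
    proof (intro exI[of _ "B \<union> B'"] conjI allI impI)
      show "finite (B \<union> B')" using B B' by simp
      fix x0 y0 assume c: "on_curve W x0 y0" "(x0, y0) \<notin> B \<union> B'"
      then show "ev x0 y0 h \<noteq> 0" using B by blast
      have "c \<in> base_ring x0 y0" unfolding ab(4) base_ring_def
        using localiseI[OF ab(1,2)] B'(2) c by blast
      then show "insert c D \<subseteq> base_ring x0 y0" using B(2) c by blast
    qed
  qed
  then show ?thesis using that by blast
qed

text \<open>
  Functions pulled back from the target take the same value at all points of a fibre, since \<open>u\<close> and \<open>v\<close>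
  do.
\<close>

lemma lev_eq_on_fibre:
  assumes c0: "on_curve W x0 y0" "ev x0 y0 h \<noteq> 0" and c: "on_curve W x z" "ev x z h \<noteq> 0"
    and eq: "ev x z f / ev x z h = ev x0 y0 f / ev x0 y0 h" "ev x z g / ev x z h = ev x0 y0 g / ev x0 y0 h"
    and a: "a \<in> base_ring x0 y0"
  shows "a \<in> local_ring x z" "lev x z a = lev x0 y0 a"
proof -
  have agree: "lev x z b = lev x0 y0 b" if "b \<in> Kuv" for b
  proof (rule hom_on_agree[where S = "range const \<union> {u, v}"])
    show "hom_on (gen_subring (range const \<union> {u, v})) (lev x z)"
      "hom_on (gen_subring (range const \<union> {u, v})) (lev x0 y0)"
      using hom_on_Kuv[OF c0] hom_on_Kuv[OF c] by (simp_all add: Kuv_def)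
    show "b \<in> gen_subring (range const \<union> {u, v})" using that by (simp add: Kuv_def)
    fix k assume "k \<in> range const \<union> {u, v}"
    then show "lev x z k = lev x0 y0 k"
      using uv_local(3,4)[OF c0] uv_local(3,4)[OF c] eq
        lev_coord_ring(2)[OF c0(1) const_in] lev_coord_ring(2)[OF c(1) const_in] by auto
  qed
  obtain p q where pq: "p \<in> Kuv" "q \<in> Kuv" "lev x0 y0 q \<noteq> 0" "a = p / q"
    using a unfolding base_ring_def localise_def by blast
  have q: "lev x z q \<noteq> 0" using pq agree by simp
  have p1: "p \<in> local_ring x z" "q \<in> local_ring x z" using pq Kuv_local[OF c] by auto
  have p2: "p \<in> local_ring x0 y0" "q \<in> local_ring x0 y0" using pq Kuv_local[OF c0] by auto
  show "a \<in> local_ring x z"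
    unfolding pq(4) local_ring_def
    by (rule localise_frac_mem(1)[OF hom_on_ev[OF c(1)] p1[unfolded local_ring_def] q[unfolded lev_def]])
  have "lev x z a = lev x z p / lev x z q"
    unfolding pq(4) lev_def
    by (rule localise_frac_mem(2)[OF hom_on_ev[OF c(1)] p1[unfolded local_ring_def] q[unfolded lev_def]])
  moreover have "lev x0 y0 a = lev x0 y0 p / lev x0 y0 q"
    unfolding pq(4) lev_def
    by (rule localise_frac_mem(2)[OF hom_on_ev[OF c0(1)] p2[unfolded local_ring_def] pq(3)[unfolded lev_def]])
  ultimately show "lev x z a = lev x0 y0 a" using agree pq by simp
qed

text \<open>
  This is how points of the curve are produced: a homomorphism that fixes the constants preserves the
  equation of the curve.
\<close>

lemma hom_eq_ev:
  assumes h': "hom_on A \<chi>" and const: "\<And>a. const a \<in> A \<and> \<chi> (const a) = a" and xA: "xc \<in> A" and yA: "y \<in> A"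
  shows "on_curve W (\<chi> xc) (\<chi> y)" "c \<in> coord_ring \<Longrightarrow> c \<in> A \<and> \<chi> c = ev (\<chi> xc) (\<chi> y) c"
proof -
  note A = is_subringD[OF hom_onD(1)[OF h']] and hh = hom_onD[OF h']
  have iota: "\<iota> p \<in> A \<and> \<chi> (\<iota> p) = poly p (\<chi> xc)" for p
  proof (induction p)
    case 0 then show ?case using A(5) hh(5) by simp
  next
    case (pCons a p)
    then show ?case unfolding iota_pCons[of a p] using A(2,3) hh(3,4) const xA by simp
  qed
  have mem: "\<iota> w \<in> A" "\<iota> s \<in> A" and val: "\<chi> (\<iota> w) = poly w (\<chi> xc)" "\<chi> (\<iota> s) = poly s (\<chi> xc)"
    using iota by blast+
  have "\<chi> y ^ 2 = \<chi> (\<iota> w - \<iota> s * y)" unfolding weierstrass_eq[symmetric] by (rule hh(9)[OF yA, symmetric])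
  also have "\<dots> = \<chi> (\<iota> w) - \<chi> (\<iota> s * y)" by (rule hh(7)[OF mem(1) A(3)[OF mem(2) yA]])
  also have "\<chi> (\<iota> s * y) = \<chi> (\<iota> s) * \<chi> y" by (rule hh(4)[OF mem(2) yA])
  finally have "\<chi> y ^ 2 = poly w (\<chi> xc) - poly s (\<chi> xc) * \<chi> y" unfolding val .
  then show "on_curve W (\<chi> xc) (\<chi> y)"
    unfolding on_curve_def poly_s poly_w by (simp add: algebra_simps)
  assume "c \<in> coord_ring"
  then obtain p q where c: "c = elem p q" by (rule coord_ringE)
  have mem: "\<iota> p \<in> A" "\<iota> q \<in> A" and val: "\<chi> (\<iota> p) = poly p (\<chi> xc)" "\<chi> (\<iota> q) = poly q (\<chi> xc)"
    using iota by blast+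
  have "\<chi> (\<iota> p + \<iota> q * y) = \<chi> (\<iota> p) + \<chi> (\<iota> q) * \<chi> y"
    using hh(3)[OF mem(1) A(3)[OF mem(2) yA]] hh(4)[OF mem(2) yA] by simp
  moreover have "\<iota> p + \<iota> q * y \<in> A" by (rule A(2)[OF mem(1) A(3)[OF mem(2) yA]])
  ultimately show "c \<in> A \<and> \<chi> c = ev (\<chi> xc) (\<chi> y) c"
    unfolding c ev_elem val by (simp add: elem_def)
qed

text \<open>
  At a generic point, evaluation is defined on a local ring \<open>A\<close> of the target that contains all relevant
  coefficients. If \<open>(x, z)\<close> lies in the fibre, evaluation at \<open>(x, z)\<close> agrees with it on \<open>A\<close>, so \<open>x\<close> is a root
  of the specialised \<open>m1\<close>, and \<open>z\<close> is a root of \<open>m2\<close> specialised at \<open>x\<close>. Conversely, such roots extend the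
  evaluation on \<open>A\<close> to a homomorphism on \<open>A[x][y]\<close>, which is evaluation at \<open>(x, z)\<close>; as it is unchanged on
  \<open>u\<close> and \<open>v\<close>, the point \<open>(x, z)\<close> lies in the fibre. All roots are simple, which gives the count.
\<close>

theorem card_generic_fibre:
  assumes m1: "is_minpoly M xc m1" and d1: "poly (pderiv m1) xc \<noteq> 0"
    and m2: "is_minpoly (adjoin M xc) y m2" and d2: "poly (pderiv m2) y \<noteq> 0"
  obtains B where "finite B" "\<And>x0 y0. on_curve W x0 y0 \<Longrightarrow> (x0, y0) \<notin> B \<Longrightarrow> ev x0 y0 h \<noteq> 0 \<and>
    card {(x, z). on_curve W x z \<and> ev x z h \<noteq> 0 \<and> ev x z f / ev x z h = ev x0 y0 f / ev x0 y0 h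
      \<and> ev x z g / ev x z h = ev x0 y0 g / ev x0 y0 h} = Polynomial.degree m1 * Polynomial.degree m2"
proof -
  obtain r1 s1 where rs1: "poly_over M r1" "poly_over M s1" "r1 * pderiv m1 = 1 + m1 * s1"
    using minpoly_bezout[OF M_props(1) m1 d1] .
  have F1: "is_subfield (adjoin M xc)" by (rule adjoin_subfield[OF M_props(1) m1])
  obtain r2 s2 where rs2: "poly_over (adjoin M xc) r2" "poly_over (adjoin M xc) s2"
    "r2 * pderiv m2 = 1 + m2 * s2"
    using minpoly_bezout[OF F1 m2 d2] .
  let ?F2 = "adjoin (adjoin M xc) y"
  have F2: "is_subfield ?F2" by (rule adjoin_subfield[OF F1 m2])
  have M1: "M \<subseteq> adjoin M xc" "xc \<in> adjoin M xc"
    by (rule adjoin_base[OF is_subfieldD(1)[OF M_props(1)]])+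
  have M2: "adjoin M xc \<subseteq> ?F2" "y \<in> ?F2"
    by (rule adjoin_base[OF is_subfieldD(1)[OF F1]])+
  have "gen_subring (range const \<union> {xc, y}) \<subseteq> ?F2"
    using M1 M2 M_props(2) by (intro gen_subring_minimal is_subfieldD(1)[OF F2]) auto
  then have "h \<in> ?F2" using generated_by_xy(2) fgh(3) by blast
  then have hinv: "inverse h \<in> ?F2" by (rule is_subfieldD(2)[OF F2])
  have sp0: "c \<in> M \<Longrightarrow> spreads M c (\<lambda>A. A)" for c by (rule spreads_base)
  have sp1: "c \<in> adjoin M xc \<Longrightarrow> spreads M c (\<lambda>A. adjoin A xc)" for c by (rule spreads_adjoin[OF sp0])
  have sp2: "spreads M (inverse h) (\<lambda>A. adjoin (adjoin A xc) y)" by (rule spreads_adjoin[OF sp1 hinv])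
  have m1o: "poly_over M m1" and m2o: "poly_over (adjoin M xc) m2"
    using m1 m2 by (simp_all add: is_minpoly_iff)
  \<comment> \<open>a finite part of \<open>M\<close> over which both minimal polynomials, their Bezout identities and \<open>1 / h\<close> are defined\<close>
  obtain D1 where D1: "finite D1" "D1 \<subseteq> M" "\<And>A. is_subring A \<Longrightarrow> D1 \<subseteq> A \<Longrightarrow> poly_over A m1"
    using spreads_poly[OF sp0 m1o] by blast
  obtain D2 where D2: "finite D2" "D2 \<subseteq> M" "\<And>A. is_subring A \<Longrightarrow> D2 \<subseteq> A \<Longrightarrow> poly_over A r1"
    using spreads_poly[OF sp0 rs1(1)] by blast
  obtain D3 where D3: "finite D3" "D3 \<subseteq> M" "\<And>A. is_subring A \<Longrightarrow> D3 \<subseteq> A \<Longrightarrow> poly_over A s1"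
    using spreads_poly[OF sp0 rs1(2)] by blast
  obtain D4 where D4: "finite D4" "D4 \<subseteq> M" "\<And>A. is_subring A \<Longrightarrow> D4 \<subseteq> A \<Longrightarrow> poly_over (adjoin A xc) m2"
    using spreads_poly[OF sp1 m2o] by blast
  obtain D5 where D5: "finite D5" "D5 \<subseteq> M" "\<And>A. is_subring A \<Longrightarrow> D5 \<subseteq> A \<Longrightarrow> poly_over (adjoin A xc) r2"
    using spreads_poly[OF sp1 rs2(1)] by blast
  obtain D6 where D6: "finite D6" "D6 \<subseteq> M" "\<And>A. is_subring A \<Longrightarrow> D6 \<subseteq> A \<Longrightarrow> poly_over (adjoin A xc) s2"
    using spreads_poly[OF sp1 rs2(2)] by blast
  obtain D7 where D7: "finite D7" "D7 \<subseteq> M"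
    "\<And>A. is_subring A \<Longrightarrow> D7 \<subseteq> A \<Longrightarrow> inverse h \<in> adjoin (adjoin A xc) y"
    using sp2 unfolding spreads_def by blast
  let ?D = "D1 \<union> D2 \<union> D3 \<union> D4 \<union> D5 \<union> D6 \<union> D7"
  have "finite ?D" "?D \<subseteq> M"
    using D1(1,2) D2(1,2) D3(1,2) D4(1,2) D5(1,2) D6(1,2) D7(1,2) by auto
  then obtain B where B: "finite B" "\<And>x0 y0. on_curve W x0 y0 \<Longrightarrow> (x0, y0) \<notin> B \<Longrightarrow>
    ev x0 y0 h \<noteq> 0 \<and> ?D \<subseteq> base_ring x0 y0" by (rule generic_base_ring) blast
  show ?thesis
  proof (rule that[OF B(1)], intro conjI)
    fix x0 y0 assume c0: "on_curve W x0 y0" and "(x0, y0) \<notin> B"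
    then have h0: "ev x0 y0 h \<noteq> 0" and D: "?D \<subseteq> base_ring x0 y0" using B(2) by blast+
    show "ev x0 y0 h \<noteq> 0" by (rule h0)
    define A where "A = base_ring x0 y0"
    define \<chi> where "\<chi> = lev x0 y0"
    have hA: "hom_on A \<chi>" unfolding A_def \<chi>_def by (rule base_ring_props[OF c0 h0])
    have A: "is_subring A" by (rule hom_onD(1)[OF hA])
    have AM: "A \<subseteq> M" and KA: "Kuv \<subseteq> A" unfolding A_def by (rule base_ring_props[OF c0 h0])+
    have over1: "poly_over A m1" "poly_over A r1" "poly_over A s1"
      using D1(3)[OF A] D2(3)[OF A] D3(3)[OF A] D unfolding A_def by auto
    have over2: "poly_over (adjoin A xc) m2" "poly_over (adjoin A xc) r2" "poly_over (adjoin A xc) s2"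
      using D4(3)[OF A] D5(3)[OF A] D6(3)[OF A] D unfolding A_def by auto
    have hinvA: "inverse h \<in> adjoin (adjoin A xc) y" using D7(3)[OF A] D unfolding A_def by auto
    \<comment> \<open>the possible \<open>x\<close>, each with an extension \<open>\<psi> x\<close> of evaluation, and the possible second coordinates over it\<close>
    define R1 where "R1 = {x. poly (map_poly \<chi> m1) x = 0}"
    have card1: "card R1 = Polynomial.degree m1"
      unfolding R1_def using m1 by (intro card_roots_specialised_minpoly[OF hA over1(1) _ over1(2,3) rs1(3)])
        (simp add: is_minpoly_iff)
    have "\<exists>\<chi>'. hom_on (adjoin A xc) \<chi>' \<and> (\<forall>a\<in>A. \<chi>' a = \<chi> a) \<and> \<chi>' xc = x \<and>
      (\<forall>q. poly_over A q \<longrightarrow> \<chi>' (poly q xc) = poly (map_poly \<chi> q) x)" if "x \<in> R1" for x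
      using extend_hom[OF hA AM m1 over1(1), of x] that unfolding R1_def by simp
    then have "\<exists>\<psi>. \<forall>x\<in>R1. hom_on (adjoin A xc) (\<psi> x) \<and> (\<forall>a\<in>A. \<psi> x a = \<chi> a) \<and> \<psi> x xc = x \<and>
      (\<forall>q. poly_over A q \<longrightarrow> \<psi> x (poly q xc) = poly (map_poly \<chi> q) x)" by (intro bchoice ballI)
    then obtain \<psi> where \<psi>: "\<And>x. x \<in> R1 \<Longrightarrow> hom_on (adjoin A xc) (\<psi> x)"
      "\<And>x a. x \<in> R1 \<Longrightarrow> a \<in> A \<Longrightarrow> \<psi> x a = \<chi> a" "\<And>x. x \<in> R1 \<Longrightarrow> \<psi> x xc = x"
      "\<And>x q. x \<in> R1 \<Longrightarrow> poly_over A q \<Longrightarrow> \<psi> x (poly q xc) = poly (map_poly \<chi> q) x" by blast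
    define R2 where "R2 x = {z. poly (map_poly (\<psi> x) m2) z = 0}" for x
    have card2: "card (R2 x) = Polynomial.degree m2" if "x \<in> R1" for x
      unfolding R2_def using m2
      by (intro card_roots_specialised_minpoly[OF \<psi>(1)[OF that] over2(1) _ over2(2,3) rs2(3)])
        (simp add: is_minpoly_iff)
    have fin: "finite R1" "x \<in> R1 \<Longrightarrow> finite (R2 x)" for x
      using card1 card2[of x] minpoly_degree_pos[OF m1] minpoly_degree_pos[OF m2]
      by (auto intro: card_ge_0_finite)
    have const\<chi>: "const a \<in> A \<and> \<chi> (const a) = a" for a
    proof
      show "const a \<in> A" using KA gen_subring(2)[of "range const \<union> {u, v}"] unfolding Kuv_def by blast
      show "\<chi> (const a) = a" unfolding \<chi>_def using lev_coord_ring(2)[OF c0 const_in] by simp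
    qed
    have uvA: "u \<in> A" "v \<in> A" using KA gen_subring(2)[of "range const \<union> {u, v}"] unfolding Kuv_def by blast+
    let ?f = "{(x, z). on_curve W x z \<and> ev x z h \<noteq> 0 \<and> ev x z f / ev x z h = ev x0 y0 f / ev x0 y0 h
      \<and> ev x z g / ev x z h = ev x0 y0 g / ev x0 y0 h}"
    have "?f = (SIGMA x:R1. R2 x)"
    proof (intro equalityI subsetI)
      fix xz assume "xz \<in> ?f"
      then obtain x z where xz: "xz = (x, z)" and c: "on_curve W x z" "ev x z h \<noteq> 0"
        "ev x z f / ev x z h = ev x0 y0 f / ev x0 y0 h" "ev x z g / ev x z h = ev x0 y0 g / ev x0 y0 h"
        by blast
      define \<phi> where "\<phi> = lev x z"
      have h\<phi>: "hom_on (local_ring x z) \<phi>" unfolding \<phi>_def by (rule hom_on_lev[OF c(1)])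
      have A\<phi>: "a \<in> local_ring x z" "\<phi> a = \<chi> a" if "a \<in> A" for a
        using lev_eq_on_fibre[OF c0 h0 c] that unfolding A_def \<phi>_def \<chi>_def by blast+
      have xcl: "xc \<in> local_ring x z" "\<phi> xc = x" and yl: "y \<in> local_ring x z" "\<phi> y = z"
        unfolding \<phi>_def using lev_coord_ring[OF c(1), of xc] lev_coord_ring[OF c(1), of y] by (simp_all add: ev_y)
      have val1: "\<phi> (poly q xc) = poly (map_poly \<chi> q) x" if q: "poly_over A q" for q
      proof -
        have ql: "poly_over (local_ring x z) q" using q A\<phi>(1) unfolding poly_over_def by blast
        have "map_poly \<phi> q = map_poly \<chi> q"
          using q A\<phi>(2) hom_onD(5)[OF h\<phi>] hom_onD(5)[OF hA]
          by (intro poly_eqI) (simp add: coeff_map_poly poly_over_def)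
        then show ?thesis using hom_on_map_poly(5)[OF h\<phi> ql ql xcl(1)] xcl(2) by simp
      qed
      have x: "x \<in> R1"
        using val1[OF over1(1)] m1 hom_onD(5)[OF h\<phi>] unfolding R1_def by (simp add: is_minpoly_iff)
      have B1: "adjoin A xc \<subseteq> local_ring x z"
        using A\<phi>(1) xcl(1) by (intro adjoin_minimal hom_onD(1)[OF h\<phi>]) auto
      have B2: "\<phi> a = \<psi> x a" if "a \<in> adjoin A xc" for a
        using that val1 \<psi>(4)[OF x] unfolding adjoin_def by auto
      have ql: "poly_over (local_ring x z) m2" using over2(1) B1 unfolding poly_over_def by blast
      have "map_poly \<phi> m2 = map_poly (\<psi> x) m2"
        using over2(1) B2 hom_onD(5)[OF h\<phi>] hom_onD(5)[OF \<psi>(1)[OF x]]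
        by (intro poly_eqI) (simp add: coeff_map_poly poly_over_def)
      then have "z \<in> R2 x"
        using hom_on_map_poly(5)[OF h\<phi> ql ql yl(1)] yl(2) m2 hom_onD(5)[OF h\<phi>]
        unfolding R2_def by (simp add: is_minpoly_iff)
      then show "xz \<in> (SIGMA x:R1. R2 x)" using x xz by blast
    next
      fix xz assume "xz \<in> (SIGMA x:R1. R2 x)"
      then obtain x z where xz: "xz = (x, z)" and x: "x \<in> R1" and z: "z \<in> R2 x" by blast
      let ?A2 = "adjoin (adjoin A xc) y"
      obtain \<omega> where \<omega>: "hom_on ?A2 \<omega>" "\<And>a. a \<in> adjoin A xc \<Longrightarrow> \<omega> a = \<psi> x a" "\<omega> y = z"
        using extend_hom[OF \<psi>(1)[OF x] adjoin_mono[OF AM] m2 over2(1) z[unfolded R2_def mem_Collect_eq]]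
        by blast
      have i1: "A \<subseteq> adjoin A xc" "xc \<in> adjoin A xc" by (rule adjoin_base[OF A])+
      have i2: "adjoin A xc \<subseteq> ?A2" "y \<in> ?A2" by (rule adjoin_base[OF adjoin_subring[OF A]])+
      have A\<omega>: "a \<in> ?A2" "\<omega> a = \<chi> a" if "a \<in> A" for a
        using that i1 i2 \<omega>(2) \<psi>(2)[OF x that] by auto
      have x\<omega>: "\<omega> xc = x" using \<omega>(2)[OF i1(2)] \<psi>(3)[OF x] by simp
      have const\<omega>: "const a \<in> ?A2 \<and> \<omega> (const a) = a" for a using A\<omega>[of "const a"] const\<chi>[of a] by simp
      have "xc \<in> ?A2" using i1 i2 by blast
      note E = hom_eq_ev[OF \<omega>(1) const\<omega> this i2(2), unfolded x\<omega> \<omega>(3)]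
      \<comment> \<open>\<open>1 / h\<close> lies in the domain of \<open>\<omega>\<close>, so \<open>h\<close> does not vanish at the new point\<close>
      have "\<omega> (h * inverse h) = ev x z h * \<omega> (inverse h)"
        using hom_onD(4)[OF \<omega>(1) _ hinvA] E(2)[OF fgh(3)] by simp
      then have hz: "ev x z h \<noteq> 0" using fgh(4) hom_onD(2)[OF \<omega>(1)] by auto
      have uv: "\<chi> u = ev x0 y0 f / ev x0 y0 h" "\<chi> v = ev x0 y0 g / ev x0 y0 h"
        unfolding \<chi>_def by (rule uv_local[OF c0 h0])+
      have "\<omega> (u * h) = \<chi> u * ev x z h" "\<omega> (v * h) = \<chi> v * ev x z h"
        using hom_onD(4)[OF \<omega>(1) A\<omega>(1)[OF uvA(1)]] hom_onD(4)[OF \<omega>(1) A\<omega>(1)[OF uvA(2)]]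
          E(2)[OF fgh(3)] A\<omega>(2)[OF uvA(1)] A\<omega>(2)[OF uvA(2)] by simp_all
      moreover have "u * h = f" "v * h = g" using fgh(4) by (simp_all add: u_def v_def)
      ultimately have "ev x z f = \<chi> u * ev x z h" "ev x z g = \<chi> v * ev x z h"
        using E(2)[OF fgh(1)] E(2)[OF fgh(2)] by simp_all
      then have "ev x z f / ev x z h = \<chi> u" "ev x z g / ev x z h = \<chi> v" using hz by simp_all
      then show "xz \<in> ?f" using E(1) hz uv xz by simp
    qed
    then have "card ?f = (\<Sum>x\<in>R1. card (R2 x))" using fin by (simp add: card_SigmaI)
    also have "\<dots> = Polynomial.degree m1 * Polynomial.degree m2" using card1 card2 by simp
    finally show "card ?f = Polynomial.degree m1 * Polynomial.degree m2" .
  qed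
qed

end

section \<open>Finite subfields\<close>

lemma finite_subring_is_subfield:
  fixes A :: "'a::field set"
  assumes A: "is_subring A" "finite A"
  shows "is_subfield A"
  unfolding is_subfield_def
proof (intro conjI ballI A(1))
  note R = is_subringD[OF A(1)]
  fix a assume a: "a \<in> A"
  show "inverse a \<in> A"
  proof (cases "a = 0")
    case False
    have "range (\<lambda>n::nat. a ^ n) \<subseteq> A" using R(7) a by auto
    then have "finite (range (\<lambda>n::nat. a ^ n))" using A(2) finite_subset by blast
    then have "\<not> inj (\<lambda>n::nat. a ^ n)" using finite_imageD infinite_UNIV_nat by blast
    then obtain i j :: nat where ij: "i < j" "a ^ i = a ^ j"
      unfolding inj_on_def by (metis linorder_neqE_nat)
    have "a ^ j = a ^ i * a ^ (j - i)" using ij(1) by (simp flip: power_add)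
    then have "a ^ (j - i) = 1" using ij(2) False by simp
    moreover have "a ^ (j - i) = a * a ^ (j - i - 1)" using ij(1) by (metis Suc_diff_1 power_Suc zero_less_diff)
    ultimately have "inverse a = a ^ (j - i - 1)" by (metis inverse_unique)
    then show ?thesis using R(7) a by simp
  qed (use R in auto)
qed

text \<open>
  Multiplication by \<open>a \<noteq> 0\<close> permutes the nonzero elements, so it does not change their product.
\<close>

lemma finite_subfield_power_card:
  assumes L: "is_subfield L" "finite L" and a: "a \<in> L"
  shows "a ^ card L = (a :: 'a::field)"
proof (cases "a = 0")
  case True
  then show ?thesis using L a card_gt_0_iff[of L] by (auto simp: power_0_left)
next
  case False
  note R = is_subringD[OF is_subfieldD(1)[OF L(1)]]
  let ?U = "L - {0}"
  have "bij_betw (\<lambda>x. a * x) ?U ?U"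
  proof (rule bij_betwI[where g = "\<lambda>x. inverse a * x"])
    show "(\<lambda>x. a * x) \<in> ?U \<rightarrow> ?U" using R(3) a False by auto
    show "(\<lambda>x. inverse a * x) \<in> ?U \<rightarrow> ?U" using R(3)[OF is_subfieldD(2)[OF L(1) a]] False by auto
  qed (use False in \<open>auto simp: mult.assoc[symmetric]\<close>)
  then have "(\<Prod>x\<in>?U. a * x) = \<Prod>?U" by (rule prod.reindex_bij_betw)
  then have "a ^ card ?U * \<Prod>?U = \<Prod>?U" by (simp add: prod.distrib)
  moreover have "\<Prod>?U \<noteq> 0" using L(2) by (simp add: prod_zero_iff)
  ultimately have p: "a ^ card ?U = 1" by simp
  have c: "card L = Suc (card ?U)" by (rule card.remove[OF L(2) R(5)])
  show ?thesis unfolding c power_Suc p by simp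
qed

lemma card_power_fixed_le:
  assumes "2 \<le> n"
  shows "finite {a :: 'a::field. a ^ n = a}" "card {a :: 'a. a ^ n = a} \<le> n"
proof -
  let ?p = "Polynomial.monom 1 n - [:0, 1 :: 'a:]"
  have d: "Polynomial.degree [:0, 1 :: 'a:] < Polynomial.degree (Polynomial.monom (1 :: 'a) n)"
    using assms by (simp add: Polynomial.degree_monom_eq)
  have "Polynomial.degree (Polynomial.monom 1 n + - [:0, 1 :: 'a:]) = Polynomial.degree (Polynomial.monom (1 :: 'a) n)"
    by (rule degree_add_eq_left) (simp only: degree_minus d)
  then have deg: "Polynomial.degree ?p = n"
    by (simp only: diff_conv_add_uminus Polynomial.degree_monom_eq[OF one_neq_zero])
  then have p0: "?p \<noteq> 0" using assms by auto
  have eq: "{a :: 'a. a ^ n = a} = {a. poly ?p a = 0}" by (auto simp: poly_monom)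
  show "finite {a :: 'a::field. a ^ n = a}" unfolding eq using p0 by (rule poly_roots_finite)
  show "card {a :: 'a. a ^ n = a} \<le> n"
    unfolding eq using card_poly_roots_bound[OF p0] deg by simp
qed

lemma card_subfield_ge_2:
  assumes L: "is_subfield L" "finite L" shows "2 \<le> card L"
proof -
  have "{0, 1} \<subseteq> L" using is_subringD[OF is_subfieldD(1)[OF L(1)]] by simp
  then have "card {0, 1 :: 'a} \<le> card L" using L(2) by (intro card_mono)
  then show ?thesis by simp
qed

text \<open>
  The list of all elements of \<open>L\<close> spans \<open>L\<close>, so some part of it is a basis.
\<close>

lemma finite_ext_degree_exists:
  assumes F: "is_subfield F" and L: "is_subfield L" "F \<subseteq> L" "finite L"
  obtains n where "ext_degree F L n"
proof -
  have F': "subfield F RT" using F by (simp add: is_subfield_iff)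
  note R = is_subringD[OF is_subfieldD(1)[OF L(1)]]
  obtain Us where Us: "set Us = L" using finite_list[OF L(3)] by blast
  have "ring.Span RT F Vs \<subseteq> L" if "set Vs \<subseteq> L" for Vs
    using that
  proof (induction Vs)
    case Nil
    then show ?case using R by (simp add: ring.Span.simps[OF RT_ring])
  next
    case (Cons v Vs)
    have "c * v + e \<in> L" if "c \<in> F" "e \<in> ring.Span RT F Vs" for c e
      using Cons that L(2) by (intro R(2) R(3)) auto
    moreover have "ring.Span RT F (v # Vs) = ring.line_extension RT F v (ring.Span RT F Vs)"
      by (simp add: ring.Span.simps[OF RT_ring])
    ultimately show ?case by (auto simp only: line_extension_iff)
  qed
  moreover have "L \<subseteq> ring.Span RT F Us"
    using ring.Span_base_incl[OF RT_ring F', of Us] Us by simp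
  ultimately have span: "ring.Span RT F Us = L" using Us by blast
  have "set Us \<subseteq> carrier RT" by simp
  then obtain Vs where "ring.independent RT F Vs" "ring.Span RT F Vs = ring.Span RT F Us"
    by (rule ring.filter_base[OF RT_ring F'])
  then have "ring.dimension RT (length Vs) F L"
    using ring.dimensionI[OF RT_ring F', of Vs L] span by simp
  then show ?thesis using that L(2) by (simp add: ext_degree_def)
qed

section \<open>Finite subfields of the algebraic closure of a finite field\<close>

lemma CHAR_finite_prime: "Factorial_Ring.prime CHAR('k::{field, finite})"
  by (intro prime_CHAR_semidom finite_imp_CHAR_pos) simp

text \<open>
  A finite subfield is a vector space over the prime field.
\<close>

lemma card_finite_subfield:
  fixes L :: "'k::{field, finite} alg_closure set"
  assumes L: "is_subfield L" "finite L"
  obtains m where "card L = CHAR('k) ^ m"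
proof -
  let ?p = "CHAR('k)"
  let ?F = "(of_nat :: nat \<Rightarrow> 'k alg_closure) ` {..<?p}"
  have p: "0 < ?p" using CHAR_finite_prime prime_gt_0_nat by blast
  have mod: "(of_nat n :: 'k alg_closure) = of_nat (n mod ?p)" for n
  proof -
    have "(of_nat n :: 'k alg_closure) = of_nat (?p * (n div ?p) + n mod ?p)" by simp
    also have "\<dots> = of_nat ?p * of_nat (n div ?p) + of_nat (n mod ?p)" by (simp only: of_nat_add of_nat_mult)
    also have "(of_nat ?p :: 'k alg_closure) = 0" using of_nat_CHAR[where 'a = "'k alg_closure"] by simp
    finally show ?thesis by simp
  qed
  have mem: "(of_nat n :: 'k alg_closure) \<in> ?F" for n using mod[of n] p by (metis imageI lessThan_iff mod_less_divisor)
  have "is_subring ?F"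
    unfolding is_subring_def
  proof (intro conjI ballI)
    show "1 \<in> ?F" using mem[of 1] by simp
    fix a assume "a \<in> ?F"
    then obtain n where n: "a = of_nat n" by blast
    have "of_nat ((?p - 1) * n) + a = of_nat (((?p - 1) + 1) * n)" unfolding n by (simp only: of_nat_add of_nat_mult distrib_right of_nat_1) simp
    also have "\<dots> = of_nat ?p * of_nat n" using p by (simp only: of_nat_mult) simp
    also have "(of_nat ?p :: 'k alg_closure) = 0" using of_nat_CHAR[where 'a = "'k alg_closure"] by simp
    finally have "a + of_nat ((?p - 1) * n) = 0" by (simp add: add.commute)
    then have "- a = of_nat ((?p - 1) * n)" by (rule minus_unique)
    then show "- a \<in> ?F" using mem by metis
    fix b assume "b \<in> ?F"
    then obtain k where k: "b = of_nat k" by blast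
    show "a + b \<in> ?F" using mem[of "n + k"] by (simp add: n k)
    show "a * b \<in> ?F" using mem[of "n * k"] by (simp add: n k)
  qed
  then have F: "is_subfield ?F" by (rule finite_subring_is_subfield) simp
  have "inj_on (of_nat :: nat \<Rightarrow> 'k alg_closure) {..<?p}"
  proof (rule linorder_inj_onI)
    fix i j assume ij: "i < j" "i \<in> {..<?p}" "j \<in> {..<?p}"
    show "(of_nat i :: 'k alg_closure) \<noteq> of_nat j"
    proof
      assume "(of_nat i :: 'k alg_closure) = of_nat j"
      then have "(of_nat (j - i) :: 'k alg_closure) = 0" using ij(1) by (simp add: of_nat_diff)
      then have "?p dvd j - i" using of_nat_eq_0_iff_char_dvd[where 'a = "'k alg_closure"] by simp
      then show False using ij by (auto dest: dvd_imp_le)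
    qed
  qed auto
  then have card: "card ?F = ?p" by (simp add: card_image)
  have "?F \<subseteq> L" using is_subringD(9)[OF is_subfieldD(1)[OF L(1)]] by blast
  then obtain m where m: "ext_degree ?F L m" by (rule finite_ext_degree_exists[OF F L(1) _ L(2)])
  have "finite ?F" by simp
  then have "card L = card ?F ^ m" by (rule conjunct2[OF card_ext_degree[OF F _ m]])
  then show ?thesis by (intro that) (simp only: card)
qed

lemma finite_subfield_adjoin:
  fixes F :: "'k::{field, finite} alg_closure set"
  assumes F: "is_subfield F" "finite F" "range to_ac \<subseteq> F"
  shows "finite (gen_subfield (F \<union> {a}))"
proof -
  obtain p :: "'k poly" where p: "p \<noteq> 0" "poly (map_poly to_ac p) a = 0" by (rule alg_closure_algebraic)
  have "poly_over F (map_poly to_ac p)" using F(3) by (auto simp: poly_over_def coeff_map_poly)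
  moreover have "map_poly to_ac p \<noteq> 0" using p(1) by (simp add: map_poly_eq_0_iff)
  ultimately obtain m where m: "is_minpoly F a m" by (rule minpoly_exists[OF F(1) _ _ p(2)])
  show ?thesis unfolding gen_subfield_insert[OF F(1) m]
    by (rule conjunct1[OF card_ext_degree[OF F(1,2) ext_degree_adjoin[OF F(1) m]]])
qed

lemma finite_field_of_definition:
  fixes R :: "'k::{field, finite} alg_closure point"
  shows "finite (field_of_definition R)"
proof -
  let ?k = "range (to_ac :: 'k \<Rightarrow> _)"
  have "is_subring ?k"
    unfolding is_subring_def
  proof (intro conjI ballI)
    show "1 \<in> ?k" by (metis rangeI to_ac_1)
    fix a assume "a \<in> ?k"
    then obtain c where c: "a = to_ac c" by blast
    show "- a \<in> ?k" unfolding c by (metis rangeI to_ac_minus)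
    fix b assume "b \<in> ?k"
    then obtain d where d: "b = to_ac d" by blast
    show "a + b \<in> ?k" unfolding c d by (metis rangeI to_ac_add)
    show "a * b \<in> ?k" unfolding c d by (metis rangeI to_ac_mult)
  qed
  then have k: "is_subfield ?k" by (rule finite_subring_is_subfield) simp
  show ?thesis
  proof (cases R)
    case Infinity
    have "gen_subfield ?k \<subseteq> ?k" by (rule gen_subfield_minimal[OF k order_refl])
    then have "finite (gen_subfield ?k)" by (rule finite_subset) simp
    then show ?thesis by (simp add: Infinity field_of_definition_def)
  next
    case (Affine x z)
    let ?F = "gen_subfield (?k \<union> {x})"
    have F: "is_subfield ?F" "finite ?F" "?k \<subseteq> ?F"
      using gen_subfield[of "?k \<union> {x}"] finite_subfield_adjoin[OF k _ order_refl, of x] by auto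
    have "finite (gen_subfield (?F \<union> {z}))" by (rule finite_subfield_adjoin[OF F])
    moreover have "?k \<union> {x, z} = ?k \<union> {x} \<union> {z}" by auto
    ultimately show ?thesis by (simp only: Affine field_of_definition_def coordinates.simps gen_subfield_gen_subfield)
  qed
qed

section \<open>The group of points\<close>

abbreviation geom_curve :: "'k::field weierstrass \<Rightarrow> 'k alg_closure weierstrass" where
  "geom_curve E \<equiv> map_weierstrass to_ac E"

abbreviation poly_embed :: "'k::field alg_closure poly \<Rightarrow> 'k ambient" where
  "poly_embed p \<equiv> to_ac (Fract p 1)"

lemma weierstrass_ring_ff: "weierstrass_ring (geom_curve E) poly_embed (ff_y E)"
proof -
  have add: "poly_embed (p + q) = poly_embed p + poly_embed q"
    and mult: "poly_embed (p * q) = poly_embed p * poly_embed q" for p q :: "'a alg_closure poly"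
    by (simp_all flip: to_ac_add to_ac_mult)
  have pCons: "poly_embed (pCons a p) = ff_const a + ff_x * poly_embed p" for a and p :: "'a alg_closure poly"
    unfolding ff_const_def ff_x_def by (simp flip: add mult)
  have zero: "poly_embed (0 :: 'a alg_closure poly) = 0"
    by (simp add: Zero_fract_def[symmetric])
  let ?E = "map_weierstrass (ff_const \<circ> to_ac) E"
  let ?b = "wa1 ?E * ff_x + wa3 ?E" and ?c = "ff_x ^ 3 + wa2 ?E * ff_x ^ 2 + wa4 ?E * ff_x + wa6 ?E"
  obtain z where "poly [:- ?c, ?b, 1:] z = 0"
    using alg_closed_imp_poly_has_root[of "[:- ?c, ?b, 1:]"] by auto
  then have "on_curve ?E ff_x z"
    unfolding on_curve_def by (simp add: algebra_simps power2_eq_square)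
  then have "on_curve ?E ff_x (ff_y E)" unfolding ff_y_def by (rule someI)
  then have y: "ff_y E ^ 2 + ?b * ff_y E = ?c" unfolding on_curve_def by (simp add: algebra_simps)
  show ?thesis
  proof
    show "poly_embed (1 :: 'a alg_closure poly) = 1"
      by (simp add: One_fract_def[symmetric])
    show "p = 0" if "poly_embed p = 0" for p :: "'a alg_closure poly"
      using that by (simp add: Zero_fract_def eq_fract)
    show "(ff_y E)\<^sup>2 + poly_embed [:wa3 (geom_curve E), wa1 (geom_curve E):] * ff_y E =
      poly_embed [:wa6 (geom_curve E), wa4 (geom_curve E), wa2 (geom_curve E), 1:]"
    proof -
      have one: "ff_const 1 = (1 :: 'a ambient)"
        unfolding ff_const_def by (simp add: One_fract_def[symmetric] one_pCons[symmetric])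
      show ?thesis using y
        by (simp add: pCons zero weierstrass.map_sel one algebra_simps power2_eq_square power3_eq_cube)
    qed
  qed (rule add mult)+
qed

lemma elliptic_curve_geom: "elliptic_curve E \<Longrightarrow> elliptic_curve (geom_curve E)"
proof -
  have "discriminant (geom_curve E) = to_ac (discriminant E)"
    by (simp add: discriminant_def Let_def weierstrass.map_sel)
  then show "elliptic_curve E \<Longrightarrow> elliptic_curve (geom_curve E)" by (simp add: elliptic_curve_def)
qed

lemma comm_group_geom_group:
  assumes "elliptic_curve E" shows "comm_group (geom_group E)"
proof (rule comm_groupI)
  note ell = elliptic_curve_geom[OF assms]
  let ?W = "geom_curve E"
  show "\<one>\<^bsub>geom_group E\<^esub> \<in> carrier (geom_group E)"
    by (simp add: geom_group_def geom_points_def points_def)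
  fix P Q R assume "P \<in> carrier (geom_group E)" "Q \<in> carrier (geom_group E)"
  then have PQ: "P \<in> points ?W" "Q \<in> points ?W" by (simp_all add: geom_group_def geom_points_def)
  show "P \<otimes>\<^bsub>geom_group E\<^esub> Q \<in> carrier (geom_group E)"
    using point_add_closed[OF PQ] by (simp add: geom_group_def geom_points_def)
  show "P \<otimes>\<^bsub>geom_group E\<^esub> Q = Q \<otimes>\<^bsub>geom_group E\<^esub> P"
    using point_add_commute[OF PQ] by (simp add: geom_group_def)
  show "\<one>\<^bsub>geom_group E\<^esub> \<otimes>\<^bsub>geom_group E\<^esub> P = P" by (simp add: geom_group_def)
  show "\<exists>P'\<in>carrier (geom_group E). P' \<otimes>\<^bsub>geom_group E\<^esub> P = \<one>\<^bsub>geom_group E\<^esub>"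
    using point_neg_closed[OF PQ(1)] point_add_neg[of ?W P]
    by (auto simp: geom_group_def geom_points_def)
  assume "R \<in> carrier (geom_group E)"
  then have R: "R \<in> points ?W" by (simp add: geom_group_def geom_points_def)
  show "P \<otimes>\<^bsub>geom_group E\<^esub> Q \<otimes>\<^bsub>geom_group E\<^esub> R = P \<otimes>\<^bsub>geom_group E\<^esub> (Q \<otimes>\<^bsub>geom_group E\<^esub> R)"
    using weierstrass_ring.point_add_assoc[OF weierstrass_ring_ff ell PQ R] by (simp add: geom_group_def)
qed

lemma geom_group_simps [simp]:
  "carrier (geom_group E) = geom_points E" "\<one>\<^bsub>geom_group E\<^esub> = Infinity"
  "P \<otimes>\<^bsub>geom_group E\<^esub> Q = point_add (geom_curve E) P Q"
  by (simp_all add: geom_group_def)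

lemma Affine_in_geom_points: "Affine x z \<in> geom_points E \<longleftrightarrow> on_curve (geom_curve E) x z"
  by (auto simp: geom_points_def points_def)

lemma Infinity_in_geom_points: "Infinity \<in> geom_points E"
  by (simp add: geom_points_def points_def)

text \<open>
  If the field is finite, adding 1 to the product of all \<open>X - a\<close> gives a polynomial without roots.
\<close>

lemma infinite_alg_closed: "infinite (UNIV :: 'a::alg_closed_field set)"
proof
  assume fin: "finite (UNIV :: 'a set)"
  define p where "p = (\<Prod>a\<in>(UNIV :: 'a set). [:- a, 1:])"
  have p0: "poly p a = 0" for a unfolding p_def poly_prod using fin by (simp add: prod_zero_iff)
  have "p \<noteq> 0" unfolding p_def using fin by (simp add: prod_zero_iff)
  have "Polynomial.degree p \<noteq> 0"
  proof
    assume "Polynomial.degree p = 0"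
    then obtain k where "p = [:k:]" by (rule degree_eq_zeroE)
    then show False using p0[of 0] \<open>p \<noteq> 0\<close> by simp
  qed
  then have "Polynomial.degree (p + 1) > 0" by (subst degree_add_eq_left) auto
  then obtain a where "poly (p + 1) a = 0" using alg_closed_imp_poly_has_root by blast
  then show False using p0 by simp
qed

lemma infinite_geom_points: "infinite (geom_points (E :: 'k::field weierstrass))"
proof
  assume fin: "finite (geom_points E)"
  have "\<exists>z. on_curve (geom_curve E) x z" for x :: "'k alg_closure"
  proof -
    let ?W = "geom_curve E"
    let ?p = "[:- (x ^ 3 + wa2 ?W * x ^ 2 + wa4 ?W * x + wa6 ?W), wa1 ?W * x + wa3 ?W, 1:]"
    obtain z where "poly ?p z = 0" using alg_closed_imp_poly_has_root[of ?p] by auto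
    then show ?thesis unfolding on_curve_def
      by (intro exI[of _ z]) (simp add: algebra_simps power2_eq_square)
  qed
  then obtain z where "\<And>x. on_curve (geom_curve E) x (z x)" by metis
  then have "(\<lambda>x. Affine x (z x)) ` UNIV \<subseteq> geom_points E" by (auto simp: Affine_in_geom_points)
  then have "finite ((\<lambda>x. Affine x (z x)) ` UNIV)" using fin finite_subset by blast
  then have "finite (UNIV :: 'k alg_closure set)" by (rule finite_imageD) (auto intro: injI)
  then show False using infinite_alg_closed by blast
qed

section \<open>The degree of a separable isogeny is the order of its kernel\<close>

text \<open>
  The minimal polynomial \<open>m\<close> over the larger field divides \<open>p\<close>, and \<open>p'(a)\<close> is a multiple of \<open>m'(a)\<close>.
\<close>

lemma minpoly_simple_root_mono:
  assumes F: "is_subfield F" "M \<subseteq> F"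
    and p: "is_minpoly M a p" "rsquarefree p"
  obtains m where "is_minpoly F a m" "poly (pderiv m) a \<noteq> 0"
proof -
  have po: "poly_over F p" "poly p a = 0" "p \<noteq> 0"
    using p(1) poly_over_mono[OF F(2)] by (auto simp: is_minpoly_iff)
  then obtain m where m: "is_minpoly F a m" using minpoly_exists[OF F(1)] by blast
  obtain s where s: "p = m * s" using minpoly_dvd[OF is_subfieldD(1)[OF F(1)] m order_refl po(1,2)] by blast
  have "poly (pderiv p) a \<noteq> 0" by (rule simple_root_pderiv[OF p(2) po(2)])
  moreover have "poly m a = 0" using m by (simp add: is_minpoly_iff)
  ultimately have "poly (pderiv m) a \<noteq> 0" unfolding s pderiv_mult by auto
  with m show ?thesis by (rule that)
qed

lemma isogeny_group_hom:
  assumes "elliptic_curve E" "elliptic_curve E'" "isogeny E E' \<phi>"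
  shows "group_hom (geom_group E) (geom_group E') \<phi>"
  using assms comm_group_geom_group[of E] comm_group_geom_group[of E']
  by (simp add: group_hom_def group_hom_axioms_def comm_group_def isogeny_def)

lemma eval_form_generic:
  fixes E :: "'k::field weierstrass"
  assumes "on_curve (geom_curve E) x z"
  shows "eval_form (ff_const \<circ> to_ac) d c (ff_x, ff_y E, 1) \<in> weierstrass_ring.coord_ring poly_embed (ff_y E)"
    "weierstrass_ring.ev poly_embed (ff_y E) x z (eval_form (ff_const \<circ> to_ac) d c (ff_x, ff_y E, 1))
      = eval_form to_ac d c (x, z, 1)"
proof -
  interpret weierstrass_ring "geom_curve E" poly_embed "ff_y E" by (rule weierstrass_ring_ff)
  have eq: "eval_form (ff_const \<circ> to_ac) d c (ff_x, ff_y E, 1) =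
     (\<Sum>i\<le>d. \<Sum>j\<le>d-i. const (to_ac (c i j)) * xc ^ i * ff_y E ^ j)"
    by (simp add: eval_form_def const_def ff_const_def ff_x_def)
  have mem: "const (to_ac (c i j)) * xc ^ i * ff_y E ^ j \<in> coord_ring" for i j
    by (intro coord_ring_mult coord_ring_power const_in iota_in y_in)
  show "eval_form (ff_const \<circ> to_ac) d c (ff_x, ff_y E, 1) \<in> coord_ring"
    unfolding eq by (intro coord_ring_sum mem)
  have "ev x z (const (to_ac (c i j)) * xc ^ i * ff_y E ^ j) = to_ac (c i j) * x ^ i * z ^ j" for i j
    using assms by (simp add: ev_mult ev_power coord_ring_mult coord_ring_power const_def ev_iota ev_y)
  then show "ev x z (eval_form (ff_const \<circ> to_ac) d c (ff_x, ff_y E, 1)) = eval_form to_ac d c (x, z, 1)"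
    unfolding eq by (simp add: ev_sum mem coord_ring_sum eval_form_def)
qed

text \<open>
  The choice in \<open>pullback_coords\<close> is between existing candidates: take a representation that is defined at
  a point with affine image. The point at infinity is mapped to infinity, so this point is affine, and
  the third form does not vanish at it.
\<close>

lemma pullback_coords_exists:
  fixes E E' :: "'k::field weierstrass"
  assumes ell: "elliptic_curve E" "elliptic_curve E'" and iso: "isogeny E E' \<phi>"
  obtains d F f g h where "represents E \<phi> d F"
    "eval_forms (ff_const \<circ> to_ac) d F (ff_x, ff_y E, 1) = (f, g, h)" "h \<noteq> 0"
    "fst (pullback_coords E \<phi>) = f / h" "snd (pullback_coords E \<phi>) = g / h"
proof -
  interpret weierstrass_ring "geom_curve E" poly_embed "ff_y E" by (rule weierstrass_ring_ff)
  interpret group_hom "geom_group E" "geom_group E'" \<phi> by (rule isogeny_group_hom[OF ell iso])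
  have "infinite (geom_points E' - {Infinity})" using infinite_geom_points[of E'] by simp
  then obtain P' where "P' \<in> geom_points E'" "P' \<noteq> Infinity"
    using infinite_imp_nonempty by blast
  moreover have "\<phi> ` geom_points E = geom_points E'" using iso by (simp add: isogeny_def)
  ultimately have "P' \<in> \<phi> ` geom_points E" "P' \<noteq> Infinity" by simp_all
  then obtain Q where Q: "Q \<in> geom_points E" "\<phi> Q \<noteq> Infinity" by blast
  have "Q \<noteq> Infinity" using Q(2) hom_one by auto
  then obtain x z where xz: "Q = Affine x z" by (cases Q) auto
  have c: "on_curve (geom_curve E) x z" using Q(1) by (simp add: xz Affine_in_geom_points)
  obtain x' z' where xz': "\<phi> Q = Affine x' z'" using Q(2) by (cases "\<phi> Q") auto
  obtain d F where dF: "represents E \<phi> d F" "eval_forms to_ac d F (hom_coords Q) \<noteq> (0, 0, 0)"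
    using iso Q(1) unfolding isogeny_def morphism_over_def by blast
  obtain F1 F2 F3 where F: "F = (F1, F2, F3)" by (cases F)
  have "proj_eq (hom_coords (\<phi> Q)) (eval_forms to_ac d F (hom_coords Q))"
    using dF Q(1) unfolding represents_def by blast
  then have "eval_form to_ac d F3 (x, z, 1) \<noteq> 0"
    by (auto simp: proj_eq_def xz xz'[unfolded xz] F eval_forms_def)
  then have "eval_form (ff_const \<circ> to_ac) d F3 (ff_x, ff_y E, 1) \<noteq> 0"
    using eval_form_generic(2)[OF c, of d F3] by auto
  moreover obtain f g h where fgh: "eval_forms (ff_const \<circ> to_ac) d F (ff_x, ff_y E, 1) = (f, g, h)"
    by (rule prod_cases3)
  ultimately have h: "h \<noteq> 0" by (auto simp: F eval_forms_def)
  let ?P = "\<lambda>u v. \<exists>d F f g h. represents E \<phi> d F \<and>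
        eval_forms (ff_const \<circ> to_ac) d F (ff_x, ff_y E, 1) = (f, g, h) \<and>
        h \<noteq> 0 \<and> u = f / h \<and> v = g / h"
  have "?P (f / h) (g / h)" using dF(1) fgh h by blast
  then have "\<exists>p. case p of (u, v) \<Rightarrow> ?P u v"
    by (intro exI[of _ "(f / h, g / h)"]) (simp only: prod.case)
  then have "case pullback_coords E \<phi> of (u, v) \<Rightarrow> ?P u v"
    unfolding pullback_coords_def by (rule someI_ex)
  then have "?P (fst (pullback_coords E \<phi>)) (snd (pullback_coords E \<phi>))"
    by (simp only: case_prod_beta)
  then show ?thesis using that by blast
qed

lemma bij_betw_kernel_fibre:
  assumes hom: "group_hom G H \<psi>" and x: "x \<in> carrier G"
  shows "bij_betw (\<lambda>t. x \<otimes>\<^bsub>G\<^esub> t) (kernel G H \<psi>) {z \<in> carrier G. \<psi> z = \<psi> x}"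
proof -
  interpret group_hom G H \<psi> by (rule hom)
  show ?thesis
  proof (rule bij_betwI')
    fix s t assume "s \<in> kernel G H \<psi>" "t \<in> kernel G H \<psi>"
    then have "s \<in> carrier G" "t \<in> carrier G" unfolding kernel_def by simp_all
    then show "(x \<otimes>\<^bsub>G\<^esub> s = x \<otimes>\<^bsub>G\<^esub> t) = (s = t)" using x by simp
  next
    fix t assume "t \<in> kernel G H \<psi>"
    then show "x \<otimes>\<^bsub>G\<^esub> t \<in> {z \<in> carrier G. \<psi> z = \<psi> x}" using x unfolding kernel_def by simp
  next
    fix z assume "z \<in> {z \<in> carrier G. \<psi> z = \<psi> x}"
    then have z: "z \<in> carrier G" "\<psi> z = \<psi> x" by auto
    have "inv\<^bsub>G\<^esub> x \<otimes>\<^bsub>G\<^esub> z \<in> kernel G H \<psi>"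
      using x z hom_closed[OF x] unfolding kernel_def by (simp add: H.l_inv)
    moreover have "z = x \<otimes>\<^bsub>G\<^esub> (inv\<^bsub>G\<^esub> x \<otimes>\<^bsub>G\<^esub> z)" using x z(1) by (simp flip: G.m_assoc)
    ultimately show "\<exists>t\<in>kernel G H \<psi>. z = x \<otimes>\<^bsub>G\<^esub> t" by blast
  qed
qed

lemma card_kernel_comp:
  assumes h1: "group_hom G H \<psi>" and h2: "group_hom H J \<chi>" and surj: "\<psi> ` carrier G = carrier H"
    and fin: "finite (kernel G H \<psi>)" "finite (kernel H J \<chi>)"
  shows "card (kernel G J (\<chi> \<circ> \<psi>)) = card (kernel H J \<chi>) * card (kernel G H \<psi>)"
    "finite (kernel G J (\<chi> \<circ> \<psi>))"
proof -
  interpret h1: group_hom G H \<psi> by (rule h1)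
  let ?fib = "\<lambda>s. {z \<in> carrier G. \<psi> z = s}"
  have fib: "finite (?fib s) \<and> card (?fib s) = card (kernel G H \<psi>)" if s: "s \<in> kernel H J \<chi>" for s
  proof -
    have "s \<in> \<psi> ` carrier G" using s unfolding surj kernel_def by simp
    then obtain x where x: "x \<in> carrier G" "\<psi> x = s" by blast
    note b = bij_betw_kernel_fibre[OF h1 x(1), unfolded x(2)]
    show ?thesis using bij_betw_finite[OF b] bij_betw_same_card[OF b] fin(1) by simp
  qed
  have eq: "kernel G J (\<chi> \<circ> \<psi>) = (\<Union>s\<in>kernel H J \<chi>. ?fib s)"
    using h1.hom_closed unfolding kernel_def by fastforce
  show "finite (kernel G J (\<chi> \<circ> \<psi>))" unfolding eq using fib fin(2) by blast
  have "card (\<Union>s\<in>kernel H J \<chi>. ?fib s) = (\<Sum>s\<in>kernel H J \<chi>. card (?fib s))"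
    using fib by (intro card_UN_disjoint fin(2)) auto
  also have "\<dots> = card (kernel H J \<chi>) * card (kernel G H \<psi>)" using fib by simp
  finally show "card (kernel G J (\<chi> \<circ> \<psi>)) = card (kernel H J \<chi>) * card (kernel G H \<psi>)" unfolding eq .
qed

text \<open>
  The degree of the isogeny is the product of the degrees of the two minimal polynomials in the tower
  from \<open>M\<close> over \<open>M(x)\<close> to \<open>M(x, y)\<close>, and this is the number of points of a generic fibre.
\<close>

theorem card_kernel_separable_isogeny:
  fixes E E' :: "'k::field weierstrass"
  assumes ell: "elliptic_curve E" "elliptic_curve E'" and sep: "separable_isogeny E E' \<phi>"
    and deg: "isogeny_degree E \<phi> n"
  shows "finite (kernel (geom_group E) (geom_group E') \<phi>)" "card (kernel (geom_group E) (geom_group E') \<phi>) = n"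
    "0 < n"
proof -
  have iso: "isogeny E E' \<phi>" and sepx: "separable_extension (pullback_field E \<phi>) (function_field E)"
    using sep by (auto simp: separable_isogeny_def)
  obtain d F f g h where rep: "represents E \<phi> d F"
    "eval_forms (ff_const \<circ> to_ac) d F (ff_x, ff_y E, 1) = (f, g, h)" "h \<noteq> 0"
    "fst (pullback_coords E \<phi>) = f / h" "snd (pullback_coords E \<phi>) = g / h"
    by (rule pullback_coords_exists[OF ell iso])
  obtain F1 F2 F3 where F: "F = (F1, F2, F3)" by (cases F)
  interpret weierstrass_ring "geom_curve E" poly_embed "ff_y E" by (rule weierstrass_ring_ff)
  interpret group_hom "geom_group E" "geom_group E'" \<phi> by (rule isogeny_group_hom[OF ell iso])
  have "infinite (geom_points E - {Infinity})" using infinite_geom_points[of E] by simp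
  then obtain Q where "Q \<in> geom_points E" "Q \<noteq> Infinity" using infinite_imp_nonempty by blast
  then obtain xa za where "on_curve (geom_curve E) xa za"
    by (cases Q) (auto simp: Affine_in_geom_points)
  then have mem: "f \<in> coord_ring" "g \<in> coord_ring" "h \<in> coord_ring"
    using eval_form_generic(1)[of E] rep(2) by (auto simp: F eval_forms_def)
  interpret weierstrass_map "geom_curve E" poly_embed "ff_y E" f g h
    by unfold_locales (use mem rep(3) in auto)
  have ev: "ev x z f = eval_form to_ac d F1 (x, z, 1)" "ev x z g = eval_form to_ac d F2 (x, z, 1)"
    "ev x z h = eval_form to_ac d F3 (x, z, 1)" if "on_curve (geom_curve E) x z" for x z
    using eval_form_generic(2)[OF that] rep(2) by (auto simp: F eval_forms_def)
  have \<phi>: "\<phi> (Affine x z) = Affine (ev x z f / ev x z h) (ev x z g / ev x z h)"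
    if c: "on_curve (geom_curve E) x z" and h: "ev x z h \<noteq> 0" for x z
  proof -
    have *: "eval_forms to_ac d F (hom_coords (Affine x z)) = (ev x z f, ev x z g, ev x z h)"
      using ev[OF c] by (simp add: F eval_forms_def)
    then have "proj_eq (hom_coords (\<phi> (Affine x z))) (ev x z f, ev x z g, ev x z h)"
      using rep(1) c h unfolding represents_def by (metis Affine_in_geom_points prod.inject)
    then show ?thesis using h by (cases "\<phi> (Affine x z)") (auto simp: proj_eq_def)
  qed
  have rng: "range ff_const = range const" by (auto simp: ff_const_def const_def)
  have xc: "ff_x = xc" by (simp add: ff_x_def)
  have M: "pullback_field E \<phi> = M"
    unfolding pullback_field_def M_def u_def v_def rep(4,5) rng ..
  have L: "function_field E = gen_subfield (range const \<union> {xc, ff_y E})"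
    unfolding function_field_def rng xc ..
  have L2: "function_field E = gen_subfield (gen_subfield (M \<union> {xc}) \<union> {ff_y E})"
  proof -
    have "M \<subseteq> function_field E" using generated_by_xy(1) unfolding L M_def .
    moreover have "is_subfield (function_field E)" "{xc, ff_y E} \<subseteq> function_field E"
      unfolding L using gen_subfield[of "range const \<union> {xc, ff_y E}"] by auto
    ultimately have "gen_subfield (M \<union> {xc, ff_y E}) \<subseteq> function_field E"
      by (intro gen_subfield_minimal) auto
    moreover have "function_field E \<subseteq> gen_subfield (M \<union> {xc, ff_y E})"
      unfolding L using M_props(2) by (intro gen_subfield_mono) auto
    ultimately have "function_field E = gen_subfield (M \<union> {xc, ff_y E})" by blast
    also have "M \<union> {xc, ff_y E} = M \<union> {xc} \<union> {ff_y E}" by auto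
    finally show ?thesis unfolding gen_subfield_gen_subfield .
  qed
  have xyL: "xc \<in> function_field E" "ff_y E \<in> function_field E"
    unfolding L using gen_subfield(2)[of "range const \<union> {xc, ff_y E}"] by auto
  obtain px where px: "is_minpoly M xc px" "rsquarefree px"
    using sepx xyL(1) unfolding separable_extension_def M by blast
  obtain py where py: "is_minpoly M (ff_y E) py" "rsquarefree py"
    using sepx xyL(2) unfolding separable_extension_def M by blast
  obtain m1 where m1: "is_minpoly M xc m1" "poly (pderiv m1) xc \<noteq> 0"
    using minpoly_simple_root_mono[OF M_props(1) order_refl px] .
  have F1: "is_subfield (adjoin M xc)" "M \<subseteq> adjoin M xc"
    using adjoin_subfield[OF M_props(1) m1(1)] adjoin_base(1)[OF is_subfieldD(1)[OF M_props(1)]] by auto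
  obtain m2 where m2: "is_minpoly (adjoin M xc) (ff_y E) m2" "poly (pderiv m2) (ff_y E) \<noteq> 0"
    using minpoly_simple_root_mono[OF F1 py] .
  have "ext_degree M (function_field E) (Polynomial.degree m1 * Polynomial.degree m2)"
    unfolding L2 gen_subfield_insert[OF M_props(1) m1(1)] gen_subfield_insert[OF F1(1) m2(1)]
    by (rule ext_degree_trans[OF M_props(1) F1(1) ext_degree_adjoin[OF M_props(1) m1(1)] ext_degree_adjoin[OF F1(1) m2(1)]])
  then have n: "n = Polynomial.degree m1 * Polynomial.degree m2"
    using deg ext_degree_unique[OF M_props(1)] unfolding isogeny_degree_def M by blast
  show "0 < n" unfolding n using minpoly_degree_pos[OF m1(1)] minpoly_degree_pos[OF m2(1)] by simp
  obtain B where B: "finite B" "\<And>x0 y0. on_curve (geom_curve E) x0 y0 \<Longrightarrow> (x0, y0) \<notin> B \<Longrightarrow> ev x0 y0 h \<noteq> 0 \<and>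
    card {(x, z). on_curve (geom_curve E) x z \<and> ev x z h \<noteq> 0 \<and> ev x z f / ev x z h = ev x0 y0 f / ev x0 y0 h
      \<and> ev x z g / ev x z h = ev x0 y0 g / ev x0 y0 h} = Polynomial.degree m1 * Polynomial.degree m2"
    by (rule card_generic_fibre[OF m1 m2]) blast
  \<comment> \<open>a target point avoiding the images of these has only affine preimages at which \<open>h\<close> does not vanish\<close>
  define B' where "B' = B \<union> {(x, z). on_curve (geom_curve E) x z \<and> ev x z h = 0}"
  have "finite (insert Infinity ((\<lambda>(x, z). \<phi> (Affine x z)) ` B'))"
    unfolding B'_def using B(1) finite_zeros[OF mem(3) rep(3)] by blast
  then have "infinite (geom_points E' - insert Infinity ((\<lambda>(x, z). \<phi> (Affine x z)) ` B'))"
    by (rule Diff_infinite_finite[OF _ infinite_geom_points])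
  then obtain P' where P': "P' \<in> geom_points E'" "P' \<noteq> Infinity" "P' \<notin> (\<lambda>(x, z). \<phi> (Affine x z)) ` B'"
    using infinite_imp_nonempty by blast
  have "\<phi> ` geom_points E = geom_points E'" using iso by (simp add: isogeny_def)
  then have "P' \<in> \<phi> ` geom_points E" using P'(1) by simp
  then obtain Q0 where Q0: "Q0 \<in> geom_points E" "\<phi> Q0 = P'" by blast
  have aff: "\<exists>x z. Q = Affine x z \<and> on_curve (geom_curve E) x z \<and> (x, z) \<notin> B'"
    if Q: "Q \<in> geom_points E" "\<phi> Q = P'" for Q
  proof (cases Q)
    case Infinity
    then show ?thesis using Q P'(2) hom_one by simp
  next
    case (Affine x z)
    then show ?thesis using Q P'(3) by (auto simp: Affine_in_geom_points)
  qed
  obtain x0 y0 where xy0: "Q0 = Affine x0 y0" "on_curve (geom_curve E) x0 y0" "(x0, y0) \<notin> B'"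
    using aff[OF Q0] by blast
  have h0: "ev x0 y0 h \<noteq> 0" using xy0 unfolding B'_def by blast
  let ?S = "{(x, z). on_curve (geom_curve E) x z \<and> ev x z h \<noteq> 0 \<and> ev x z f / ev x z h = ev x0 y0 f / ev x0 y0 h
      \<and> ev x z g / ev x z h = ev x0 y0 g / ev x0 y0 h}"
  let ?fib = "{Q \<in> geom_points E. \<phi> Q = P'}"
  have P'eq: "P' = Affine (ev x0 y0 f / ev x0 y0 h) (ev x0 y0 g / ev x0 y0 h)"
    using \<phi>[OF xy0(2) h0] Q0(2) xy0(1) by simp
  have "?fib = (\<lambda>(x, z). Affine x z) ` ?S"
  proof (intro equalityI subsetI)
    fix Q assume "Q \<in> ?fib"
    then have Q: "Q \<in> geom_points E" "\<phi> Q = P'" by auto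
    obtain x z where xz: "Q = Affine x z" "on_curve (geom_curve E) x z" "(x, z) \<notin> B'" using aff[OF Q] by blast
    have hz: "ev x z h \<noteq> 0" using xz unfolding B'_def by blast
    have "Affine (ev x z f / ev x z h) (ev x z g / ev x z h) = P'" using \<phi>[OF xz(2) hz] Q(2) xz(1) by simp
    then have "(x, z) \<in> ?S" unfolding P'eq using xz(2) hz by simp
    then show "Q \<in> (\<lambda>(x, z). Affine x z) ` ?S" unfolding xz(1) by force
  next
    fix Q assume "Q \<in> (\<lambda>(x, z). Affine x z) ` ?S"
    then obtain x z where xz: "Q = Affine x z" "(x, z) \<in> ?S" by auto
    then have "\<phi> Q = P'" unfolding P'eq xz(1) by (subst \<phi>) auto
    then show "Q \<in> ?fib" using xz by (auto simp: Affine_in_geom_points)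
  qed
  moreover have "inj_on (\<lambda>(x, z). Affine x z) ?S" by (auto intro: inj_onI)
  ultimately have "card ?fib = card ?S" by (simp only: card_image)
  also have "\<dots> = n" unfolding n using B(2)[OF xy0(2)] xy0(3) unfolding B'_def by blast
  finally have card_fib: "card ?fib = n" .
  let ?ker = "kernel (geom_group E) (geom_group E') \<phi>"
  have "bij_betw (\<lambda>T. Q0 \<otimes>\<^bsub>geom_group E\<^esub> T) ?ker ?fib"
    using bij_betw_kernel_fibre[OF group_hom_axioms, of Q0] Q0 by simp
  note bij = this
  show "card ?ker = n" using bij_betw_same_card[OF bij] card_fib by simp
  then show "finite ?ker" using \<open>0 < n\<close> card_ge_0_finite by blast
qed

section \<open>Field automorphisms acting on points\<close>

definition base_hom :: "('k::field alg_closure \<Rightarrow> 'k alg_closure) \<Rightarrow> bool" where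
  "base_hom \<sigma> \<longleftrightarrow> (\<forall>a b. \<sigma> (a + b) = \<sigma> a + \<sigma> b \<and> \<sigma> (a * b) = \<sigma> a * \<sigma> b) \<and> (\<forall>c. \<sigma> (to_ac c) = to_ac c)"

lemma base_homD:
  assumes "base_hom \<sigma>"
  shows "\<sigma> (a + b) = \<sigma> a + \<sigma> b" "\<sigma> (a * b) = \<sigma> a * \<sigma> b" "\<sigma> (to_ac c) = to_ac c"
    "\<sigma> 0 = 0" "\<sigma> 1 = 1" "\<sigma> (- a) = - \<sigma> a" "\<sigma> (a - b) = \<sigma> a - \<sigma> b" "\<sigma> (a ^ n) = \<sigma> a ^ n"
    "\<sigma> (inverse a) = inverse (\<sigma> a)" "\<sigma> (a / b) = \<sigma> a / \<sigma> b" "\<sigma> a = 0 \<longleftrightarrow> a = 0" "\<sigma> a = \<sigma> b \<longleftrightarrow> a = b"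
    "\<sigma> (sum f I) = (\<Sum>i\<in>I. \<sigma> (f i))" "\<sigma> (numeral k) = numeral k"
proof -
  show add: "\<sigma> (a + b) = \<sigma> a + \<sigma> b" and mult: "\<sigma> (a * b) = \<sigma> a * \<sigma> b" and c: "\<sigma> (to_ac c) = to_ac c" for a b c
    using assms by (auto simp: base_hom_def)
  show zero: "\<sigma> 0 = 0" using c[of 0] by simp
  show one: "\<sigma> 1 = 1" using c[of 1] by simp
  show minus: "\<sigma> (- a) = - \<sigma> a" for a using add[of a "- a"] zero by (simp add: minus_unique)
  show diff: "\<sigma> (a - b) = \<sigma> a - \<sigma> b" for a b using add[of a "- b"] minus[of b] by simp
  show "\<sigma> (a ^ n) = \<sigma> a ^ n" by (induction n) (simp_all add: one mult)
  show inv: "\<sigma> (inverse a) = inverse (\<sigma> a)" for a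
  proof (cases "a = 0")
    case False
    then have "\<sigma> a * \<sigma> (inverse a) = 1" using mult[of a "inverse a"] one by simp
    then show ?thesis by (metis inverse_unique)
  qed (simp add: zero)
  show "\<sigma> (a / b) = \<sigma> a / \<sigma> b" by (simp only: divide_inverse mult inv)
  show z: "\<sigma> a = 0 \<longleftrightarrow> a = 0" for a
    using mult[of a "inverse a"] one zero by (cases "a = 0") auto
  show "\<sigma> a = \<sigma> b \<longleftrightarrow> a = b" using z[of "a - b"] diff[of a b] by simp
  show "\<sigma> (sum f I) = (\<Sum>i\<in>I. \<sigma> (f i))"
    by (induction I rule: infinite_finite_induct) (simp_all add: zero add)
  show "\<sigma> (numeral k) = numeral k" using c[of "numeral k"] by simp
qed

lemma base_hom_geom_curve:
  assumes "base_hom \<sigma>"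
  shows "\<sigma> (wa1 (geom_curve E)) = wa1 (geom_curve E)" "\<sigma> (wa2 (geom_curve E)) = wa2 (geom_curve E)"
    "\<sigma> (wa3 (geom_curve E)) = wa3 (geom_curve E)" "\<sigma> (wa4 (geom_curve E)) = wa4 (geom_curve E)"
    "\<sigma> (wa6 (geom_curve E)) = wa6 (geom_curve E)"
  by (simp_all add: weierstrass.map_sel base_homD(3)[OF assms])

lemma base_hom_geom_points:
  assumes s: "base_hom \<sigma>" and P: "P \<in> geom_points E"
  shows "map_point \<sigma> P \<in> geom_points E"
proof (cases P)
  case (Affine x z)
  note h = base_homD[OF s] and c = base_hom_geom_curve[OF s, of E]
  let ?W = "geom_curve E"
  have "on_curve ?W x z" using P by (simp add: Affine Affine_in_geom_points)
  then have "\<sigma> (z ^ 2 + wa1 ?W * x * z + wa3 ?W * z) = \<sigma> (x ^ 3 + wa2 ?W * x ^ 2 + wa4 ?W * x + wa6 ?W)"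
    by (simp only: on_curve_def)
  then have "on_curve ?W (\<sigma> x) (\<sigma> z)" unfolding on_curve_def h c .
  then show ?thesis by (simp add: Affine Affine_in_geom_points)
qed (simp add: Infinity_in_geom_points)

lemma base_hom_point_add:
  assumes s: "base_hom \<sigma>"
  shows "map_point \<sigma> (point_add (geom_curve E) P Q) = point_add (geom_curve E) (map_point \<sigma> P) (map_point \<sigma> Q)"
proof (cases P; cases Q)
  note h = base_homD[OF s] and c = base_hom_geom_curve[OF s, of E]
  let ?W = "geom_curve E"
  fix x1 y1 x2 y2 assume PQ: "P = Affine x1 y1" "Q = Affine x2 y2"
  have "\<sigma> (y1 + y2 + wa1 ?W * x2 + wa3 ?W) = \<sigma> y1 + \<sigma> y2 + wa1 ?W * \<sigma> x2 + wa3 ?W"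
    by (simp only: h c)
  then have opp: "\<sigma> x1 = \<sigma> x2 \<and> \<sigma> y1 + \<sigma> y2 + wa1 ?W * \<sigma> x2 + wa3 ?W = 0 \<longleftrightarrow>
      x1 = x2 \<and> y1 + y2 + wa1 ?W * x2 + wa3 ?W = 0"
    using h(11)[of "y1 + y2 + wa1 ?W * x2 + wa3 ?W"] h(12)[of x1 x2] by simp
  show ?thesis
  proof (cases "x1 = x2 \<and> y1 + y2 + wa1 ?W * x2 + wa3 ?W = 0")
    case True
    show ?thesis unfolding PQ point.map point_add.simps if_P[OF True] if_P[OF opp[THEN iffD2, OF True]] ..
  next
    case False
    then have False': "\<not> (\<sigma> x1 = \<sigma> x2 \<and> \<sigma> y1 + \<sigma> y2 + wa1 ?W * \<sigma> x2 + wa3 ?W = 0)"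
      using opp by blast
    show ?thesis
    proof (cases "x1 = x2")
      case eq: True
      then have eq': "\<sigma> x1 = \<sigma> x2" by simp
      show ?thesis
        unfolding PQ point.map point_add.simps if_not_P[OF False] if_not_P[OF False']
          if_P[OF eq] if_P[OF eq'] Let_def point.map h(1,2,6,7,8,10,14) c ..
    next
      case ne: False
      then have ne': "\<sigma> x1 \<noteq> \<sigma> x2" using h(12) by simp
      show ?thesis
        unfolding PQ point.map point_add.simps if_not_P[OF False] if_not_P[OF False']
          if_not_P[OF ne] if_not_P[OF ne'] Let_def point.map h(1,2,6,7,8,10,14) c ..
    qed
  qed
qed auto

lemma eval_form_base_hom:
  assumes s: "base_hom \<sigma>"
  shows "eval_form to_ac d c (\<sigma> x, \<sigma> y, \<sigma> z) = \<sigma> (eval_form to_ac d c (x, y, z))"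
  unfolding eval_form_def prod.case base_homD[OF s] ..

lemma hom_coords_base_hom:
  assumes s: "base_hom \<sigma>"
  shows "hom_coords (map_point \<sigma> P) = (case hom_coords P of (x, y, z) \<Rightarrow> (\<sigma> x, \<sigma> y, \<sigma> z))"
  by (cases P) (simp_all add: base_homD(4,5)[OF s])

lemma proj_eq_hom_coords_inj:
  assumes "proj_eq (hom_coords P) w" "proj_eq (hom_coords Q) w" shows "P = Q"
  using assms by (cases P; cases Q) (auto simp: proj_eq_def)

text \<open>
  The forms that represent \<open>\<phi>\<close> have coefficients in \<open>k\<close>, so they commute with \<open>\<sigma>\<close>.
\<close>

lemma isogeny_base_hom:
  assumes s: "base_hom \<sigma>" and iso: "isogeny E E' \<phi>" and Q: "Q \<in> geom_points E"
  shows "\<phi> (map_point \<sigma> Q) = map_point \<sigma> (\<phi> Q)"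
proof -
  note h = base_homD[OF s]
  obtain d F where dF: "represents E \<phi> d F" "eval_forms to_ac d F (hom_coords Q) \<noteq> (0, 0, 0)"
    using iso Q unfolding isogeny_def morphism_over_def by blast
  obtain F1 F2 F3 where F: "F = (F1, F2, F3)" by (cases F)
  obtain x y z where xyz: "hom_coords Q = (x, y, z)" by (rule prod_cases3)
  obtain a b c where abc: "eval_forms to_ac d F (x, y, z) = (a, b, c)" by (rule prod_cases3)
  obtain x' y' z' where xyz': "hom_coords (\<phi> Q) = (x', y', z')" by (rule prod_cases3)
  have coords: "hom_coords (map_point \<sigma> Q) = (\<sigma> x, \<sigma> y, \<sigma> z)"
    by (simp add: hom_coords_base_hom[OF s] xyz)
  have ev: "eval_forms to_ac d F (hom_coords (map_point \<sigma> Q)) = (\<sigma> a, \<sigma> b, \<sigma> c)"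
    using abc unfolding coords by (auto simp: F eval_forms_def eval_form_base_hom[OF s])
  have "proj_eq (x', y', z') (a, b, c)"
    using dF Q unfolding represents_def by (metis abc xyz xyz')
  then obtain k where k: "k \<noteq> 0" "a = k * x'" "b = k * y'" "c = k * z'" by (auto simp: proj_eq_def)
  have 1: "proj_eq (hom_coords (map_point \<sigma> (\<phi> Q))) (\<sigma> a, \<sigma> b, \<sigma> c)"
    unfolding hom_coords_base_hom[OF s] xyz' proj_eq_def prod.case
    using k by (intro exI[of _ "\<sigma> k"]) (simp add: h)
  have "(\<sigma> a, \<sigma> b, \<sigma> c) \<noteq> (0, 0, 0)" using dF(2) abc xyz by (simp add: h(11))
  then have "proj_eq (hom_coords (\<phi> (map_point \<sigma> Q))) (\<sigma> a, \<sigma> b, \<sigma> c)"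
    using dF(1) base_hom_geom_points[OF s Q] ev unfolding represents_def by metis
  then show ?thesis using 1 proj_eq_hom_coords_inj by blast
qed

lemma is_subfield_field_of_definition:
  "is_subfield (field_of_definition R)" "range to_ac \<subseteq> field_of_definition R" "coordinates R \<subseteq> field_of_definition R"
  unfolding field_of_definition_def using gen_subfield[of "range to_ac \<union> coordinates R"] by auto

lemma field_of_definition_isogeny:
  assumes iso: "isogeny E E' \<phi>" and Q: "Q \<in> geom_points E"
  shows "field_of_definition (\<phi> Q) \<subseteq> field_of_definition Q"
proof -
  let ?L = "field_of_definition Q"
  note L = is_subfield_field_of_definition[of Q]
  note R = is_subringD[OF is_subfieldD(1)[OF L(1)]]
  obtain d F where dF: "represents E \<phi> d F" "eval_forms to_ac d F (hom_coords Q) \<noteq> (0, 0, 0)"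
    using iso Q unfolding isogeny_def morphism_over_def by blast
  obtain F1 F2 F3 where F: "F = (F1, F2, F3)" by (cases F)
  obtain x y z where xyz: "hom_coords Q = (x, y, z)" by (rule prod_cases3)
  have mem: "x \<in> ?L" "y \<in> ?L" "z \<in> ?L"
    using xyz L(3) R(1,5) by (cases Q; auto)+
  have ev: "eval_form to_ac d c (x, y, z) \<in> ?L" for c
  proof -
    have "to_ac (c i j) \<in> ?L" for i j using L(2) by blast
    then show ?thesis unfolding eval_form_def prod.case
      by (intro R(8) R(3) R(7) mem)
  qed
  have pe: "proj_eq (hom_coords (\<phi> Q)) (eval_forms to_ac d F (hom_coords Q))"
    using dF Q unfolding represents_def by blast
  have "coordinates (\<phi> Q) \<subseteq> ?L"
  proof (cases "\<phi> Q")
    case (Affine a b)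
    obtain k where k: "k \<noteq> 0" "eval_form to_ac d F1 (x, y, z) = k * a" "eval_form to_ac d F2 (x, y, z) = k * b"
      "eval_form to_ac d F3 (x, y, z) = k"
      using pe unfolding Affine xyz F by (auto simp: proj_eq_def eval_forms_def)
    have kL: "k \<in> ?L" "k * a \<in> ?L" "k * b \<in> ?L" using ev[of F1] ev[of F2] ev[of F3] k(2-4) by simp_all
    have "(k * a) / k \<in> ?L" "(k * b) / k \<in> ?L" using kL is_subfieldD(3)[OF L(1)] by blast+
    then show ?thesis using k(1) by (simp add: Affine)
  qed simp
  then show ?thesis using L(1,2) unfolding field_of_definition_def[of "\<phi> Q"]
    by (intro gen_subfield_minimal) auto
qed

section \<open>The Frobenius of a finite subfield\<close>

lemma base_hom_frobenius:
  fixes F :: "'k::{field, finite} alg_closure set"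
  assumes F: "is_subfield F" "finite F" "range to_ac \<subseteq> F"
  shows "base_hom (\<lambda>a::'k alg_closure. a ^ card F ^ j)"
proof -
  obtain m where m: "card F = CHAR('k) ^ m" by (rule card_finite_subfield[OF F(1,2)])
  have N: "card F ^ j = CHAR('k alg_closure) ^ (m * j)" by (simp add: m power_mult)
  have additive: "(a + b) ^ card F ^ j = a ^ card F ^ j + b ^ card F ^ j" for a b :: "'k alg_closure"
    by (rule freshmans_dream'[OF _ N]) (simp add: CHAR_finite_prime)
  have const: "to_ac c ^ card F ^ j = to_ac c" for c :: 'k
  proof (induction j)
    case (Suc j)
    have "to_ac c \<in> F" using F(3) by blast
    then have "to_ac c ^ card F = to_ac c" by (rule finite_subfield_power_card[OF F(1,2)])
    then show ?case using Suc unfolding power_Suc power_mult by simp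
  qed simp
  show ?thesis
    unfolding base_hom_def
  proof (intro conjI allI)
    show "(a + b) ^ card F ^ j = a ^ card F ^ j + b ^ card F ^ j" for a b :: "'k alg_closure"
      by (rule additive)
    show "(a * b) ^ card F ^ j = a ^ card F ^ j * b ^ card F ^ j" for a b :: "'k alg_closure"
      by (rule power_mult_distrib)
    show "to_ac c ^ card F ^ j = to_ac c" for c :: 'k
      by (rule const)
  qed
qed

lemma map_point_fixed_iff: "map_point \<sigma> R = R \<longleftrightarrow> (\<forall>a\<in>coordinates R. \<sigma> a = a)"
  by (cases R) auto

lemma fixed_field:
  assumes "base_hom \<sigma>"
  shows "is_subfield {a. \<sigma> a = a}" "range to_ac \<subseteq> {a. \<sigma> a = a}"
  using base_homD[OF assms] by (auto simp: is_subfield_def is_subring_def)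

lemma map_point_fixed_iff_field:
  assumes "base_hom \<sigma>"
  shows "map_point \<sigma> R = R \<longleftrightarrow> field_of_definition R \<subseteq> {a. \<sigma> a = a}"
proof
  assume "map_point \<sigma> R = R"
  then show "field_of_definition R \<subseteq> {a. \<sigma> a = a}"
    unfolding field_of_definition_def map_point_fixed_iff
    using fixed_field[OF assms] by (intro gen_subfield_minimal) auto
next
  assume "field_of_definition R \<subseteq> {a. \<sigma> a = a}"
  then show "map_point \<sigma> R = R"
    unfolding map_point_fixed_iff using is_subfield_field_of_definition(3)[of R] by blast
qed

text \<open>
  The field of definition of \<open>R\<close> has \<open>card F ^ d\<close> elements, so raising to this power fixes it. Conversely, if
  the \<open>r\<close>-th power of Frobenius fixes \<open>R\<close>, it fixes this whole field; but at most \<open>card F ^ r\<close> elements can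
  be fixed.
\<close>

lemma ext_degree_eq_period:
  fixes R :: "'k::{field, finite} alg_closure point"
  assumes F: "is_subfield F" "finite F" "range to_ac \<subseteq> F"
    and d: "ext_degree F (field_of_definition R) d"
  shows "0 < r \<Longrightarrow> map_point (\<lambda>a. a ^ card F ^ r) R = R \<Longrightarrow> d \<le> r"
    and "map_point (\<lambda>a. a ^ card F ^ d) R = R" and "0 < d"
proof -
  let ?L = "field_of_definition R"
  have L: "is_subfield ?L" "finite ?L" using is_subfield_field_of_definition(1) finite_field_of_definition by auto
  have card: "card ?L = card F ^ d" using card_ext_degree[OF F(1,2) d] by simp
  have F2: "2 \<le> card F" by (rule card_subfield_ge_2[OF F(1,2)])
  have "card ?L \<noteq> 1" using card_subfield_ge_2[OF L] by simp
  then show "0 < d" using card by (cases d) auto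
  show "map_point (\<lambda>a. a ^ card F ^ d) R = R"
    unfolding map_point_fixed_iff_field[OF base_hom_frobenius[OF F]]
    using finite_subfield_power_card[OF L] unfolding card by blast
  assume r: "0 < r" "map_point (\<lambda>a. a ^ card F ^ r) R = R"
  have "card F ^ 1 \<le> card F ^ r" using r(1) F2 by (intro power_increasing) auto
  then have N: "2 \<le> card F ^ r" using F2 by simp
  have "?L \<subseteq> {a. a ^ card F ^ r = a}"
    using r(2) unfolding map_point_fixed_iff_field[OF base_hom_frobenius[OF F]] .
  then have "card ?L \<le> card {a :: 'k alg_closure. a ^ card F ^ r = a}"
    using card_power_fixed_le(1)[OF N] by (intro card_mono)
  also have "\<dots> \<le> card F ^ r" by (rule card_power_fixed_le(2)[OF N])
  finally show "d \<le> r" unfolding card using F2 by (simp add: power_le_imp_le_exp)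
qed

section \<open>Cyclic groups\<close>

text \<open>
  Let \<open>g\<close> generate \<open>C\<close> and \<open>T = g\<^sup>a\<close>. It is enough that \<open>a\<close> is coprime to \<open>l0 l1\<close>. Any common prime factor \<open>p\<close>
  would divide \<open>l0\<close>, and \<open>T\<close> would be the \<open>p\<close>-th power of an element \<open>S\<close> of \<open>C\<close>. As the image of \<open>S\<close> is
  annihilated by \<open>l0\<close>, that of \<open>T\<close> would be annihilated by \<open>l0 / p\<close>.
\<close>

lemma cyclic_lift_generator:
  assumes hom: "group_hom G H \<psi>" and C: "subgroup C G" and cyc: "cyclic_group (G\<lparr>carrier := C\<rparr>)"
    and fin: "finite C" and card: "card C = l0 * l1" and T: "T \<in> C"
    and exp: "\<And>S. S \<in> C \<Longrightarrow> \<psi> S [^]\<^bsub>H\<^esub> l0 = \<one>\<^bsub>H\<^esub>"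
    and gen: "\<And>r::nat. 0 < r \<Longrightarrow> \<psi> T [^]\<^bsub>H\<^esub> r = \<one>\<^bsub>H\<^esub> \<Longrightarrow> l0 \<le> r"
    and primes: "\<And>p. Factorial_Ring.prime p \<Longrightarrow> p dvd l1 \<Longrightarrow> p dvd l0"
    and r: "T [^]\<^bsub>G\<^esub> (r::nat) = \<one>\<^bsub>G\<^esub>"
  shows "l0 * l1 dvd r"
proof -
  interpret group_hom G H \<psi> by (rule hom)
  let ?C = "G\<lparr>carrier := C\<rparr>"
  interpret C: group ?C by (rule subgroup.subgroup_is_group[OF C G.group_axioms])
  obtain g where g: "g \<in> C" and sg: "subgroup_generated ?C {g} = ?C"
    using cyc unfolding cyclic_group_def by auto
  have "generate ?C (carrier ?C \<inter> {g}) = carrier ?C"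
    unfolding carrier_subgroup_generated[symmetric] sg ..
  then have gC: "generate ?C {g} = C" using g by simp
  have ordg: "C.ord g = l0 * l1"
    using C.generate_pow_card[of g] g gC card by simp
  have "C \<noteq> {}" using g by blast
  then have "0 < l0 * l1" using card fin card_gt_0_iff[of C] by simp
  then have l0: "0 < l0" by simp
  have pow: "x [^]\<^bsub>?C\<^esub> (n::nat) = x [^]\<^bsub>G\<^esub> n" for x n by (rule G.nat_pow_consistent[symmetric])
  have "T \<in> generate ?C {g}" using T gC by simp
  then obtain a :: nat where a: "T = g [^]\<^bsub>G\<^esub> a"
    using C.generate_pow_nat[of g] g ordg \<open>0 < l0 * l1\<close> pow by auto
  have gG: "g \<in> carrier G" using g subgroup.subset[OF C] by blast
  have "g [^]\<^bsub>G\<^esub> (a * r) = \<one>\<^bsub>G\<^esub>" using r unfolding a by (simp add: G.nat_pow_pow[OF gG])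
  then have dvd: "l0 * l1 dvd a * r"
    using C.pow_eq_id[of g "a * r"] g pow ordg by simp
  have "coprime (l0 * l1) a"
  proof (rule ccontr)
    assume "\<not> coprime (l0 * l1) a"
    \<comment> \<open>then \<open>T\<close> is a \<open>p\<close>-th power in \<open>C\<close> (groups are written multiplicatively)\<close>
    then obtain p where p: "Factorial_Ring.prime p" "p dvd l0 * l1" "p dvd a"
      by (metis coprime_iff_gcd_eq_1 gcd_nat.boundedE prime_factor_nat)
    then have "p dvd l0" using primes by (auto simp: prime_dvd_mult_iff)
    then obtain l0' where l0': "l0 = p * l0'" by (auto elim: dvdE)
    obtain a' where a': "a = p * a'" using p(3) by (auto elim: dvdE)
    let ?S = "g [^]\<^bsub>G\<^esub> a'"
    have S: "?S \<in> C" using C.nat_pow_closed[of g a'] g pow by simp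
    then have SG: "?S \<in> carrier G" using subgroup.subset[OF C] by blast
    have TS: "T = ?S [^]\<^bsub>G\<^esub> p" unfolding a a' by (simp add: G.nat_pow_pow[OF gG] mult.commute)
    have "\<psi> T [^]\<^bsub>H\<^esub> l0' = \<psi> ?S [^]\<^bsub>H\<^esub> l0"
      unfolding TS l0' hom_nat_pow[OF SG] by (rule H.nat_pow_pow[OF hom_closed[OF SG]])
    also have "\<dots> = \<one>\<^bsub>H\<^esub>" by (rule exp[OF S])
    finally have "l0 \<le> l0'" using gen[of l0'] l0 l0' by simp
    then have "p * l0' \<le> 1 * l0'" using l0' by simp
    moreover have "0 < l0'" using l0 l0' by simp
    ultimately have "p \<le> 1" by simp
    then show False using prime_gt_1_nat[OF p(1)] by simp
  qed
  then show ?thesis using dvd by (simp add: coprime_dvd_mult_right_iff)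
qed

theorem theorem2p2:
  fixes E0 E1 E2 :: "'k::{field, finite} weierstrass"
    and \<phi>0 \<phi>1 :: "'k alg_closure point \<Rightarrow> 'k alg_closure point"
    and l0 l1 :: nat
    and P :: "'k alg_closure point"
  defines "C \<equiv> kernel (geom_group E2) (geom_group E0) (\<phi>0 \<circ> \<phi>1)"
  assumes "elliptic_curve E0" and "elliptic_curve E1" and "elliptic_curve E2"
    and "separable_isogeny E1 E0 \<phi>0" and "isogeny_degree E1 \<phi>0 l0"
    and "separable_isogeny E2 E1 \<phi>1" and "isogeny_degree E2 \<phi>1 l1"
    and "\<And>p. \<lbrakk>Factorial_Ring.prime p; p dvd l1\<rbrakk> \<Longrightarrow> p dvd l0"
    and "P \<in> geom_points E0"
    and "cyclic_group (geom_group E2\<lparr>carrier := C\<rparr>)"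
    and "\<And>T. T \<in> C \<Longrightarrow> field_of_definition T \<subseteq> field_of_definition P"
  shows "\<forall>Q\<in>geom_points E2. (\<phi>0 \<circ> \<phi>1) Q = P \<longrightarrow>
           ext_degree (field_of_definition P) (field_of_definition (\<phi>1 Q)) l0 \<longrightarrow>
           ext_degree (field_of_definition P) (field_of_definition Q) (l0 * l1)"
proof (intro ballI impI)
  note ell0 = assms(2) and ell1 = assms(3) and ell2 = assms(4)
  note sep0 = assms(5) and deg0 = assms(6) and sep1 = assms(7) and deg1 = assms(8)
  note primes = assms(9) and cyc = assms(11) and rational = assms(12)
  fix Q assume Q: "Q \<in> geom_points E2" and QP: "(\<phi>0 \<circ> \<phi>1) Q = P"
    and ext: "ext_degree (field_of_definition P) (field_of_definition (\<phi>1 Q)) l0"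
  let ?G0 = "geom_group E0" and ?G1 = "geom_group E1" and ?G2 = "geom_group E2"
  have iso0: "isogeny E1 E0 \<phi>0" and iso1: "isogeny E2 E1 \<phi>1"
    using sep0 sep1 by (auto simp: separable_isogeny_def)
  interpret h1: group_hom ?G2 ?G1 \<phi>1 by (rule isogeny_group_hom[OF ell2 ell1 iso1])
  interpret h0: group_hom ?G1 ?G0 \<phi>0 by (rule isogeny_group_hom[OF ell1 ell0 iso0])
  have hom: "group_hom ?G2 ?G0 (\<phi>0 \<circ> \<phi>1)"
    using hom_compose[OF h1.homh h0.homh] h1.G.group_axioms h0.H.group_axioms
    by (simp add: group_hom_def group_hom_axioms_def)
  interpret h: group_hom ?G2 ?G0 "\<phi>0 \<circ> \<phi>1" by (rule hom)
  note ker0 = card_kernel_separable_isogeny[OF ell1 ell0 sep0 deg0]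
  note ker1 = card_kernel_separable_isogeny[OF ell2 ell1 sep1 deg1]
  have "\<phi>1 ` carrier ?G2 = carrier ?G1" using iso1 by (simp add: isogeny_def)
  note kerC = card_kernel_comp[OF h1.group_hom_axioms h0.group_hom_axioms this ker1(1) ker0(1)]
  have finC: "finite C" and cardC: "card C = l0 * l1"
    unfolding C_def using kerC ker0(2) ker1(2) by simp_all
  have C: "subgroup C ?G2" unfolding C_def by (rule h.subgroup_kernel)
  define F where "F = field_of_definition P"
  have F: "is_subfield F" "finite F" "range to_ac \<subseteq> F"
    unfolding F_def using is_subfield_field_of_definition[of P] finite_field_of_definition[of P] by auto
  define \<sigma> where "\<sigma> j = map_point (\<lambda>a::'k alg_closure. a ^ card F ^ j)" for j
  have base: "base_hom (\<lambda>a::'k alg_closure. a ^ card F ^ j)" for j by (rule base_hom_frobenius[OF F])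
  have fixF: "\<sigma> j R = R" if "field_of_definition R \<subseteq> F" for j R
  proof -
    have "a ^ card F ^ j = a" if "a \<in> F" for a
    proof (induction j)
      case (Suc j)
      then show ?case using finite_subfield_power_card[OF F(1,2) that] unfolding power_Suc power_mult by simp
    qed simp
    then show ?thesis unfolding \<sigma>_def map_point_fixed_iff_field[OF base] using that by blast
  qed
  have \<sigma>_add: "\<sigma> j (R \<otimes>\<^bsub>geom_group E\<^esub> S) = \<sigma> j R \<otimes>\<^bsub>geom_group E\<^esub> \<sigma> j S" for j R S and E :: "'k weierstrass"
    unfolding \<sigma>_def using base_hom_point_add[OF base] by simp
  have \<sigma>_closed: "\<sigma> j R \<in> geom_points E2" if "R \<in> geom_points E2" for j R
    unfolding \<sigma>_def by (rule base_hom_geom_points[OF base that])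
  have \<sigma>_\<phi>1: "\<phi>1 (\<sigma> j R) = \<sigma> j (\<phi>1 R)" if "R \<in> geom_points E2" for j R
    unfolding \<sigma>_def by (rule isogeny_base_hom[OF base iso1 that])
  have \<sigma>_\<phi>0: "\<phi>0 (\<sigma> j R) = \<sigma> j (\<phi>0 R)" if "R \<in> geom_points E1" for j R
    unfolding \<sigma>_def by (rule isogeny_base_hom[OF base iso0 that])
  have QG: "Q \<in> carrier ?G2" using Q by simp
  have Q1: "\<phi>1 Q \<in> carrier ?G1" by (rule h1.hom_closed[OF QG])
  have \<sigma>Q: "\<sigma> 1 Q \<in> carrier ?G2" using \<sigma>_closed[OF Q] by simp
  \<comment> \<open>Frobenius moves \<open>Q\<close> by a point of the kernel\<close>
  define T where "T = inv\<^bsub>?G2\<^esub> Q \<otimes>\<^bsub>?G2\<^esub> \<sigma> 1 Q"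
  have TG: "T \<in> carrier ?G2" unfolding T_def using QG \<sigma>Q by (intro h1.G.m_closed h1.G.inv_closed)
  have \<sigma>QT: "\<sigma> 1 Q = Q \<otimes>\<^bsub>?G2\<^esub> T"
    unfolding T_def using h1.G.m_assoc[OF QG h1.G.inv_closed[OF QG] \<sigma>Q] h1.G.r_inv[OF QG] h1.G.l_one[OF \<sigma>Q]
    by (simp del: geom_group_simps)
  have "(\<phi>0 \<circ> \<phi>1) (\<sigma> 1 Q) = \<sigma> 1 P"
    using \<sigma>_\<phi>1[OF Q] \<sigma>_\<phi>0[of "\<phi>1 Q"] Q1 QP by simp
  also have "\<sigma> 1 P = P" by (rule fixF) (simp add: F_def)
  finally have "(\<phi>0 \<circ> \<phi>1) (\<sigma> 1 Q) = (\<phi>0 \<circ> \<phi>1) Q" unfolding QP .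
  then have "(\<phi>0 \<circ> \<phi>1) T = \<one>\<^bsub>?G0\<^esub>"
    unfolding T_def h.hom_mult[OF h1.G.inv_closed[OF QG] \<sigma>Q] h.hom_inv[OF QG]
    using h0.H.l_inv[OF h.hom_closed[OF QG]] by (simp del: geom_group_simps)
  then have TC: "T \<in> C" unfolding C_def kernel_def using TG by blast
  have powC: "S [^]\<^bsub>?G2\<^esub> (j::nat) \<in> C" if "S \<in> C" for S j
    by (induction j) (simp_all del: geom_group_simps add: subgroup.one_closed[OF C] subgroup.m_closed[OF C] that)
  have \<sigma>C: "\<sigma> j S = S" if "S \<in> C" for S j using rational[OF that] by (intro fixF) (simp add: F_def)
  have \<sigma>Qj: "\<sigma> j Q = Q \<otimes>\<^bsub>?G2\<^esub> T [^]\<^bsub>?G2\<^esub> j" for j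
  proof (induction j)
    case 0
    have "\<sigma> 0 Q = Q" unfolding \<sigma>_def by (simp add: point.map_ident)
    then show ?case using h1.G.r_one[OF QG] by (simp del: geom_group_simps)
  next
    case (Suc j)
    have "\<sigma> (Suc j) Q = \<sigma> 1 (\<sigma> j Q)"
      unfolding \<sigma>_def point.map_comp comp_def by (simp add: power_mult[symmetric] mult.commute)
    also have "\<dots> = \<sigma> 1 Q \<otimes>\<^bsub>?G2\<^esub> T [^]\<^bsub>?G2\<^esub> j" unfolding Suc \<sigma>_add \<sigma>C[OF powC[OF TC]] ..
    also have "\<dots> = Q \<otimes>\<^bsub>?G2\<^esub> (T \<otimes>\<^bsub>?G2\<^esub> T [^]\<^bsub>?G2\<^esub> j)"
      unfolding \<sigma>QT by (rule h1.G.m_assoc[OF QG TG h1.G.nat_pow_closed[OF TG]])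
    also have "T \<otimes>\<^bsub>?G2\<^esub> T [^]\<^bsub>?G2\<^esub> j = T [^]\<^bsub>?G2\<^esub> Suc j" by (rule h1.G.nat_pow_Suc2[OF TG, symmetric])
    finally show ?case .
  qed
  have period: "\<sigma> j Q = Q \<longleftrightarrow> T [^]\<^bsub>?G2\<^esub> j = \<one>\<^bsub>?G2\<^esub>" for j
    unfolding \<sigma>Qj using h1.G.r_cancel_one[OF QG h1.G.nat_pow_closed[OF TG]] h1.G.l_cancel_one[OF QG h1.G.nat_pow_closed[OF TG]]
    by simp
  have period1: "\<sigma> j (\<phi>1 Q) = \<phi>1 Q" if "\<phi>1 T [^]\<^bsub>?G1\<^esub> j = \<one>\<^bsub>?G1\<^esub>" for j
    unfolding \<sigma>_\<phi>1[OF Q, symmetric] \<sigma>Qj h1.hom_mult[OF QG h1.G.nat_pow_closed[OF TG]] h1.hom_nat_pow[OF TG] that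
    by (rule h1.H.r_one[OF Q1])
  have gen: "l0 \<le> r" if "0 < r" "\<phi>1 T [^]\<^bsub>?G1\<^esub> r = \<one>\<^bsub>?G1\<^esub>" for r :: nat
    using ext_degree_eq_period(1)[OF F ext[folded F_def] that(1)] period1[OF that(2)] unfolding \<sigma>_def by blast
  have exp: "\<phi>1 S [^]\<^bsub>?G1\<^esub> l0 = \<one>\<^bsub>?G1\<^esub>" if S: "S \<in> C" for S
  proof -
    let ?K = "kernel ?G1 ?G0 \<phi>0"
    have SK: "\<phi>1 S \<in> ?K" using S h1.hom_closed unfolding C_def kernel_def by simp
    have "subgroup ?K ?G1" by (rule h0.subgroup_kernel)
    then interpret K: group "?G1\<lparr>carrier := ?K\<rparr>" by (rule subgroup.subgroup_is_group[OF _ h1.H.group_axioms])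
    have "\<phi>1 S [^]\<^bsub>?G1\<lparr>carrier := ?K\<rparr>\<^esub> Coset.order (?G1\<lparr>carrier := ?K\<rparr>) = \<one>\<^bsub>?G1\<lparr>carrier := ?K\<rparr>\<^esub>"
      by (rule K.pow_order_eq_1) (simp add: SK)
    moreover have "Coset.order (?G1\<lparr>carrier := ?K\<rparr>) = l0" unfolding Coset.order_def using ker0(2) by simp
    ultimately show ?thesis by (simp add: h1.H.nat_pow_consistent[symmetric] del: geom_group_simps)
  qed
  have dvd: "l0 * l1 dvd r" if "T [^]\<^bsub>?G2\<^esub> r = \<one>\<^bsub>?G2\<^esub>" for r :: nat
    by (rule cyclic_lift_generator[OF h1.group_hom_axioms C cyc finC cardC TC exp gen primes that])
  have L: "F \<subseteq> field_of_definition Q"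
    using ext field_of_definition_isogeny[OF iso1 Q] unfolding ext_degree_def F_def by blast
  obtain d where d: "ext_degree F (field_of_definition Q) d"
    by (rule finite_ext_degree_exists[OF F(1) is_subfield_field_of_definition(1) L finite_field_of_definition])
  note per = ext_degree_eq_period[OF F d]
  have "l0 * l1 dvd d" using per(2) period[of d] dvd unfolding \<sigma>_def by blast
  then have "l0 * l1 \<le> d" using per(3) by (rule dvd_imp_le)
  moreover have "d \<le> l0 * l1"
  proof (rule per(1))
    show "0 < l0 * l1" using ker0(3) ker1(3) by simp
    interpret C: group "?G2\<lparr>carrier := C\<rparr>" by (rule subgroup.subgroup_is_group[OF C h1.G.group_axioms])
    have "T [^]\<^bsub>?G2\<lparr>carrier := C\<rparr>\<^esub> Coset.order (?G2\<lparr>carrier := C\<rparr>) = \<one>\<^bsub>?G2\<lparr>carrier := C\<rparr>\<^esub>"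
      by (rule C.pow_order_eq_1) (simp add: TC)
    moreover have "Coset.order (?G2\<lparr>carrier := C\<rparr>) = l0 * l1" unfolding Coset.order_def using cardC by simp
    ultimately have "T [^]\<^bsub>?G2\<^esub> (l0 * l1) = \<one>\<^bsub>?G2\<^esub>"
      by (simp add: h1.G.nat_pow_consistent[symmetric] del: geom_group_simps)
    then show "map_point (\<lambda>a. a ^ card F ^ (l0 * l1)) Q = Q" using period[of "l0 * l1"] unfolding \<sigma>_def by simp
  qed
  ultimately have "d = l0 * l1" by simp
  then show "ext_degree (field_of_definition P) (field_of_definition Q) (l0 * l1)" using d unfolding F_def by simp
qed

end
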